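(* Consider the $d$-dimensional Black–Scholes market, contingent claim $H$, and functions $\Phi_1,\Phi_2,\Psi_1,\Psi_2$ described in the context (loss function $l(x)=x$). (a) For $x\in[0,p(H))$ let $c=c(x)\ge 0$ be a solution of the equation $\Psi_2(c)=e^{rT}x$. Then $$\Phi_1(x)=\begin{cases}\Psi_1(0)-\Psi_1(c(x)) & \text{for } x\in[0,p(H)),\\ 0 & \text{for } x\ge p(H).\end{cases}$$ Moreover, for $x\in[0,p(H))$, the replicating strategy for the payoff $H\mathbf 1_{A_{c(x)}}$ is a risk minimizing strategy for $x$. (b) For $v\in[0,\mathbf E[H])$ let $c=c(v)\ge0$ be a solution of the equation $\Psi_1(c)=\Psi_1(0)-v$. Then $$\Phi_2(v)=\begin{cases}e^{-rT}\Psi_2(c(v)) & \text{for } v\in[0,\mathbf E[H]),\\ 0 & \text{for } v\ge \mathbf E[H].\end{cases}$$ Moreover, for $v\in[0,\mathbf E[H])$, the replicating strategy for the payoff $H\mathbf 1_{A_{c(v)}}$ is a cost minimizing strategy for $v$.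
   Context: Market. $(\Omega,\mathcal F,(\mathcal F_t)_{t\in[0,T]},P)$ is a filtered probability space with a $d$-dimensional Wiener process $W=(W^1,\dots,W^d)$ whose components are correlated with positive definite correlation matrix $Q=(\rho_{i,j})$, $\rho_{i,i}=1$, $\rho_{i,j}=\mathrm{cor}(W^i_1,W^j_1)$ (a "$Q$-Wiener process"). Stocks: $dS^i_t=S^i_t(\alpha_i\,dt+\sigma_i\,dW^i_t)$, $i=1,\dots,d$, $\alpha_i\in\mathbb R$, $\sigma_i>0$; money market account $dB_t=rB_t\,dt$, $r$ constant. Let $\theta=\left(\frac{\alpha_1-r}{\sigma_1},\dots,\frac{\alpha_d-r}{\sigma_d}\right)^T$. The unique martingale measure $\tilde P$ has density $\frac{d\tilde P}{dP}=\tilde Z_T:=\exp\left(-(Q^{-1}\theta,W_T)-\tfrac12|Q^{-1/2}\theta|^2T\right)$. $\mathbf E,\tilde{\mathbf E}$ denote expectations under $P,\tilde P$. The market is complete (e.g. the filtration is the augmented filtration generated by $W$): every nonnegative $\mathcal F_T$-measurable payoff $G$ with $\tilde{\mathbf E}[e^{-rT}G]<\infty$ is replicated by an admissible self-financing strategy with initial capital $\tilde{\mathbf E}[e^{-rT}G]$. Strategies. The wealth process with initial capital $x$ and strategy $\pi$ is $X^{x,\pi}_t=\pi^0_tB_t+\sum_{i=1}^d\pi^i_tS^i_t$, $X_0^{x,\pi}=x$; strategies are self-financing, $dX^{x,\pi}_t=\pi^0_t\,dB_t+\sum_i\pi^i_t\,dS^i_t$, and admissible, $X^{x,\pi}_t\ge0$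 for all $t\in[0,T]$ a.s. Claim. $H\ge0$ is an $\mathcal F_T$-measurable random variable with $\mathbf E[e^{-rT}\tilde Z_TH]<\infty$ and $\mathbf E[H]<\infty$. Its price is $p(H)=\tilde{\mathbf E}[e^{-rT}H]$. Risk functions for $l(x)=x$. For $x\geq 0$, $\Phi_1(x):=\min_\pi\mathbf E[(H-X^{x,\pi}_T)^+]$; a strategy attaining this minimum is a risk minimizing strategy for $x$. For $v\ge0$, $\Phi_2(v):=\min\{x:\exists\pi\ \text{s.t.}\ \mathbf E[(H-X^{x,\pi}_T)^+]\le v\}$; a strategy $\hat\pi$ with $\mathbf E[(H-X_T^{\Phi_2(v),\hat\pi})^+]\le v$ is a cost minimizing strategy for $v$. Auxiliary functions. For $c\ge0$: $A_c:=\{\tilde Z_T^{-1}\ge c\}$, $\Psi_1(c):=\mathbf E[H\mathbf 1_{A_c}]$, $\Psi_2(c):=\tilde{\mathbf E}[H\mathbf 1_{A_c}]$. *)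

theory Defs
  imports "HOL-Probability.Probability"
begin

section \<open>Market data\<close>

text \<open>
  Time runs through \<open>[0, horizon]\<close>; values of processes outside this interval are irrelevant.
  The finite type \<open>'n\<close> indexes the stocks and the driving Wiener processes, so \<open>d = CARD('n)\<close>.
\<close>

record ('a, 'n::finite) bs_market =
  pspace  :: "'a measure"
  filt    :: "real \<Rightarrow> 'a measure"
  horizon :: real
  wiener  :: "real \<Rightarrow> 'a \<Rightarrow> real ^ 'n"
  corr    :: "real ^ 'n ^ 'n"
  drift   :: "real ^ 'n"
  vol     :: "real ^ 'n"
  rate    :: real
  bank    :: "real \<Rightarrow> real"
  stock   :: "real \<Rightarrow> 'a \<Rightarrow> real ^ 'n"

section \<open>Filtrations and Wiener processes\<close>

definition filtration_upto :: "'a measure \<Rightarrow> (real \<Rightarrow> 'a measure) \<Rightarrow> real \<Rightarrow> bool" where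
  "filtration_upto M F T \<longleftrightarrow>
     (\<forall>t\<in>{0..T}. subalgebra M (F t)) \<and>
     (\<forall>s t. 0 \<le> s \<and> s \<le> t \<and> t \<le> T \<longrightarrow> sets (F s) \<subseteq> sets (F t))"

definition progressive :: "('a, 'n::finite) bs_market \<Rightarrow> (real \<Rightarrow> 'a \<Rightarrow> real) \<Rightarrow> bool" where
  "progressive mk \<phi> \<longleftrightarrow>
     (\<forall>t\<in>{0..horizon mk}.
        (\<lambda>(s, \<omega>). \<phi> s \<omega>) \<in> borel_measurable (restrict_space borel {0..t} \<Otimes>\<^sub>M filt mk t))"

definition symmetric_posdef :: "real ^ 'n ^ 'n \<Rightarrow> bool" where
  "symmetric_posdef A \<longleftrightarrow> transpose A = A \<and> (\<forall>x. x \<noteq> 0 \<longrightarrow> 0 < x \<bullet> (A *v x))"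

definition correlation_matrix :: "real ^ 'n ^ 'n \<Rightarrow> bool" where
  "correlation_matrix Q \<longleftrightarrow> symmetric_posdef Q \<and> (\<forall>i. Q $ i $ i = 1)"

text \<open>
  The increment over \<open>[s,t]\<close> is centred Gaussian with covariance matrix \<open>(t - s) Q\<close>, expressed
  by requiring that every nontrivial linear combination of its components is normal with the
  corresponding variance (\<open>normal_density\<close> takes the standard deviation as its argument).
\<close>

definition Q_wiener_process ::
  "'a measure \<Rightarrow> (real \<Rightarrow> 'a measure) \<Rightarrow> real \<Rightarrow> real ^ 'n ^ 'n \<Rightarrow> (real \<Rightarrow> 'a \<Rightarrow> real ^ 'n::finite) \<Rightarrow> bool" where
  "Q_wiener_process M F T Q W \<longleftrightarrow>
     (\<forall>t\<in>{0..T}. W t \<in> borel_measurable (F t)) \<and>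
     (AE \<omega> in M. W 0 \<omega> = 0) \<and>
     (AE \<omega> in M. continuous_on {0..T} (\<lambda>t. W t \<omega>)) \<and>
     (\<forall>s t. 0 \<le> s \<and> s < t \<and> t \<le> T \<longrightarrow>
        prob_space.indep_set M (sets (F s))
          {(\<lambda>\<omega>. W t \<omega> - W s \<omega>) -` A \<inter> space M | A. A \<in> sets borel} \<and>
        (\<forall>u. u \<noteq> 0 \<longrightarrow>
           distributed M lborel (\<lambda>\<omega>. u \<bullet> (W t \<omega> - W s \<omega>))
             (\<lambda>y. ennreal (normal_density 0 (sqrt ((t - s) * (u \<bullet> (Q *v u)))) y))))"

section \<open>The Ito integral\<close>

text \<open>
  The \<open>D m\<close> tend to zero in probability. The events are only required to be covered by
  measurable ones, because \<open>measure\<close> is zero on sets that are not measurable.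
\<close>

definition vanish_in_prob :: "'a measure \<Rightarrow> (nat \<Rightarrow> 'a \<Rightarrow> ennreal) \<Rightarrow> bool" where
  "vanish_in_prob M D \<longleftrightarrow>
     (\<forall>\<epsilon>>0. \<exists>E. (\<forall>m. E m \<in> sets M \<and> {\<omega> \<in> space M. \<epsilon> < D m \<omega>} \<subseteq> E m) \<and>
               (\<lambda>m. measure M (E m)) \<longlonglongrightarrow> 0)"

text \<open>
  A simple process \<open>\<Sum>k<n. \<xi>\<^sub>k 1\<^bsub>(\<tau> k, \<tau> (k+1)]\<^esub>\<close> is given by the triple
  \<open>(n, \<tau>, \<xi>)\<close>.
\<close>

type_synonym 'a simple_proc = "nat \<times> (nat \<Rightarrow> real) \<times> (nat \<Rightarrow> 'a \<Rightarrow> real)"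

definition simple_process :: "('a, 'n::finite) bs_market \<Rightarrow> 'a simple_proc \<Rightarrow> bool" where
  "simple_process mk p \<longleftrightarrow> (case p of (n, \<tau>, \<xi>) \<Rightarrow>
     (\<forall>k\<le>n. \<tau> k \<in> {0..horizon mk}) \<and> (\<forall>k<n. \<tau> k \<le> \<tau> (Suc k)) \<and>
     (\<forall>k<n. \<xi> k \<in> borel_measurable (filt mk (\<tau> k)) \<and>
            (\<exists>C. \<forall>\<omega>\<in>space (pspace mk). \<bar>\<xi> k \<omega>\<bar> \<le> C)))"

definition simple_value :: "'a simple_proc \<Rightarrow> real \<Rightarrow> 'a \<Rightarrow> real" where
  "simple_value p t \<omega> = (case p of (n, \<tau>, \<xi>) \<Rightarrow>
     \<Sum>k<n. \<xi> k \<omega> * indicator {\<tau> k<..\<tau> (Suc k)} t)"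

definition simple_integral :: "'a simple_proc \<Rightarrow> (real \<Rightarrow> 'a \<Rightarrow> real) \<Rightarrow> real \<Rightarrow> 'a \<Rightarrow> real" where
  "simple_integral p V t \<omega> = (case p of (n, \<tau>, \<xi>) \<Rightarrow>
     \<Sum>k<n. \<xi> k \<omega> * (V (min t (\<tau> (Suc k))) \<omega> - V (min t (\<tau> k)) \<omega>))"

text \<open>
  \<open>I\<close> is (a version of) \<open>(\<integral>\<^sub>0\<^sup>t \<phi> dW\<^sup>i)\<^sub>t\<close>, for progressively measurable \<open>\<phi>\<close> with
  \<open>\<integral>\<^sub>0\<^sup>T \<phi>\<^sup>2 ds < \<infinity>\<close> almost surely: the limit, uniformly in time in probability, of the
  elementary integrals of simple processes that approximate \<open>\<phi>\<close> in \<open>L\<^sup>2([0,T])\<close> in probability.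
  This determines \<open>I\<close> up to indistinguishability on \<open>[0,T]\<close>.
\<close>

definition is_ito_integral ::
  "('a, 'n::finite) bs_market \<Rightarrow> 'n \<Rightarrow> (real \<Rightarrow> 'a \<Rightarrow> real) \<Rightarrow> (real \<Rightarrow> 'a \<Rightarrow> real) \<Rightarrow> bool" where
  "is_ito_integral mk i \<phi> I \<longleftrightarrow>
     progressive mk \<phi> \<and>
     (AE \<omega> in pspace mk. (\<integral>\<^sup>+s\<in>{0..horizon mk}. ennreal ((\<phi> s \<omega>)\<^sup>2) \<partial>lborel) < \<infinity>) \<and>
     (\<exists>p. (\<forall>m. simple_process mk (p m)) \<and>
        vanish_in_prob (pspace mk)
          (\<lambda>m \<omega>. \<integral>\<^sup>+s\<in>{0..horizon mk}. ennreal ((simple_value (p m) s \<omega> - \<phi> s \<omega>)\<^sup>2) \<partial>lborel) \<and>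
        vanish_in_prob (pspace mk)
          (\<lambda>m \<omega>. SUP t\<in>{0..horizon mk}.
             ennreal \<bar>simple_integral (p m) (\<lambda>t \<omega>. wiener mk t \<omega> $ i) t \<omega> - I t \<omega>\<bar>))"

text \<open>\<open>a\<close> is integrable in time along almost every path, so that \<open>\<integral>\<^sub>0\<^sup>t a ds\<close> exists.\<close>

definition time_integrable :: "('a, 'n::finite) bs_market \<Rightarrow> (real \<Rightarrow> 'a \<Rightarrow> real) \<Rightarrow> bool" where
  "time_integrable mk a \<longleftrightarrow>
     progressive mk a \<and>
     (AE \<omega> in pspace mk. set_integrable lborel {0..horizon mk} (\<lambda>s. a s \<omega>))"

text \<open>\<open>J\<^sub>t = \<integral>\<^sub>0\<^sup>t a ds + \<integral>\<^sub>0\<^sup>t b dW\<^sup>i\<close>, that is, \<open>dJ = a dt + b dW\<^sup>i\<close> and \<open>J\<^sub>0 = 0\<close>.\<close>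

definition is_ito_process ::
  "('a, 'n::finite) bs_market \<Rightarrow> 'n \<Rightarrow> (real \<Rightarrow> 'a \<Rightarrow> real) \<Rightarrow> (real \<Rightarrow> 'a \<Rightarrow> real) \<Rightarrow>
     (real \<Rightarrow> 'a \<Rightarrow> real) \<Rightarrow> bool" where
  "is_ito_process mk i a b J \<longleftrightarrow>
     time_integrable mk a \<and>
     (\<exists>I. is_ito_integral mk i b I \<and>
        (AE \<omega> in pspace mk. \<forall>t\<in>{0..horizon mk}. J t \<omega> = (LBINT s:{0..t}. a s \<omega>) + I t \<omega>))"

section \<open>The Black--Scholes market\<close>

definition black_scholes_market :: "('a, 'n::finite) bs_market \<Rightarrow> bool" where
  "black_scholes_market mk \<longleftrightarrow>
     0 < horizon mk \<and>
     prob_space (pspace mk) \<and>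
     filtration_upto (pspace mk) (filt mk) (horizon mk) \<and>
     correlation_matrix (corr mk) \<and>
     Q_wiener_process (pspace mk) (filt mk) (horizon mk) (corr mk) (wiener mk) \<and>
     (\<forall>i. 0 < vol mk $ i) \<and>
     0 < bank mk 0 \<and>
     (\<forall>t\<in>{0..horizon mk}.
        (bank mk has_real_derivative rate mk * bank mk t) (at t within {0..horizon mk})) \<and>
     (\<forall>i. \<exists>s0>0. \<exists>J.
        is_ito_process mk i (\<lambda>t \<omega>. drift mk $ i * stock mk t \<omega> $ i)
                            (\<lambda>t \<omega>. vol mk $ i * stock mk t \<omega> $ i) J \<and>
        (AE \<omega> in pspace mk. \<forall>t\<in>{0..horizon mk}. stock mk t \<omega> $ i = s0 + J t \<omega>))"

text \<open>The positive definite square root \<open>Q\<^sup>1\<^sup>/\<^sup>2\<close> (which is unique).\<close>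

definition matrix_sqrt :: "real ^ 'n ^ 'n \<Rightarrow> real ^ 'n ^ 'n" where
  "matrix_sqrt Q = (SOME R. symmetric_posdef R \<and> R ** R = Q)"

definition theta :: "('a, 'n::finite) bs_market \<Rightarrow> real ^ 'n" where
  "theta mk = (\<chi> i. (drift mk $ i - rate mk) / vol mk $ i)"

definition Z_T :: "('a, 'n::finite) bs_market \<Rightarrow> 'a \<Rightarrow> real" where
  "Z_T mk \<omega> =
     exp (- ((matrix_inv (corr mk) *v theta mk) \<bullet> wiener mk (horizon mk) \<omega>)
          - 1 / 2 * (norm (matrix_inv (matrix_sqrt (corr mk)) *v theta mk))\<^sup>2 * horizon mk)"

definition martingale_measure :: "('a, 'n::finite) bs_market \<Rightarrow> 'a measure" where
  "martingale_measure mk = density (pspace mk) (\<lambda>\<omega>. ennreal (Z_T mk \<omega>))"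

section \<open>Strategies\<close>

text \<open>The pair \<open>(\<pi>\<^sup>0, \<pi>)\<close>: units of the money market account and of the stocks.\<close>

type_synonym ('a, 'n) strategy = "(real \<Rightarrow> 'a \<Rightarrow> real) \<times> (real \<Rightarrow> 'a \<Rightarrow> real ^ 'n)"

definition wealth :: "('a, 'n::finite) bs_market \<Rightarrow> ('a, 'n) strategy \<Rightarrow> real \<Rightarrow> 'a \<Rightarrow> real" where
  "wealth mk \<pi> t \<omega> = fst \<pi> t \<omega> * bank mk t + (\<Sum>i\<in>UNIV. snd \<pi> t \<omega> $ i * stock mk t \<omega> $ i)"

text \<open>
  \<open>X\<^sub>0 = x\<close> and \<open>dX = \<pi>\<^sup>0 dB + \<Sum>i. \<pi>\<^sup>i dS\<^sup>i\<close>, where \<open>dB = r B dt\<close> and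
  \<open>dS\<^sup>i = S\<^sup>i (\<alpha>\<^sub>i dt + \<sigma>\<^sub>i dW\<^sup>i)\<close>; the process \<open>J i\<close> is the integral of \<open>\<pi>\<^sup>i\<close>
  against \<open>S\<^sup>i\<close>.
\<close>

definition self_financing ::
  "('a, 'n::finite) bs_market \<Rightarrow> real \<Rightarrow> ('a, 'n) strategy \<Rightarrow> bool" where
  "self_financing mk x \<pi> \<longleftrightarrow>
     progressive mk (fst \<pi>) \<and>
     (\<forall>i. progressive mk (\<lambda>t \<omega>. snd \<pi> t \<omega> $ i)) \<and>
     time_integrable mk (\<lambda>t \<omega>. fst \<pi> t \<omega> * (rate mk * bank mk t)) \<and>
     (AE \<omega> in pspace mk. wealth mk \<pi> 0 \<omega> = x) \<and>
     (\<exists>J. (\<forall>i. is_ito_process mk i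
                  (\<lambda>t \<omega>. snd \<pi> t \<omega> $ i * (drift mk $ i * stock mk t \<omega> $ i))
                  (\<lambda>t \<omega>. snd \<pi> t \<omega> $ i * (vol mk $ i * stock mk t \<omega> $ i)) (J i)) \<and>
        (AE \<omega> in pspace mk. \<forall>t\<in>{0..horizon mk}.
           wealth mk \<pi> t \<omega> =
             x + (LBINT s:{0..t}. fst \<pi> s \<omega> * (rate mk * bank mk s)) + (\<Sum>i\<in>UNIV. J i t \<omega>)))"

definition admissible ::
  "('a, 'n::finite) bs_market \<Rightarrow> real \<Rightarrow> ('a, 'n) strategy \<Rightarrow> bool" where
  "admissible mk x \<pi> \<longleftrightarrow>
     self_financing mk x \<pi> \<and>
     (AE \<omega> in pspace mk. \<forall>t\<in>{0..horizon mk}. 0 \<le> wealth mk \<pi> t \<omega>)"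

definition price :: "('a, 'n::finite) bs_market \<Rightarrow> ('a \<Rightarrow> real) \<Rightarrow> real" where
  "price mk G = (\<integral>\<omega>. exp (- rate mk * horizon mk) * G \<omega> \<partial>martingale_measure mk)"

text \<open>
  Replication starts from the price: an admissible strategy with larger initial capital could
  also end in \<open>G\<close>, by throwing money away.
\<close>

definition replicates ::
  "('a, 'n::finite) bs_market \<Rightarrow> ('a \<Rightarrow> real) \<Rightarrow> ('a, 'n) strategy \<Rightarrow> bool" where
  "replicates mk G \<pi> \<longleftrightarrow>
     admissible mk (price mk G) \<pi> \<and>
     (AE \<omega> in pspace mk. wealth mk \<pi> (horizon mk) \<omega> = G \<omega>)"

definition complete_market :: "('a, 'n::finite) bs_market \<Rightarrow> bool" where
  "complete_market mk \<longleftrightarrow>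
     (\<forall>G. G \<in> borel_measurable (filt mk (horizon mk)) \<and> (\<forall>\<omega>\<in>space (pspace mk). 0 \<le> G \<omega>) \<and>
          integrable (martingale_measure mk) (\<lambda>\<omega>. exp (- rate mk * horizon mk) * G \<omega>) \<longrightarrow>
          (\<exists>\<pi>. replicates mk G \<pi>))"

section \<open>The claim and the risk functions\<close>

definition contingent_claim :: "('a, 'n::finite) bs_market \<Rightarrow> ('a \<Rightarrow> real) \<Rightarrow> bool" where
  "contingent_claim mk H \<longleftrightarrow>
     H \<in> borel_measurable (filt mk (horizon mk)) \<and>
     (\<forall>\<omega>\<in>space (pspace mk). 0 \<le> H \<omega>) \<and>
     integrable (pspace mk) (\<lambda>\<omega>. exp (- rate mk * horizon mk) * Z_T mk \<omega> * H \<omega>) \<and>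
     integrable (pspace mk) H"

definition shortfall_risk ::
  "('a, 'n::finite) bs_market \<Rightarrow> ('a \<Rightarrow> real) \<Rightarrow> ('a, 'n) strategy \<Rightarrow> real" where
  "shortfall_risk mk H \<pi> = (\<integral>\<omega>. max 0 (H \<omega> - wealth mk \<pi> (horizon mk) \<omega>) \<partial>pspace mk)"

definition risks :: "('a, 'n::finite) bs_market \<Rightarrow> ('a \<Rightarrow> real) \<Rightarrow> real \<Rightarrow> real set" where
  "risks mk H x = {shortfall_risk mk H \<pi> | \<pi>. admissible mk x \<pi>}"

definition costs :: "('a, 'n::finite) bs_market \<Rightarrow> ('a \<Rightarrow> real) \<Rightarrow> real \<Rightarrow> real set" where
  "costs mk H v = {x. \<exists>\<pi>. admissible mk x \<pi> \<and> shortfall_risk mk H \<pi> \<le> v}"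

text \<open>
  \<open>LEAST\<close> is the minimum when there is one and unspecified otherwise; \<open>is_minimum\<close> expresses
  that the minimum is attained.
\<close>

definition is_minimum :: "real \<Rightarrow> real set \<Rightarrow> bool" where
  "is_minimum m A \<longleftrightarrow> m \<in> A \<and> (\<forall>a\<in>A. m \<le> a)"

definition Phi1 :: "('a, 'n::finite) bs_market \<Rightarrow> ('a \<Rightarrow> real) \<Rightarrow> real \<Rightarrow> real" where
  "Phi1 mk H x = (LEAST m. m \<in> risks mk H x)"

definition Phi2 :: "('a, 'n::finite) bs_market \<Rightarrow> ('a \<Rightarrow> real) \<Rightarrow> real \<Rightarrow> real" where
  "Phi2 mk H v = (LEAST x. x \<in> costs mk H v)"

definition risk_minimizing ::
  "('a, 'n::finite) bs_market \<Rightarrow> ('a \<Rightarrow> real) \<Rightarrow> real \<Rightarrow> ('a, 'n) strategy \<Rightarrow> bool" where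
  "risk_minimizing mk H x \<pi> \<longleftrightarrow> admissible mk x \<pi> \<and> shortfall_risk mk H \<pi> = Phi1 mk H x"

definition cost_minimizing ::
  "('a, 'n::finite) bs_market \<Rightarrow> ('a \<Rightarrow> real) \<Rightarrow> real \<Rightarrow> ('a, 'n) strategy \<Rightarrow> bool" where
  "cost_minimizing mk H v \<pi> \<longleftrightarrow> admissible mk (Phi2 mk H v) \<pi> \<and> shortfall_risk mk H \<pi> \<le> v"

definition A_set :: "('a, 'n::finite) bs_market \<Rightarrow> real \<Rightarrow> 'a set" where
  "A_set mk c = {\<omega> \<in> space (pspace mk). c \<le> inverse (Z_T mk \<omega>)}"

definition Psi1 :: "('a, 'n::finite) bs_market \<Rightarrow> ('a \<Rightarrow> real) \<Rightarrow> real \<Rightarrow> real" where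
  "Psi1 mk H c = (\<integral>\<omega>. H \<omega> * indicator (A_set mk c) \<omega> \<partial>pspace mk)"

definition Psi2 :: "('a, 'n::finite) bs_market \<Rightarrow> ('a \<Rightarrow> real) \<Rightarrow> real \<Rightarrow> real" where
  "Psi2 mk H c = (\<integral>\<omega>. H \<omega> * indicator (A_set mk c) \<omega> \<partial>martingale_measure mk)"

end

theory Submission
  imports Defs
begin

text \<open>
  The optimality is the Neyman-Pearson lemma. For every admissible strategy, the terminal wealth \<open>X\<close>
  satisfies \<open>X \<ge> 0\<close> and \<open>exp (- r T) * E'[X] \<le> x\<close>, where \<open>E'\<close> is the expectation under the martingale
  measure; integrating \<open>(H - X)\<^sup>+ \<ge> H - H 1\<^sub>A + c Z (H 1\<^sub>A - X)\<close>, with \<open>A\<close> the event \<open>c Z \<le> 1\<close>, bounds the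
  shortfall from below by \<open>\<Psi>\<^sub>1(0) - \<Psi>\<^sub>1(c)\<close> when \<open>x = exp (- r T) \<Psi>\<^sub>2(c)\<close>, and replicating \<open>H 1\<^sub>A\<close> attains
  this bound.

  The supermartingale bound needs no stochastic calculus beyond the definition of the integral.
  Independence of the increments and the Gaussian exponential moments give the exponential moments of
  the drifted increments under the martingale measure, hence their conditional mean zero and fourth
  moments of order \<open>(t - s)\<^sup>2\<close>. So discounted gains of simple strategies sampled on a grid are
  martingales; they approximate the discounted wealth uniformly in time along a subsequence. Stopped
  when they first fall below \<open>- e\<close>, they undershoot by little, and Fatou's lemma gives the bound.
\<close>

section \<open>Square roots of positive definite matrices\<close>

text \<open>The integral of the definitions is a limit in probability of elementary integrals of
  simple processes, with no control of moments. So the discounted wealth is not known to be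
  integrable, and the simple approximants, though they have mean \<open>x\<close>, are not bounded
  below: Fatou's lemma cannot be applied to them directly, hence the stopping. The undershoot below
  \<open>- e\<close> is at most \<open>e\<close> plus the sum of \<open>d ^ 4 / e ^ 3\<close> over
  the grid increments \<open>d\<close>. On a grid of \<open>n\<close> steps the fourth moments are
  of order \<open>1 / n ^ 2\<close> and contribute \<open>1 / n\<close> in total, whereas second
  moments would leave a contribution that does not vanish. The constant depends on the approximant,
  so the grid is refined separately for each one.

  Discounting is pathwise: wealth solves a linear integral equation driven by undiscounted gains,
  and summation by parts against the discount factor replaces a product rule. The square roots enter
  because the exponent of the density is written with the root of \<open>Q\<close>; it has to become
  the quadratic form of the inverse of \<open>Q\<close> before the Gaussian moments can be
  matched.\<close>

lemma coercive_bounded_shift: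
  fixes f :: "'a::euclidean_space \<Rightarrow>\<^sub>L 'a"
  assumes pos: "\<And>x. x \<noteq> 0 \<Longrightarrow> 0 < x \<bullet> blinfun_apply f x"
  shows "\<exists>c>0. norm (id_blinfun - (1 / c) *\<^sub>R f) < 1"
proof -
  define S where "S = sphere (0::'a) 1"
  have S: "compact S" "S \<noteq> {}" by (auto simp: S_def)
  have "continuous_on S (\<lambda>x. x \<bullet> blinfun_apply f x)"
    by (intro continuous_intros)
  from continuous_attains_inf[OF S this] obtain z where z: "z \<in> S"
    and zmin: "\<And>x. x \<in> S \<Longrightarrow> z \<bullet> blinfun_apply f z \<le> x \<bullet> blinfun_apply f x" by blast
  define m where "m = z \<bullet> blinfun_apply f z"
  have z1: "norm z = 1" using z by (simp add: S_def)
  have m: "0 < m" unfolding m_def using z1 by (intro pos) auto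
  have low: "m * (norm x)\<^sup>2 \<le> x \<bullet> blinfun_apply f x" for x
  proof (cases "x = 0")
    case False
    have "m \<le> (x /\<^sub>R norm x) \<bullet> blinfun_apply f (x /\<^sub>R norm x)"
      unfolding m_def using False by (intro zmin) (auto simp: S_def)
    also have "\<dots> = (x \<bullet> blinfun_apply f x) / (norm x)\<^sup>2"
      by (simp add: blinfun.scaleR_right power2_eq_square divide_simps)
    finally show ?thesis using False by (simp add: field_simps)
  qed auto
  define L where "L = norm f"
  have mL: "m \<le> L"
  proof -
    have "m \<le> norm z * norm (blinfun_apply f z)" unfolding m_def by (rule norm_cauchy_schwarz)
    also have "\<dots> \<le> 1 * (norm f * norm z)" using z1 by (metis mult_1 norm_blinfun)
    finally show ?thesis using z1 by (simp add: L_def)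
  qed
  have L: "0 < L" using m mL by simp
  \<comment> \<open>The choice \<open>1 / c = m / L\<^sup>2\<close> minimises
    \<open>1 - 2 * m / c + L\<^sup>2 / c\<^sup>2\<close>, the factor bounding the squared norm of
    \<open>x - f x / c\<close>; the minimum is \<open>b\<close> below.\<close>
  define c where "c = L\<^sup>2 / m"
  have c: "0 < c" using L m by (simp add: c_def)
  define b where "b = 1 - m\<^sup>2 / L\<^sup>2"
  have b: "0 \<le> b" "b < 1" using m mL L by (auto simp: b_def divide_simps power_mono)
  have "norm (blinfun_apply (id_blinfun - (1 / c) *\<^sub>R f) x) \<le> sqrt b * norm x" for x
  proof -
    define y where "y = blinfun_apply f x"
    have nf: "norm y \<le> L * norm x" unfolding y_def L_def by (rule norm_blinfun)
    have "(norm (x - (1 / c) *\<^sub>R y))\<^sup>2 = (norm x)\<^sup>2 - 2 / c * (x \<bullet> y) + (1/c)\<^sup>2 * (norm y)\<^sup>2"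
      unfolding power2_norm_eq_inner
      by (simp add: inner_diff_left inner_diff_right inner_commute power2_eq_square algebra_simps)
    also have "\<dots> \<le> (norm x)\<^sup>2 - 2 / c * (m * (norm x)\<^sup>2) + (1/c)\<^sup>2 * (L * norm x)\<^sup>2"
      using c low[of x] nf
      by (intro add_mono diff_mono mult_left_mono power_mono order_refl) (auto simp: y_def)
    also have "\<dots> = b * (norm x)\<^sup>2"
      using L m by (simp add: b_def c_def field_simps power2_eq_square)
    finally have "(norm (x - (1 / c) *\<^sub>R y))\<^sup>2 \<le> (sqrt b * norm x)\<^sup>2"
      using b by (simp add: power_mult_distrib)
    then have "norm (x - (1 / c) *\<^sub>R y) \<le> sqrt b * norm x"
      by (rule power2_le_imp_le) (use b in auto)
    then show ?thesis by (simp add: y_def blinfun.diff_left blinfun.scaleR_left)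
  qed
  then have "norm (id_blinfun - (1 / c) *\<^sub>R f) \<le> sqrt b"
    using b by (intro norm_blinfun_bound) auto
  also have "\<dots> < 1" using b by simp
  finally show ?thesis using c by blast
qed

text \<open>
  Scaled so that \<open>A = I - f/c\<close> has norm below one, \<open>R = I - Y\<close> is a square root of \<open>f/c\<close> iff
  \<open>Y = (A + Y\<^sup>2)/2\<close>, and the right-hand side is a contraction of a ball of self-adjoint operators.
\<close>

lemma exists_selfadjoint_sqrt:
  fixes f :: "'a::euclidean_space \<Rightarrow>\<^sub>L 'a"
  assumes pos: "\<And>x. x \<noteq> 0 \<Longrightarrow> 0 < x \<bullet> blinfun_apply f x"
    and sym: "\<And>x y. blinfun_apply f x \<bullet> y = x \<bullet> blinfun_apply f y"
  shows "\<exists>g :: 'a \<Rightarrow>\<^sub>L 'a. (\<forall>x y. blinfun_apply g x \<bullet> y = x \<bullet> blinfun_apply g y) \<and>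
    (\<forall>x. x \<noteq> 0 \<longrightarrow> 0 < x \<bullet> blinfun_apply g x) \<and> g o\<^sub>L g = f"
proof -
  obtain c where c: "0 < c" and A1: "norm (id_blinfun - (1 / c) *\<^sub>R f) < 1"
    using coercive_bounded_shift[OF pos] by blast
  define A where "A = id_blinfun - (1 / c) *\<^sub>R f"
  define a where "a = norm A"
  have a: "0 \<le> a" "a < 1" using A1 by (auto simp: a_def A_def)
  \<comment> \<open>The smaller root of \<open>(a + \<rho>\<^sup>2) / 2 = \<rho>\<close>: the ball
    of radius \<rho> is mapped into itself, and since \<rho> < 1 the same number is the contraction
    factor and keeps \<open>id_blinfun - Y\<close> positive definite.\<close>
  define \<rho> where "\<rho> = 1 - sqrt (1 - a)"
  have \<rho>: "0 \<le> \<rho>" "\<rho> < 1" using a by (auto simp: \<rho>_def)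
  have \<rho>2: "(a + \<rho>\<^sup>2) / 2 = \<rho>"
    using a by (simp add: \<rho>_def power2_eq_square field_simps)
  define S where "S = cball (0::'a \<Rightarrow>\<^sub>L 'a) \<rho> \<inter>
    (\<Inter>x. \<Inter>y. {Y. blinfun_apply Y x \<bullet> y = x \<bullet> blinfun_apply Y y})"
  define G where "G = (\<lambda>Y::'a \<Rightarrow>\<^sub>L 'a. (1/2) *\<^sub>R (A + (Y o\<^sub>L Y)))"
  have "closed S" unfolding S_def
    by (intro closed_Int closed_cball closed_INT ballI closed_Collect_eq continuous_intros)
  note complete_eq_closed[THEN iffD2, OF this]
  moreover have "S \<noteq> {}"
  proof -
    have "0 \<in> S" using \<rho> by (simp add: S_def)
    then show ?thesis by blast
  qed
  moreover have "G ` S \<subseteq> S"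
  proof (rule image_subsetI)
    fix Y assume Y: "Y \<in> S"
    then have nY: "norm Y \<le> \<rho>" and sY: "\<And>x y. blinfun_apply Y x \<bullet> y = x \<bullet> blinfun_apply Y y"
      by (auto simp: S_def)
    have "norm (A + (Y o\<^sub>L Y)) \<le> a + \<rho> * \<rho>"
      unfolding a_def using nY \<rho>
      by (intro norm_triangle_mono order_refl order_trans[OF norm_blinfun_compose] mult_mono) auto
    then have "norm (G Y) \<le> \<rho>" using \<rho>2 by (simp add: G_def power2_eq_square)
    moreover have "blinfun_apply (G Y) x \<bullet> y = x \<bullet> blinfun_apply (G Y) y" for x y
      unfolding G_def A_def
      by (simp add: blinfun.add_left blinfun.diff_left blinfun.scaleR_left inner_simps sym sY)
    ultimately show "G Y \<in> S" by (simp add: S_def)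
  qed
  moreover have "dist (G Y) (G Z) \<le> \<rho> * dist Y Z" if "Y \<in> S" "Z \<in> S" for Y Z
  proof -
    have n: "norm Y \<le> \<rho>" "norm Z \<le> \<rho>" using that by (auto simp: S_def)
    have "G Y - G Z = (1/2) *\<^sub>R ((Y o\<^sub>L (Y - Z)) + ((Y - Z) o\<^sub>L Z))"
      by (rule blinfun_eqI) (simp add: G_def blinfun.bilinear_simps scaleR_right_distrib scaleR_right_diff_distrib)
    also have "norm \<dots> \<le> (1/2) * (\<rho> * norm (Y - Z) + norm (Y - Z) * \<rho>)"
      unfolding norm_scaleR using n \<rho>
      by (intro mult_mono norm_triangle_mono order_trans[OF norm_blinfun_compose] order_refl) auto
    finally show ?thesis by (simp add: dist_norm)
  qed
  ultimately have "\<exists>!Y\<in>S. G Y = Y"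
    using \<rho> by (intro Banach_fix[where c = \<rho>]) auto
  then obtain Y where Y: "Y \<in> S" "G Y = Y" by blast
  then have nY: "norm Y \<le> \<rho>" and sY: "\<And>x y. blinfun_apply Y x \<bullet> y = x \<bullet> blinfun_apply Y y"
    by (auto simp: S_def)
  have fixpt: "A + (Y o\<^sub>L Y) = 2 *\<^sub>R Y"
  proof -
    have "2 *\<^sub>R ((1/2) *\<^sub>R (A + (Y o\<^sub>L Y))) = 2 *\<^sub>R Y" using Y(2) unfolding G_def by simp
    then show ?thesis by simp
  qed
  define g where "g = sqrt c *\<^sub>R (id_blinfun - Y)"
  have "blinfun_apply g x \<bullet> y = x \<bullet> blinfun_apply g y" for x y
    by (simp add: g_def blinfun.bilinear_simps inner_simps sY)
  moreover have "0 < x \<bullet> blinfun_apply g x" if "x \<noteq> 0" for x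
  proof -
    have "x \<bullet> blinfun_apply Y x \<le> norm x * norm (blinfun_apply Y x)" by (rule norm_cauchy_schwarz)
    also have "\<dots> \<le> norm x * (\<rho> * norm x)"
      using nY by (intro mult_left_mono order_trans[OF norm_blinfun] mult_right_mono) auto
    also have "\<dots> < norm x * (1 * norm x)"
      using \<rho> that by (intro mult_strict_left_mono mult_strict_right_mono) auto
    also have "\<dots> = x \<bullet> x" by (simp add: power2_norm_eq_inner[symmetric] power2_eq_square)
    finally show ?thesis using c by (simp add: g_def blinfun.bilinear_simps inner_simps)
  qed
  moreover have "g o\<^sub>L g = f"
  proof (rule blinfun_eqI)
    fix x
    have YY: "blinfun_apply Y (blinfun_apply Y x) = 2 *\<^sub>R blinfun_apply Y x - blinfun_apply A x"
      using arg_cong[OF fixpt, of "\<lambda>h. blinfun_apply h x"]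
      by (simp add: blinfun.bilinear_simps algebra_simps)
    have "blinfun_apply (g o\<^sub>L g) x
        = c *\<^sub>R (x - 2 *\<^sub>R blinfun_apply Y x + blinfun_apply Y (blinfun_apply Y x))"
      using c unfolding g_def
      by (simp add: blinfun.bilinear_simps algebra_simps scaleR_2 flip: real_sqrt_mult)
    also have "\<dots> = blinfun_apply f x"
      using c unfolding YY by (simp add: A_def blinfun.bilinear_simps algebra_simps)
    finally show "blinfun_apply (g o\<^sub>L g) x = blinfun_apply f x" .
  qed
  ultimately show ?thesis by blast
qed

text \<open>Existence of a root is what makes the choice in \<open>matrix_sqrt\<close>
  meaningful.\<close>

lemma symmetric_posdef_sqrt:
  fixes Q :: "real ^ 'n ^ 'n"
  assumes "symmetric_posdef Q"
  shows "symmetric_posdef (matrix_sqrt Q) \<and> matrix_sqrt Q ** matrix_sqrt Q = Q"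
proof -
  define f where "f = Blinfun ((*v) Q)"
  have f: "blinfun_apply f x = Q *v x" for x
    unfolding f_def by (simp add: bounded_linear_Blinfun_apply matrix_vector_mul_bounded_linear)
  have Qsym: "(Q *v x) \<bullet> y = x \<bullet> (Q *v y)" for x y
    using assms by (metis symmetric_posdef_def dot_lmul_matrix vector_transpose_matrix)
  obtain g :: "(real ^ 'n) \<Rightarrow>\<^sub>L (real ^ 'n)" where
    gs: "\<And>x y. blinfun_apply g x \<bullet> y = x \<bullet> blinfun_apply g y"
    and gp: "\<And>x. x \<noteq> 0 \<Longrightarrow> 0 < x \<bullet> blinfun_apply g x" and gg: "g o\<^sub>L g = f"
    using exists_selfadjoint_sqrt[of f] assms Qsym f unfolding symmetric_posdef_def by auto
  define R where "R = matrix (blinfun_apply g)"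
  have R: "R *v x = blinfun_apply g x" for x
    unfolding R_def by (simp add: matrix_works blinfun.bounded_linear_right bounded_linear.linear)
  have "transpose R = R"
  proof -
    have "transpose R *v x = R *v x" for x
    proof (rule vector_eq_ldot[THEN iffD1], rule allI)
      fix y show "y \<bullet> (transpose R *v x) = y \<bullet> (R *v x)"
        by (metis gs R dot_lmul_matrix vector_transpose_matrix)
    qed
    then show ?thesis by (simp add: matrix_eq)
  qed
  moreover have "R ** R = Q"
    unfolding matrix_eq by (metis R f gg matrix_vector_mul_assoc blinfun_apply_blinfun_compose)
  ultimately have "\<exists>R. symmetric_posdef R \<and> R ** R = Q"
    using gp by (auto simp: symmetric_posdef_def R)
  then show ?thesis unfolding matrix_sqrt_def by (rule someI_ex)
qed

lemma symmetric_posdef_invertible: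
  fixes Q :: "real ^ 'n ^ 'n"
  assumes "symmetric_posdef Q"
  shows "invertible Q"
proof -
  have "x = 0" if "Q *v x = 0" for x
    using assms that by (metis symmetric_posdef_def inner_zero_right less_irrefl)
  then show ?thesis by (metis invertible_left_inverse matrix_left_invertible_ker)
qed

lemma matrix_inv_inverse:
  fixes A :: "real ^ 'n ^ 'n"
  assumes "invertible A"
  shows "A ** matrix_inv A = mat 1" "matrix_inv A ** A = mat 1"
proof -
  have "A ** matrix_inv A = mat 1 \<and> matrix_inv A ** A = mat 1"
    unfolding matrix_inv_def by (rule someI_ex) (use assms in \<open>simp add: invertible_def\<close>)
  then show "A ** matrix_inv A = mat 1" "matrix_inv A ** A = mat 1" by auto
qed

text \<open>Writing \<open>x\<close> as \<open>R *v (R *v z)\<close> with the symmetric root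
  \<open>R\<close>, both sides become the inner product of \<open>R *v z\<close> with itself. For
  \<theta> this is the normalising exponent of the density.\<close>

lemma norm_matrix_sqrt_inv:
  fixes Q :: "real ^ 'n ^ 'n"
  assumes "symmetric_posdef Q"
  shows "(norm (matrix_inv (matrix_sqrt Q) *v x))\<^sup>2 = x \<bullet> (matrix_inv Q *v x)"
proof -
  define R where "R = matrix_sqrt Q"
  have R: "symmetric_posdef R" "R ** R = Q" using symmetric_posdef_sqrt[OF assms] by (auto simp: R_def)
  have Ri: "R ** matrix_inv R = mat 1" "matrix_inv R ** R = mat 1"
    using symmetric_posdef_invertible[OF R(1)] by (auto intro: matrix_inv_inverse)
  have Qi: "matrix_inv Q ** Q = mat 1"
    using symmetric_posdef_invertible[OF assms] by (auto intro: matrix_inv_inverse)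
  define y where "y = matrix_inv R *v x"
  have Ry: "R *v y = x" by (simp add: y_def matrix_vector_mul_assoc Ri)
  have sym: "(R *v u) \<bullet> v = u \<bullet> (R *v v)" for u v
    using R(1) by (metis symmetric_posdef_def dot_lmul_matrix vector_transpose_matrix)
  define z where "z = matrix_inv R *v y"
  have Rz: "R *v z = y" by (simp add: z_def matrix_vector_mul_assoc Ri)
  have "matrix_inv Q *v x = matrix_inv Q *v (R *v (R *v z))" by (simp add: Rz Ry)
  also have "\<dots> = z" by (simp add: matrix_vector_mul_assoc R(2) Qi flip: matrix_mul_assoc)
  finally have "x \<bullet> (matrix_inv Q *v x) = (R *v y) \<bullet> z" by (simp add: Ry)
  also have "\<dots> = y \<bullet> y" by (simp add: sym Rz)
  finally show ?thesis by (simp add: y_def R_def power2_norm_eq_inner)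
qed

text \<open>Completing the square: the factor \<open>exp y\<close> tilts the centred density into
  the one with mean \<open>\<sigma>\<^sup>2\<close>, which again integrates to one.\<close>

lemma nn_integral_normal_exp:
  assumes \<sigma>: "0 < \<sigma>"
  shows "(\<integral>\<^sup>+y. ennreal (normal_density 0 \<sigma> y) * ennreal (exp y) \<partial>lborel) = ennreal (exp (\<sigma>\<^sup>2 / 2))"
proof -
  have eq: "normal_density 0 \<sigma> y * exp y = exp (\<sigma>\<^sup>2 / 2) * normal_density (\<sigma>\<^sup>2) \<sigma> y" for y
  proof -
    have "- (y\<^sup>2) / (2 * \<sigma>\<^sup>2) + y = \<sigma>\<^sup>2 / 2 + (- (y - \<sigma>\<^sup>2)\<^sup>2 / (2 * \<sigma>\<^sup>2))"
      using \<sigma> by (simp add: field_simps power2_eq_square)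
    then show ?thesis by (simp add: normal_density_def flip: exp_add)
  qed
  have "(\<integral>\<^sup>+y. ennreal (normal_density 0 \<sigma> y) * ennreal (exp y) \<partial>lborel)
      = (\<integral>\<^sup>+y. ennreal (exp (\<sigma>\<^sup>2 / 2)) * ennreal (normal_density (\<sigma>\<^sup>2) \<sigma> y) \<partial>lborel)"
    by (intro nn_integral_cong) (simp add: eq flip: ennreal_mult)
  also have "\<dots> = ennreal (exp (\<sigma>\<^sup>2 / 2)) * (\<integral>\<^sup>+y. ennreal (normal_density (\<sigma>\<^sup>2) \<sigma> y) \<partial>lborel)"
    by (rule nn_integral_cmult) auto
  also have "(\<integral>\<^sup>+y. ennreal (normal_density (\<sigma>\<^sup>2) \<sigma> y) \<partial>lborel) = 1"
    using \<sigma> by (subst nn_integral_eq_integral) auto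
  finally show ?thesis by simp
qed

section \<open>The market and its martingale measure\<close>

locale black_scholes =
  fixes mk :: "('a, 'n::finite) bs_market"
  assumes bs: "black_scholes_market mk"
begin

abbreviation "M \<equiv> pspace mk"
abbreviation "F \<equiv> filt mk"
abbreviation "T \<equiv> horizon mk"
abbreviation "W \<equiv> wiener mk"
abbreviation "Q \<equiv> corr mk"
abbreviation "N \<equiv> martingale_measure mk"
abbreviation "\<theta> \<equiv> theta mk"

text \<open>The direction of the change of measure: tilting by
  \<open>exp (- (q \<bullet> W))\<close> gives \<open>W\<close> the drift
  \<open>- (Q *v q) = - \<theta>\<close>.\<close>

definition q :: "real ^ 'n" where "q = matrix_inv Q *v \<theta>"

text \<open>Adding the market price of risk back makes \<open>V\<close> the driving process that has
  centred increments under \<open>N\<close>.\<close>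

definition V :: "real \<Rightarrow> 'a \<Rightarrow> real ^ 'n" where "V t \<omega> = W t \<omega> + t *\<^sub>R \<theta>"

text \<open>The density process: \<open>Z t\<close> is the density of \<open>N\<close> on
  \<open>F t\<close>. The number \<open>\<theta> \<bullet> q\<close> is the squared norm in
  \<open>Z_T\<close>.\<close>

definition Z :: "real \<Rightarrow> 'a \<Rightarrow> real" where "Z t \<omega> = exp (- (q \<bullet> W t \<omega>) - t / 2 * (\<theta> \<bullet> q))"

lemma T_pos: "0 < T" and prob_M: "prob_space M" and filtr: "filtration_upto M F T"
  and corr: "correlation_matrix Q" and wiener: "Q_wiener_process M F T Q W"
  and vol_pos: "0 < vol mk $ i"
  using bs by (auto simp: black_scholes_market_def)

sublocale M: prob_space M by (rule prob_M)

lemma posdef: "symmetric_posdef Q" and corr_diag: "Q $ i $ i = 1"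
  using corr by (auto simp: correlation_matrix_def)

lemma Q_sym: "(Q *v x) \<bullet> y = x \<bullet> (Q *v y)"
  using posdef by (metis symmetric_posdef_def dot_lmul_matrix vector_transpose_matrix)

lemma Q_q: "Q *v q = \<theta>"
  by (simp add: q_def matrix_vector_mul_assoc matrix_inv_inverse symmetric_posdef_invertible posdef)

lemma subalg: "t \<in> {0..T} \<Longrightarrow> subalgebra M (F t)"
  and filt_mono: "0 \<le> s \<Longrightarrow> s \<le> t \<Longrightarrow> t \<le> T \<Longrightarrow> sets (F s) \<subseteq> sets (F t)"
  using filtr by (auto simp: filtration_upto_def)

lemma space_F: "t \<in> {0..T} \<Longrightarrow> space (F t) = space M"
  using subalg by (auto simp: subalgebra_def)

lemma measurable_F_M: "t \<in> {0..T} \<Longrightarrow> f \<in> measurable (F t) R \<Longrightarrow> f \<in> measurable M R"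
  using measurable_from_subalg subalg by blast

lemma measurable_F_mono:
  assumes "0 \<le> s" "s \<le> t" "t \<le> T" "f \<in> measurable (F s) R"
  shows "f \<in> measurable (F t) R"
proof -
  have "subalgebra (F t) (F s)" using assms filt_mono space_F by (auto simp: subalgebra_def)
  then show ?thesis using assms(4) by (rule measurable_from_subalg)
qed

lemma W_measurable_F: "t \<in> {0..T} \<Longrightarrow> W t \<in> borel_measurable (F t)"
  using wiener by (simp add: Q_wiener_process_def)

lemma W_measurable_F_le: "0 \<le> s \<Longrightarrow> s \<le> t \<Longrightarrow> t \<le> T \<Longrightarrow> W s \<in> borel_measurable (F t)"
  by (rule measurable_F_mono[OF _ _ _ W_measurable_F]) auto

lemma W_measurable: "t \<in> {0..T} \<Longrightarrow> W t \<in> borel_measurable M"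
  by (blast intro: measurable_F_M W_measurable_F)

section \<open>Gaussian increments and the change of measure\<close>

text \<open>The factor known at time \<open>s\<close> is independent of the increment, so the
  integral splits. Values in \<open>ennreal\<close> spare any integrability condition on
  \<xi>.\<close>

lemma nn_integral_exp_increment:
  assumes st: "0 \<le> s" "s \<le> t" "t \<le> T" and \<xi>[measurable]: "\<xi> \<in> borel_measurable (F s)"
  shows "(\<integral>\<^sup>+\<omega>. \<xi> \<omega> * ennreal (exp (a \<bullet> (W t \<omega> - W s \<omega>))) \<partial>M)
    = ennreal (exp ((t - s) / 2 * (a \<bullet> (Q *v a)))) * (\<integral>\<^sup>+\<omega>. \<xi> \<omega> \<partial>M)"
proof (cases "s = t \<or> a = 0")
  case True
  then show ?thesis by auto
next
  case False
  then have "s < t" and a: "a \<noteq> 0" using st by auto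
  have sT: "s \<in> {0..T}" using st by auto
  have tT: "t \<in> {0..T}" using st by auto
  note [measurable] = W_measurable[OF sT] W_measurable[OF tT]
  define Y where "Y = (\<lambda>\<omega>. W t \<omega> - W s \<omega>)"
  have Y[measurable]: "Y \<in> borel_measurable M" unfolding Y_def by measurable
  define e where "e = (\<lambda>y::real^'n. ennreal (exp (a \<bullet> y)))"
  have e[measurable]: "e \<in> borel_measurable borel" unfolding e_def by measurable
  have ind: "M.indep_set (sets (F s)) {Y -` A \<inter> space M | A. A \<in> sets borel}"
    and dist: "distributed M lborel (\<lambda>\<omega>. a \<bullet> Y \<omega>)
             (\<lambda>y. ennreal (normal_density 0 (sqrt ((t - s) * (a \<bullet> (Q *v a)))) y))"
    using wiener \<open>s < t\<close> st a unfolding Q_wiener_process_def Y_def by auto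
  \<comment> \<open>Independence is given for preimages of Borel sets under the increment; these are
    stable under intersection, so it extends to the sigma-algebra they generate.\<close>
  have iset: "M.indep_set (sets (F s)) (sigma_sets (space M) {Y -` A \<inter> space M | A. A \<in> sets borel})"
  proof -
    have "Int_stable {Y -` A \<inter> space M | A. A \<in> sets borel}"
    proof (rule Int_stableI)
      fix a b assume "a \<in> {Y -` A \<inter> space M | A. A \<in> sets borel}" "b \<in> {Y -` A \<inter> space M | A. A \<in> sets borel}"
      then obtain A B where "A \<in> sets borel" "B \<in> sets borel" "a \<inter> b = Y -` (A \<inter> B) \<inter> space M" by blast
      then show "a \<inter> b \<in> {Y -` A \<inter> space M | A. A \<in> sets borel}" by blast
    qed
    from M.indep_set_sigma_sets[OF ind sets.Int_stable this] show ?thesis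
      using sets.sigma_sets_eq[of "F s"] space_F[OF sT] by simp
  qed
  have "sigma_sets (space M) {\<xi> -` A \<inter> space M | A. A \<in> sets borel} \<subseteq> sets (F s)"
    unfolding space_F[OF sT, symmetric] using measurable_sets[OF \<xi>]
    by (intro sets.sigma_sets_subset) blast
  moreover have "{(e \<circ> Y) -` A \<inter> space M | A. A \<in> sets borel} \<subseteq> {Y -` A \<inter> space M | A. A \<in> sets borel}"
  proof safe
    fix A :: "ennreal set" assume "A \<in> sets borel"
    then have "e -` A \<in> sets borel" using measurable_sets[OF e, of A] by simp
    then show "\<exists>B. (e \<circ> Y) -` A \<inter> space M = Y -` B \<inter> space M \<and> B \<in> sets borel"
      by (intro exI[of _ "e -` A"]) (auto simp: vimage_comp)
  qed
  then have "sigma_sets (space M) {(e \<circ> Y) -` A \<inter> space M | A. A \<in> sets borel}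
      \<subseteq> sigma_sets (space M) {Y -` A \<inter> space M | A. A \<in> sets borel}"
    by (rule sigma_sets_mono')
  ultimately have "M.indep_set (sigma_sets (space M) {\<xi> -` A \<inter> space M | A. A \<in> sets borel})
      (sigma_sets (space M) {(e \<circ> Y) -` A \<inter> space M | A. A \<in> sets borel})"
    using iset unfolding M.indep_set_def
    by (elim M.indep_sets_mono_sets) (auto split: bool.split)
  then have "M.indep_var borel \<xi> borel (e \<circ> Y)"
    unfolding M.indep_var_eq using measurable_F_M[OF sT \<xi>] by simp
  then have "M.indep_vars (\<lambda>_. borel) (case_bool \<xi> (\<lambda>\<omega>. e (Y \<omega>))) UNIV"
  proof -
    have "case_bool borel borel = (\<lambda>_. borel :: ennreal measure)"
      by (simp add: fun_eq_iff split: bool.split)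
    then show ?thesis using \<open>M.indep_var borel \<xi> borel (e \<circ> Y)\<close>
      unfolding M.indep_var_def by (simp add: o_def)
  qed
  from M.indep_vars_nn_integral[OF _ this]
  have "(\<integral>\<^sup>+\<omega>. \<xi> \<omega> * e (Y \<omega>) \<partial>M) = (\<integral>\<^sup>+\<omega>. \<xi> \<omega> \<partial>M) * (\<integral>\<^sup>+\<omega>. e (Y \<omega>) \<partial>M)"
    by (simp add: UNIV_bool mult.commute)
  also have "(\<integral>\<^sup>+\<omega>. e (Y \<omega>) \<partial>M) = (\<integral>\<^sup>+\<omega>. (\<lambda>y. ennreal (exp y)) (a \<bullet> Y \<omega>) \<partial>M)"
    by (simp add: e_def)
  also have "\<dots> = ennreal (exp ((sqrt ((t - s) * (a \<bullet> (Q *v a))))\<^sup>2 / 2))"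
  proof (subst distributed_nn_integral[OF dist, symmetric])
    have "0 < (t - s) * (a \<bullet> (Q *v a))"
      using \<open>s < t\<close> posdef a by (simp add: symmetric_posdef_def)
    then show "(\<integral>\<^sup>+x. ennreal (normal_density 0 (sqrt ((t - s) * (a \<bullet> (Q *v a)))) x) * ennreal (exp x) \<partial>lborel) =
      ennreal (exp ((sqrt ((t - s) * (a \<bullet> (Q *v a))))\<^sup>2 / 2))"
      by (intro nn_integral_normal_exp) simp
  qed simp
  also have "(sqrt ((t - s) * (a \<bullet> (Q *v a))))\<^sup>2 = (t - s) * (a \<bullet> (Q *v a))"
    using \<open>s < t\<close> posdef a by (simp add: symmetric_posdef_def less_imp_le)
  finally show ?thesis by (simp add: e_def Y_def mult.commute)
qed

lemma Z_T_eq: "Z_T mk = Z T"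
  unfolding Z_T_def Z_def q_def[symmetric] fun_eq_iff
  by (simp add: norm_matrix_sqrt_inv posdef q_def[symmetric])

lemma Z_pos: "0 < Z t \<omega>" by (simp add: Z_def)

lemma Z_measurable: "0 \<le> s \<Longrightarrow> s \<le> t \<Longrightarrow> t \<le> T \<Longrightarrow> Z s \<in> borel_measurable (F t)"
  using W_measurable_F_le unfolding Z_def[abs_def] by measurable

lemma ZT_measurable[measurable]: "Z T \<in> borel_measurable M"
  using Z_measurable[of T T] measurable_F_M[of T] T_pos by simp

lemma sets_N[simp, measurable_cong]: "sets N = sets M" and space_N[simp]: "space N = space M"
  by (simp_all add: martingale_measure_def)

lemma N_eq: "N = density M (\<lambda>\<omega>. ennreal (Z T \<omega>))"
  by (simp add: martingale_measure_def Z_T_eq)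

lemma nn_integral_N:
  assumes "f \<in> borel_measurable M"
  shows "(\<integral>\<^sup>+\<omega>. f \<omega> \<partial>N) = (\<integral>\<^sup>+\<omega>. ennreal (Z T \<omega>) * f \<omega> \<partial>M)"
  unfolding N_eq by (rule nn_integral_density) (use assms in auto)

text \<open>The martingale property of the density process in integrated form:
  \<open>Z T / Z t\<close> is an exponential of the increment after \<open>t\<close>, normalised to
  mean one and independent of \<open>F t\<close>.\<close>

lemma nn_integral_N_restrict:
  assumes t: "0 \<le> t" "t \<le> T" and \<xi>: "\<xi> \<in> borel_measurable (F t)"
  shows "(\<integral>\<^sup>+\<omega>. \<xi> \<omega> \<partial>N) = (\<integral>\<^sup>+\<omega>. ennreal (Z t \<omega>) * \<xi> \<omega> \<partial>M)"
proof -
  have tT: "t \<in> {0..T}" using t by auto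
  note [measurable] = \<xi> Z_measurable[OF t(1) order_refl t(2)]
  define k where "k = exp (- ((T - t) / 2 * (\<theta> \<bullet> q)))"
  have Zeq: "Z T \<omega> = k * Z t \<omega> * exp ((- q) \<bullet> (W T \<omega> - W t \<omega>))" for \<omega>
    unfolding Z_def k_def exp_add[symmetric]
    by (simp add: inner_simps exp_add[symmetric]) (simp add: field_simps)
  have "(\<integral>\<^sup>+\<omega>. \<xi> \<omega> \<partial>N) = (\<integral>\<^sup>+\<omega>. ennreal (Z T \<omega>) * \<xi> \<omega> \<partial>M)"
    using measurable_F_M[OF tT \<xi>] by (rule nn_integral_N)
  also have "\<dots> = (\<integral>\<^sup>+\<omega>. (ennreal k * (ennreal (Z t \<omega>) * \<xi> \<omega>)) * ennreal (exp ((- q) \<bullet> (W T \<omega> - W t \<omega>))) \<partial>M)"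
    by (intro nn_integral_cong)
      (simp add: Zeq ennreal_mult Z_pos less_imp_le k_def mult_ac)
  also have "\<dots> = ennreal (exp ((T - t) / 2 * ((- q) \<bullet> (Q *v (- q))))) * (\<integral>\<^sup>+\<omega>. ennreal k * (ennreal (Z t \<omega>) * \<xi> \<omega>) \<partial>M)"
    using t by (intro nn_integral_exp_increment) (auto intro!: borel_measurable_times_ennreal)
  also have "(\<integral>\<^sup>+\<omega>. ennreal k * (ennreal (Z t \<omega>) * \<xi> \<omega>) \<partial>M) = ennreal k * (\<integral>\<^sup>+\<omega>. ennreal (Z t \<omega>) * \<xi> \<omega> \<partial>M)"
    by (intro nn_integral_cmult measurable_F_M[OF tT]) measurable
  also have "(- q) \<bullet> (Q *v (- q)) = \<theta> \<bullet> q"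
    using linear_neg[OF matrix_vector_mul_linear, of Q q] by (simp add: Q_q inner_commute)
  also have "ennreal (exp ((T - t) / 2 * (\<theta> \<bullet> q))) * (ennreal k * (\<integral>\<^sup>+\<omega>. ennreal (Z t \<omega>) * \<xi> \<omega> \<partial>M))
    = ennreal (exp ((T - t) / 2 * (\<theta> \<bullet> q)) * k) * (\<integral>\<^sup>+\<omega>. ennreal (Z t \<omega>) * \<xi> \<omega> \<partial>M)"
    by (simp add: ennreal_mult k_def mult.assoc)
  also have "exp ((T - t) / 2 * (\<theta> \<bullet> q)) * k = 1" by (simp add: k_def flip: exp_add)
  finally show ?thesis by simp
qed

text \<open>Girsanov's theorem on the level of Laplace transforms: under \<open>N\<close> the
  increments of \<open>V\<close> have the exponential moments that those of \<open>W\<close> have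
  under \<open>M\<close>. The density ratio replaces \<open>u\<close> by \<open>u - q\<close>, and
  by \<open>Q *v q = \<theta>\<close> the cross term of the quadratic form cancels the drift of
  \<open>V\<close>.\<close>

lemma nn_integral_N_exp_increment:
  assumes st: "0 \<le> s" "s \<le> t" "t \<le> T" and \<xi>: "\<xi> \<in> borel_measurable (F s)"
  shows "(\<integral>\<^sup>+\<omega>. \<xi> \<omega> * ennreal (exp (u \<bullet> (V t \<omega> - V s \<omega>))) \<partial>N)
    = ennreal (exp ((t - s) / 2 * (u \<bullet> (Q *v u)))) * (\<integral>\<^sup>+\<omega>. \<xi> \<omega> \<partial>N)"
proof -
  note [measurable] = \<xi> measurable_F_mono[OF st \<xi>] Z_measurable[OF st(1) order_refl]
    Z_measurable[OF _ order_refl] W_measurable_F_le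
  have sT: "s \<in> {0..T}" "0 \<le> t" "t \<in> {0..T}" using st by auto
  have Wm[measurable]: "W t \<in> borel_measurable (F t)" "W s \<in> borel_measurable (F t)"
    using st by (auto intro: W_measurable_F_le)
  have Zm[measurable]: "Z s \<in> borel_measurable (F s)" using st by (intro Z_measurable) auto
  define k where "k = exp ((t - s) * (u \<bullet> \<theta>) - (t - s) / 2 * (\<theta> \<bullet> q))"
  have eq: "Z t \<omega> * exp (u \<bullet> (V t \<omega> - V s \<omega>)) = k * Z s \<omega> * exp ((u - q) \<bullet> (W t \<omega> - W s \<omega>))" for \<omega>
    unfolding Z_def k_def V_def exp_add[symmetric]
    by (simp add: inner_simps exp_add[symmetric]) (simp add: field_simps)
  have quad: "(u - q) \<bullet> (Q *v (u - q)) = u \<bullet> (Q *v u) - 2 * (u \<bullet> \<theta>) + \<theta> \<bullet> q"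
    using Q_sym[of q u] by (simp add: matrix_vector_mult_diff_distrib inner_simps Q_q inner_commute)
  have Vm[measurable]: "(\<lambda>\<omega>. u \<bullet> (V t \<omega> - V s \<omega>)) \<in> borel_measurable (F t)"
    unfolding V_def by measurable
  have "(\<integral>\<^sup>+\<omega>. \<xi> \<omega> * ennreal (exp (u \<bullet> (V t \<omega> - V s \<omega>))) \<partial>N)
      = (\<integral>\<^sup>+\<omega>. ennreal (Z t \<omega>) * (\<xi> \<omega> * ennreal (exp (u \<bullet> (V t \<omega> - V s \<omega>)))) \<partial>M)"
    using sT st by (intro nn_integral_N_restrict) auto
  also have "\<dots> = (\<integral>\<^sup>+\<omega>. (ennreal k * (ennreal (Z s \<omega>) * \<xi> \<omega>)) * ennreal (exp ((u - q) \<bullet> (W t \<omega> - W s \<omega>))) \<partial>M)"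
  proof (intro nn_integral_cong)
    fix \<omega>
    have "ennreal (Z t \<omega>) * (\<xi> \<omega> * ennreal (exp (u \<bullet> (V t \<omega> - V s \<omega>))))
        = \<xi> \<omega> * ennreal (Z t \<omega> * exp (u \<bullet> (V t \<omega> - V s \<omega>)))"
      by (simp add: ennreal_mult Z_pos less_imp_le mult_ac)
    also have "\<dots> = (ennreal k * (ennreal (Z s \<omega>) * \<xi> \<omega>)) * ennreal (exp ((u - q) \<bullet> (W t \<omega> - W s \<omega>)))"
      unfolding eq by (simp add: ennreal_mult Z_pos less_imp_le k_def mult_ac)
    finally show "ennreal (Z t \<omega>) * (\<xi> \<omega> * ennreal (exp (u \<bullet> (V t \<omega> - V s \<omega>)))) = \<dots>" .
  qed
  also have "\<dots> = ennreal (exp ((t - s) / 2 * ((u - q) \<bullet> (Q *v (u - q))))) * (\<integral>\<^sup>+\<omega>. ennreal k * (ennreal (Z s \<omega>) * \<xi> \<omega>) \<partial>M)"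
    by (intro nn_integral_exp_increment st) measurable
  also have "(\<integral>\<^sup>+\<omega>. ennreal k * (ennreal (Z s \<omega>) * \<xi> \<omega>) \<partial>M) = ennreal k * (\<integral>\<^sup>+\<omega>. ennreal (Z s \<omega>) * \<xi> \<omega> \<partial>M)"
    by (intro nn_integral_cmult measurable_F_M[OF sT(1)]) measurable
  also have "(\<integral>\<^sup>+\<omega>. ennreal (Z s \<omega>) * \<xi> \<omega> \<partial>M) = (\<integral>\<^sup>+\<omega>. \<xi> \<omega> \<partial>N)"
    using st by (intro nn_integral_N_restrict[symmetric] \<xi>) auto
  also have "ennreal (exp ((t - s) / 2 * ((u - q) \<bullet> (Q *v (u - q))))) * (ennreal k * (\<integral>\<^sup>+\<omega>. \<xi> \<omega> \<partial>N))
      = ennreal (exp ((t - s) / 2 * ((u - q) \<bullet> (Q *v (u - q)))) * k) * (\<integral>\<^sup>+\<omega>. \<xi> \<omega> \<partial>N)"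
    by (simp add: ennreal_mult k_def mult.assoc)
  also have "exp ((t - s) / 2 * ((u - q) \<bullet> (Q *v (u - q)))) * k = exp ((t - s) / 2 * (u \<bullet> (Q *v u)))"
    unfolding quad k_def exp_add[symmetric] by (simp add: field_simps)
  finally show ?thesis .
qed

sublocale N: prob_space N
proof
  \<comment> \<open>The density at time zero is almost surely one, so restricting to
    \<open>F 0\<close> gives the total mass.\<close>
  have "AE \<omega> in M. Z 0 \<omega> = 1" using wiener by (auto simp: Q_wiener_process_def Z_def)
  then have "(\<integral>\<^sup>+\<omega>. ennreal (Z 0 \<omega>) * 1 \<partial>M) = (\<integral>\<^sup>+\<omega>. 1 \<partial>M)"
    by (intro nn_integral_cong_AE) auto
  then have "(\<integral>\<^sup>+\<omega>. 1 \<partial>N) = 1"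
    using nn_integral_N_restrict[of 0 "\<lambda>_. 1"] T_pos M.emeasure_space_1 by simp
  then show "emeasure N (space N) = 1" by simp
qed

lemma AE_N_iff: "(AE \<omega> in N. P \<omega>) \<longleftrightarrow> (AE \<omega> in M. P \<omega>)"
  unfolding N_eq by (subst AE_density) (auto simp: Z_pos)

lemma integrable_N_iff:
  "f \<in> borel_measurable M \<Longrightarrow> integrable N f \<longleftrightarrow> integrable M (\<lambda>\<omega>. Z T \<omega> * f \<omega>)"
  unfolding N_eq by (subst integrable_density) (auto simp: Z_pos less_imp_le)

lemma integral_N_eq:
  "f \<in> borel_measurable M \<Longrightarrow> (\<integral>\<omega>. f \<omega> \<partial>N) = (\<integral>\<omega>. Z T \<omega> * f \<omega> \<partial>M)"
  unfolding N_eq by (subst integral_density) (auto simp: Z_pos less_imp_le)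

section \<open>Moments of the increments under the martingale measure\<close>

context
  fixes s t :: real and i :: 'n
  assumes st: "0 \<le> s" "s \<le> t" "t \<le> T"
begin

definition "dV = (\<lambda>\<omega>. V t \<omega> $ i - V s \<omega> $ i)"

lemma dV_measurable_F: "dV \<in> borel_measurable (F t)"
proof -
  have [measurable]: "W t \<in> borel_measurable (F t)" "W s \<in> borel_measurable (F t)"
    using st by (auto intro: W_measurable_F_le)
  have [measurable]: "(\<lambda>x::real^'n. x $ i) \<in> borel_measurable borel"
    by (intro borel_measurable_continuous_onI continuous_intros)
  show ?thesis unfolding dV_def V_def by measurable
qed

lemma dV_measurable[measurable]: "dV \<in> borel_measurable M"
  by (rule measurable_F_M[OF _ dV_measurable_F]) (use st in auto)

lemma nn_integral_exp_dV:
  assumes "\<xi> \<in> borel_measurable (F s)"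
  shows "(\<integral>\<^sup>+\<omega>. \<xi> \<omega> * ennreal (exp (l * dV \<omega>)) \<partial>N) = ennreal (exp (l\<^sup>2 * (t - s) / 2)) * (\<integral>\<^sup>+\<omega>. \<xi> \<omega> \<partial>N)"
proof -
  have 1: "axis i l \<bullet> (V t \<omega> - V s \<omega>) = l * dV \<omega>" for \<omega>
    by (simp add: dV_def inner_axis inner_axis')
  have 2: "axis i l \<bullet> (Q *v axis i l) = l\<^sup>2"
    unfolding inner_axis'
    by (simp add: matrix_vector_mult_def axis_def power2_eq_square corr_diag
        if_distrib[of "\<lambda>x. _ * x"] cong: if_cong)
  show ?thesis
    using nn_integral_N_exp_increment[OF st assms, of "axis i l"] by (simp add: 1 2 mult_ac)
qed

lemma nn_integral_exp_dV_1: "(\<integral>\<^sup>+\<omega>. ennreal (exp (l * dV \<omega>)) \<partial>N) = ennreal (exp (l\<^sup>2 * (t - s) / 2))"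
  using nn_integral_exp_dV[of "\<lambda>_. 1" l] N.emeasure_space_1 by simp

lemma integrable_exp_dV: "integrable N (\<lambda>\<omega>. exp (l * dV \<omega>))"
  by (rule integrableI_nonneg) (auto simp: nn_integral_exp_dV_1)

lemma integrable_dV: "integrable N dV"
proof (rule Bochner_Integration.integrable_bound)
  show "integrable N (\<lambda>\<omega>. exp (1 * dV \<omega>) + exp (- 1 * dV \<omega>))"
    by (intro Bochner_Integration.integrable_add integrable_exp_dV)
  have "\<bar>x\<bar> \<le> exp x + exp (-x)" for x :: real
    using exp_ge_add_one_self[of x] exp_ge_add_one_self[of "-x"] exp_gt_zero[of x] exp_gt_zero[of "-x"]
    by linarith
  then show "AE \<omega> in N. norm (dV \<omega>) \<le> norm (exp (1 * dV \<omega>) + exp (- 1 * dV \<omega>))"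
    by (auto intro!: AE_I2 order_trans[OF _ abs_ge_self])
qed measurable

lemma integrable_mult_dV:
  assumes \<xi>: "\<xi> \<in> borel_measurable (F s)" and C: "\<And>\<omega>. \<omega> \<in> space M \<Longrightarrow> \<bar>\<xi> \<omega>\<bar> \<le> C"
  shows "integrable N (\<lambda>\<omega>. \<xi> \<omega> * dV \<omega>)"
proof (rule Bochner_Integration.integrable_bound)
  show "integrable N (\<lambda>\<omega>. C * dV \<omega>)" using integrable_dV by simp
  have [measurable]: "\<xi> \<in> borel_measurable M" using \<xi> by (rule measurable_F_M[rotated]) (use st in auto)
  show "(\<lambda>\<omega>. \<xi> \<omega> * dV \<omega>) \<in> borel_measurable N" by measurable
  show "AE \<omega> in N. norm (\<xi> \<omega> * dV \<omega>) \<le> norm (C * dV \<omega>)"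
  proof (rule AE_I2)
    fix \<omega> assume "\<omega> \<in> space N"
    then have "\<bar>\<xi> \<omega>\<bar> \<le> \<bar>C\<bar>" using C[of \<omega>] by simp
    then show "norm (\<xi> \<omega> * dV \<omega>) \<le> norm (C * dV \<omega>)" by (simp add: abs_mult mult_right_mono)
  qed
qed

text \<open>
  \<open>1 + l x \<le> exp (l x)\<close> gives \<open>l E[\<xi> dV] \<le> (exp (l\<^sup>2 (t - s)/2) - 1) E[\<xi>]\<close> for every real \<open>l\<close>; a linear
  function of \<open>l\<close> dominated by \<open>O(l\<^sup>2)\<close> on both sides of zero vanishes.
\<close>

lemma integral_mult_dV_nonneg:
  assumes \<xi>: "\<xi> \<in> borel_measurable (F s)" and C: "\<And>\<omega>. \<omega> \<in> space M \<Longrightarrow> 0 \<le> \<xi> \<omega> \<and> \<xi> \<omega> \<le> C"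
  shows "(\<integral>\<omega>. \<xi> \<omega> * dV \<omega> \<partial>N) = 0"
proof -
  have \<xi>M[measurable]: "\<xi> \<in> borel_measurable M" using \<xi> by (rule measurable_F_M[rotated]) (use st in auto)
  have i\<xi>: "integrable N \<xi>" by (rule N.integrable_const_bound[where B = C]) (use C in auto)
  define K where "K = (\<integral>\<omega>. \<xi> \<omega> \<partial>N)"
  have K: "0 \<le> K" unfolding K_def using C by (intro integral_nonneg_AE AE_I2) auto
  define a where "a = (\<integral>\<omega>. \<xi> \<omega> * dV \<omega> \<partial>N)"
  have main: "l * a \<le> (exp (l\<^sup>2 * (t - s) / 2) - 1) * K" for l
  proof -
    have e: "(\<integral>\<^sup>+\<omega>. ennreal (\<xi> \<omega> * exp (l * dV \<omega>)) \<partial>N) = ennreal (exp (l\<^sup>2 * (t - s) / 2) * K)"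
    proof -
      have "(\<integral>\<^sup>+\<omega>. ennreal (\<xi> \<omega> * exp (l * dV \<omega>)) \<partial>N) = (\<integral>\<^sup>+\<omega>. ennreal (\<xi> \<omega>) * ennreal (exp (l * dV \<omega>)) \<partial>N)"
        using C by (intro nn_integral_cong) (auto simp: ennreal_mult)
      also have "\<dots> = ennreal (exp (l\<^sup>2 * (t - s) / 2)) * (\<integral>\<^sup>+\<omega>. ennreal (\<xi> \<omega>) \<partial>N)"
        by (intro nn_integral_exp_dV measurable_compose[OF \<xi> measurable_ennreal])
      also have "(\<integral>\<^sup>+\<omega>. ennreal (\<xi> \<omega>) \<partial>N) = ennreal K"
        unfolding K_def using C by (intro nn_integral_eq_integral i\<xi> AE_I2) auto
      finally show ?thesis using K by (simp add: ennreal_mult)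
    qed
    have ie: "integrable N (\<lambda>\<omega>. \<xi> \<omega> * exp (l * dV \<omega>))"
      by (rule integrableI_nonneg) (use C in \<open>auto simp: e\<close>)
    have "(\<integral>\<omega>. \<xi> \<omega> * exp (l * dV \<omega>) \<partial>N) = exp (l\<^sup>2 * (t - s) / 2) * K"
      using C K by (subst integral_eq_nn_integral) (auto simp: e)
    moreover have "(\<integral>\<omega>. \<xi> \<omega> + l * (\<xi> \<omega> * dV \<omega>) \<partial>N) \<le> (\<integral>\<omega>. \<xi> \<omega> * exp (l * dV \<omega>) \<partial>N)"
    proof (rule integral_mono_AE)
      show "integrable N (\<lambda>\<omega>. \<xi> \<omega> + l * (\<xi> \<omega> * dV \<omega>))"
        using C by (intro Bochner_Integration.integrable_add i\<xi> integrable_mult_right integrable_mult_dV[where C = C] \<xi>) auto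
      show "AE \<omega> in N. \<xi> \<omega> + l * (\<xi> \<omega> * dV \<omega>) \<le> \<xi> \<omega> * exp (l * dV \<omega>)"
      proof (rule AE_I2)
        fix \<omega> assume "\<omega> \<in> space N"
        then have "\<xi> \<omega> * (1 + l * dV \<omega>) \<le> \<xi> \<omega> * exp (l * dV \<omega>)"
          using C by (intro mult_left_mono exp_ge_add_one_self) auto
        then show "\<xi> \<omega> + l * (\<xi> \<omega> * dV \<omega>) \<le> \<xi> \<omega> * exp (l * dV \<omega>)" by (simp add: algebra_simps)
      qed
    qed (rule ie)
    moreover have "(\<integral>\<omega>. \<xi> \<omega> + l * (\<xi> \<omega> * dV \<omega>) \<partial>N) = K + l * a"
      unfolding K_def a_def using C
      by (subst Bochner_Integration.integral_add) (auto intro!: i\<xi> integrable_mult_right integrable_mult_dV[where C = C] \<xi>)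
    ultimately show ?thesis by (simp add: algebra_simps)
  qed
  have small: "l * a \<le> l\<^sup>2 * ((t - s) * K)" if l: "l\<^sup>2 * (t - s) / 2 \<le> 1" for l
  proof -
    define z where "z = l\<^sup>2 * (t - s) / 2"
    have z: "0 \<le> z" "z \<le> 1" using l st by (auto simp: z_def)
    have "exp z - 1 \<le> 2 * z" using exp_bound[OF z] z mult_left_mono[of z 1 z] by (simp add: power2_eq_square)
    then have "(exp z - 1) * K \<le> 2 * z * K" using K by (intro mult_right_mono)
    then show ?thesis using main[of l] by (simp add: z_def mult_ac)
  qed
  have "a = 0"
  proof (rule ccontr)
    assume "a \<noteq> 0"
    define c where "c = (t - s) * K"
    have c: "0 \<le> c" using st K by (simp add: c_def)
    \<comment> \<open>The first bound gives \<open>d * c < \<bar>a\<bar>\<close>, against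
      \<open>\<bar>a\<bar> \<le> d * c\<close> from \<open>small\<close>; the second keeps the
      exponent within the range where \<open>small\<close> applies. Both signs of \<open>d\<close>
      are used because the sign of \<open>a\<close> is unknown.\<close>
    define d where "d = min (\<bar>a\<bar> / (c + 1)) (1 / (t - s + 1))"
    have d: "0 < d" using \<open>a \<noteq> 0\<close> c st by (auto simp: d_def)
    have d1: "d \<le> 1 / (t - s + 1)" and d2: "d \<le> \<bar>a\<bar> / (c + 1)" by (auto simp: d_def)
    have "d\<^sup>2 * (t - s) / 2 \<le> 1"
    proof -
      have "d * (t - s + 1) \<le> 1" using d1 st by (simp add: pos_le_divide_eq)
      then have "d * (t - s) + d \<le> 1" by (simp add: distrib_left)
      moreover have "0 \<le> d * (t - s)" using st d by simp
      ultimately have "d * (t - s) \<le> 1" "d \<le> 1" using d by linarith+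
      then have "d * (d * (t - s)) \<le> 1 * 1" using d st by (intro mult_mono) auto
      then show ?thesis by (simp add: power2_eq_square mult_ac)
    qed
    from small[of d] small[of "- d"] this have "d * \<bar>a\<bar> \<le> d * (d * c)"
      by (cases "0 \<le> a") (simp_all add: c_def power2_eq_square mult_ac)
    then have "\<bar>a\<bar> \<le> d * c" using d by simp
    also have "\<dots> \<le> \<bar>a\<bar> / (c + 1) * c" using d2 c by (intro mult_right_mono)
    also have "\<dots> < \<bar>a\<bar>" using \<open>a \<noteq> 0\<close> c by (simp add: field_simps)
    finally show False by simp
  qed
  then show ?thesis by (simp add: a_def)
qed

text \<open>Adding the bound \<open>C\<close> reduces the signed case to the nonnegative
  one.\<close>

lemma integral_mult_dV:
  assumes \<xi>: "\<xi> \<in> borel_measurable (F s)" and C: "\<And>\<omega>. \<omega> \<in> space M \<Longrightarrow> \<bar>\<xi> \<omega>\<bar> \<le> C"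
  shows "(\<integral>\<omega>. \<xi> \<omega> * dV \<omega> \<partial>N) = 0"
proof -
  have s: "s \<in> {0..T}" using st by auto
  have "0 \<le> C" using C M.not_empty by (meson abs_ge_zero order_trans ex_in_conv)
  have "(\<integral>\<omega>. (\<xi> \<omega> + C) * dV \<omega> \<partial>N) = 0"
    using C \<xi> by (intro integral_mult_dV_nonneg[where C = "2 * C"]) (fastforce simp: abs_le_iff)+
  moreover have "(\<integral>\<omega>. C * dV \<omega> \<partial>N) = 0"
    using \<open>0 \<le> C\<close> by (intro integral_mult_dV_nonneg[where C = C]) auto
  moreover have "(\<integral>\<omega>. (\<xi> \<omega> + C) * dV \<omega> \<partial>N) = (\<integral>\<omega>. \<xi> \<omega> * dV \<omega> \<partial>N) + (\<integral>\<omega>. C * dV \<omega> \<partial>N)"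
    unfolding distrib_right
    by (intro Bochner_Integration.integral_add integrable_mult_dV[OF \<xi> C] integrable_mult_right integrable_dV)
  ultimately show ?thesis by linarith
qed

text \<open>Rescaling by \<open>l = 1 / sqrt (t - s)\<close> turns both exponential moments into
  \<open>exp (1 / 2)\<close>, and the fourth power is dominated by exponentials. The constant is
  crude: \<open>256 = 4 ^ 4\<close> comes from \<open>(1 + y / 4) ^ 4 \<le> exp y\<close>, and two
  exponentials, each at most 2 in the mean, give 1024.\<close>

lemma nn_integral_dV_power4: "(\<integral>\<^sup>+\<omega>. ennreal ((dV \<omega>) ^ 4) \<partial>N) \<le> ennreal (1024 * (t - s)\<^sup>2)"
proof (cases "s = t")
  case True
  then show ?thesis unfolding dV_def by simp
next
  case False
  define h where "h = t - s"
  have h: "0 < h" using False st by (simp add: h_def)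
  define l where "l = 1 / sqrt h"
  have l2: "l\<^sup>2 * h = 1" using h by (simp add: l_def power_divide)
  have l4: "l ^ 4 * h\<^sup>2 = 1"
  proof -
    have "l ^ 4 * h\<^sup>2 = (l\<^sup>2 * h)\<^sup>2" by (simp add: power_mult_distrib flip: power_mult)
    then show ?thesis by (simp add: l2)
  qed
  have quart: "y ^ 4 \<le> 256 * (exp y + exp (- y))" for y :: real
  proof -
    have *: "y ^ 4 \<le> 256 * exp y" if "0 \<le> y" for y :: real
    proof -
      have "(y / 4) ^ 4 \<le> (1 + y / 4) ^ 4" using that by (intro power_mono) auto
      also have "\<dots> \<le> exp y" using exp_ge_one_plus_x_over_n_power_n[of 4 y] that by simp
      finally show ?thesis by (simp add: power_divide)
    qed
    show ?thesis
    proof (cases "0 \<le> y")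
      case True
      then show ?thesis using *[of y] exp_gt_zero[of "-y"] by (simp add: distrib_left add_increasing2)
    next
      case False
      then have "y ^ 4 \<le> 256 * exp (- y)" using *[of "- y"] by simp
      then show ?thesis using exp_gt_zero[of y] by (simp add: distrib_left add_increasing)
    qed
  qed
  have "(dV \<omega>) ^ 4 \<le> 256 * h\<^sup>2 * (exp (l * dV \<omega>) + exp (- l * dV \<omega>))" for \<omega>
  proof -
    have "(dV \<omega>) ^ 4 = h\<^sup>2 * (l * dV \<omega>) ^ 4" using l4 by (simp add: power_mult_distrib mult_ac)
    also have "\<dots> \<le> h\<^sup>2 * (256 * (exp (l * dV \<omega>) + exp (- (l * dV \<omega>))))"
      by (intro mult_left_mono quart) auto
    finally show ?thesis by (simp add: mult_ac)
  qed
  then have "(\<integral>\<^sup>+\<omega>. ennreal ((dV \<omega>) ^ 4) \<partial>N)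
      \<le> (\<integral>\<^sup>+\<omega>. ennreal (256 * h\<^sup>2) * (ennreal (exp (l * dV \<omega>)) + ennreal (exp (- l * dV \<omega>))) \<partial>N)"
    by (intro nn_integral_mono) (auto simp: ennreal_mult[symmetric] simp flip: ennreal_plus)
  also have "\<dots> = ennreal (256 * h\<^sup>2) * (ennreal (exp (l\<^sup>2 * h / 2)) + ennreal (exp ((- l)\<^sup>2 * h / 2)))"
    by (subst nn_integral_cmult, measurable, subst nn_integral_add, measurable)
      (simp only: nn_integral_exp_dV_1 h_def)
  also have "\<dots> = ennreal (256 * h\<^sup>2 * (2 * exp (1 / 2)))"
    using l2 by (simp add: ennreal_mult[symmetric] flip: ennreal_plus)
  also have "\<dots> \<le> ennreal (1024 * h\<^sup>2)"
  proof -
    have "exp (1 / 2 :: real) \<le> 2" using exp_bound[of "1/2"] by (simp add: power2_eq_square)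
    then have "256 * h\<^sup>2 * (2 * exp (1 / 2)) \<le> 256 * h\<^sup>2 * (2 * 2)" by (intro mult_left_mono) auto
    then show ?thesis by (intro ennreal_leI) simp
  qed
  finally show ?thesis by (simp add: h_def)
qed

end

end

section \<open>Deterministic estimates\<close>

text \<open>Cauchy-Schwarz twice. The cube of the cardinality is harmless: the number of summands
  stays fixed while the time grid is refined.\<close>

lemma sum_power4_le:
  fixes f :: "'b \<Rightarrow> real"
  shows "(\<Sum>i\<in>I. f i) ^ 4 \<le> real (card I) ^ 3 * (\<Sum>i\<in>I. f i ^ 4)"
proof -
  define c where "c = real (card I)"
  have c: "0 \<le> c" by (simp add: c_def)
  have "(\<Sum>i\<in>I. f i) ^ 4 = ((\<Sum>i\<in>I. f i)\<^sup>2)\<^sup>2" by (simp flip: power_mult)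
  also have "\<dots> \<le> ((\<Sum>i\<in>I. (f i)\<^sup>2) * c)\<^sup>2"
    unfolding c_def by (intro power_mono sum_squared_le_sum_of_squares) auto
  also have "\<dots> = (\<Sum>i\<in>I. (f i)\<^sup>2)\<^sup>2 * c\<^sup>2" by (simp add: power_mult_distrib)
  also have "\<dots> \<le> ((\<Sum>i\<in>I. ((f i)\<^sup>2)\<^sup>2) * c) * c\<^sup>2"
    unfolding c_def by (intro mult_right_mono sum_squared_le_sum_of_squares) auto
  also have "\<dots> = c ^ 3 * (\<Sum>i\<in>I. f i ^ 4)"
    by (simp add: power2_eq_square power3_eq_cube power4_eq_xxxx mult_ac)
  finally show ?thesis by (simp add: c_def)
qed

text \<open>An increment of size at most \<open>e\<close> is covered by the first term; for a larger
  one \<open>\<bar>d\<bar> / e\<close> exceeds one, and its cube only enlarges it.\<close>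

lemma abs_le_eps_plus_power4:
  fixes d :: real
  assumes e: "0 < e"
  shows "\<bar>d\<bar> \<le> e + d ^ 4 / e ^ 3"
proof (cases "\<bar>d\<bar> \<le> e")
  case True
  then show ?thesis using e by (simp add: add_increasing2)
next
  case False
  have "\<bar>d\<bar> * 1 \<le> \<bar>d\<bar> * (\<bar>d\<bar> / e) ^ 3"
    using False e by (intro mult_left_mono one_le_power) (auto simp: field_simps)
  also have "\<dots> = d ^ 4 / e ^ 3"
  proof -
    have "\<bar>d\<bar> * \<bar>d\<bar> ^ 3 = d ^ 4" by (simp add: power_even_abs flip: power_Suc)
    then show ?thesis by (simp add: power_divide)
  qed
  finally show ?thesis using e by simp
qed

text \<open>A number, so that it can weight increments. It looks at the path up to index
  \<open>n\<close> only and is therefore a legitimate weight for the step from \<open>n\<close> to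
  \<open>Suc n\<close>.\<close>

definition stays_above :: "real \<Rightarrow> (nat \<Rightarrow> real) \<Rightarrow> nat \<Rightarrow> real" where
  "stays_above a D n = (if \<forall>j\<le>n. a \<le> D j then 1 else 0)"

text \<open>
  The right-hand sum is \<open>D\<close> stopped at its first visit below \<open>- e\<close>; there it undershoots \<open>- e\<close> by at
  most one increment, which is paid for by the fourth powers.
\<close>

lemma stopped_sum_lower_bound:
  fixes D :: "nat \<Rightarrow> real"
  assumes e: "0 < e" and D0: "0 \<le> D 0"
  shows "stays_above (- e) D n * (D n + e)
    \<le> D 0 + (\<Sum>l<n. stays_above (- e) D l * (D (Suc l) - D l)) + 2 * e + (\<Sum>l<n. (D (Suc l) - D l) ^ 4 / e ^ 3)"
proof -
  define S where "S n = D 0 + (\<Sum>l<n. stays_above (- e) D l * (D (Suc l) - D l))" for n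
  define R where "R n = (\<Sum>l<n. (D (Suc l) - D l) ^ 4 / e ^ 3)" for n
  have R: "0 \<le> R n" for n unfolding R_def using e by (intro sum_nonneg) auto
  \<comment> \<open>Before the first visit below \<open>- e\<close> all weights are one and the sum
    telescopes; afterwards it is frozen. The bound is settled at the step that crosses
    \<open>- e\<close>, since \<open>R\<close> only grows later.\<close>
  have "(if \<forall>j\<le>n. - e \<le> D j then S n = D n else - (2 * e) - R n \<le> S n)" for n
  proof (induction n)
    case 0
    then show ?case using e D0 by (auto simp: S_def)
  next
    case (Suc n)
    have R': "R (Suc n) = R n + (D (Suc n) - D n) ^ 4 / e ^ 3" by (simp add: R_def)
    have pos: "0 \<le> (D (Suc n) - D n) ^ 4 / e ^ 3" using e by simp
    show ?case
    proof (cases "\<forall>j\<le>n. - e \<le> D j")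
      case True
      then have "S (Suc n) = D (Suc n)" using Suc by (simp add: S_def stays_above_def)
      moreover have "- (2 * e) - R (Suc n) \<le> D (Suc n)"
      proof -
        have "- e \<le> D n" using True by auto
        moreover have "\<bar>D (Suc n) - D n\<bar> \<le> e + (D (Suc n) - D n) ^ 4 / e ^ 3"
          by (rule abs_le_eps_plus_power4[OF e])
        ultimately show ?thesis using R[of n] unfolding R' by linarith
      qed
      ultimately show ?thesis by simp
    next
      case False
      then have "\<not> (\<forall>j\<le>Suc n. - e \<le> D j)" by (meson le_SucI)
      moreover have "S (Suc n) = S n"
        unfolding S_def sum.lessThan_Suc using False by (auto simp: stays_above_def)
      moreover have "- (2 * e) - R n \<le> S n" using Suc False by simp
      ultimately show ?thesis using R' pos by auto
    qed
  qed
  from this[of n] show ?thesis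
    using e R[of n] unfolding S_def[of n, symmetric] R_def[symmetric]
    by (auto simp: stays_above_def split: if_splits)
qed

section \<open>Discounting along a time grid\<close>

definition grid :: "real \<Rightarrow> nat \<Rightarrow> nat \<Rightarrow> real" where "grid T n l = real l * T / real n"

lemma grid_in: "0 < T \<Longrightarrow> 0 < n \<Longrightarrow> l \<le> n \<Longrightarrow> grid T n l \<in> {0..T}"
  by (auto simp: grid_def field_simps)

lemma grid_Suc: "grid T n (Suc l) = grid T n l + T / real n"
  by (simp add: grid_def distrib_right add_divide_distrib)

lemma grid_0: "grid T n 0 = 0" and grid_n: "0 < n \<Longrightarrow> grid T n n = T"
  by (simp_all add: grid_def)

text \<open>The Riemann-Stieltjes sum for the integral of \<open>exp (- r * t)\<close> against
  \<open>m\<close>, meaningful also for \<open>m\<close> of unbounded variation.\<close>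

definition discounted_sum :: "real \<Rightarrow> real \<Rightarrow> nat \<Rightarrow> (real \<Rightarrow> real) \<Rightarrow> nat \<Rightarrow> real" where
  "discounted_sum r T n m j = (\<Sum>l<j. exp (- r * grid T n l) * (m (grid T n (Suc l)) - m (grid T n l)))"

text \<open>Summation by parts moves the differences from \<open>d\<close> to \<open>c\<close>, so
  that only the size of \<open>d\<close> and the variation of \<open>c\<close> count.\<close>

lemma abel_sum_bound:
  fixes c d :: "nat \<Rightarrow> real"
  assumes "\<And>l. l \<le> j \<Longrightarrow> \<bar>d l\<bar> \<le> k"
  shows "\<bar>(\<Sum>l<j. c l * (d (Suc l) - d l)) - c j * d j\<bar> \<le> k * (\<bar>c 0\<bar> + (\<Sum>l<j. \<bar>c (Suc l) - c l\<bar>))"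
  using assms
proof (induction j)
  case 0
  then show ?case using mult_right_mono[of "\<bar>d 0\<bar>" k "\<bar>c 0\<bar>"] by (simp add: abs_mult mult.commute)
next
  case (Suc j)
  have "\<bar>(c (Suc j) - c j) * d (Suc j)\<bar> \<le> k * \<bar>c (Suc j) - c j\<bar>"
    using mult_right_mono[OF Suc.prems[of "Suc j"], of "\<bar>c (Suc j) - c j\<bar>"]
    by (simp add: abs_mult mult.commute)
  moreover have "(\<Sum>l<Suc j. c l * (d (Suc l) - d l)) - c (Suc j) * d (Suc j)
      = ((\<Sum>l<j. c l * (d (Suc l) - d l)) - c j * d j) - (c (Suc j) - c j) * d (Suc j)"
    by (simp add: algebra_simps)
  ultimately show ?case using Suc by (simp add: distrib_left)
qed

lemma exp_grid_le:
  assumes "0 < T" "0 < n" "l \<le> n"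
  shows "exp (- r * grid T n l) \<le> exp (\<bar>r\<bar> * T)"
proof -
  have "- r * grid T n l \<le> \<bar>r\<bar> * grid T n l" using grid_in[OF assms] by (intro mult_right_mono) auto
  also have "\<dots> \<le> \<bar>r\<bar> * T" using grid_in[OF assms] by (intro mult_left_mono) auto
  finally show ?thesis by simp
qed

text \<open>Makes discounting continuous for uniform convergence. The constant 3 collects the first
  discount factor, the variation of the discount factors and the boundary term, each at most
  \<open>exp (\<bar>r\<bar> * T)\<close>; the variation telescopes because the factors are monotone,
  in a direction given by the sign of \<open>r\<close>.\<close>

lemma discounted_sum_perturb:
  assumes T: "0 < T" and n: "0 < n" and j: "j \<le> n"
    and k: "\<And>t. t \<in> {0..T} \<Longrightarrow> \<bar>m' t - m t\<bar> \<le> k"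
  shows "\<bar>discounted_sum r T n m' j - discounted_sum r T n m j\<bar> \<le> 3 * exp (\<bar>r\<bar> * T) * k"
proof -
  define c where "c l = exp (- r * grid T n l)" for l
  define d where "d l = m' (grid T n l) - m (grid T n l)" for l
  have d: "\<bar>d l\<bar> \<le> k" if "l \<le> j" for l
    unfolding d_def using j that by (intro k grid_in T n) auto
  have k0: "0 \<le> k" using d[of 0] by simp
  have cle: "0 \<le> c l" "c l \<le> exp (\<bar>r\<bar> * T)" if "l \<le> j" for l
    using exp_grid_le[OF T n, of l r] j that by (auto simp: c_def)
  have var: "(\<Sum>l<j. \<bar>c (Suc l) - c l\<bar>) \<le> exp (\<bar>r\<bar> * T)"
  proof (cases "0 \<le> r")
    case True
    have "c (Suc l) \<le> c l" for l
      unfolding c_def using True T by (simp add: grid_Suc mult_left_mono)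
    then have "(\<Sum>l<j. \<bar>c (Suc l) - c l\<bar>) = (\<Sum>l<j. c l - c (Suc l))" by simp
    also have "\<dots> = c 0 - c j" by (rule sum_lessThan_telescope')
    also have "\<dots> \<le> exp (\<bar>r\<bar> * T)" using cle[of 0] cle[of j] by linarith
    finally show ?thesis .
  next
    case False
    have "c l \<le> c (Suc l)" for l
      unfolding c_def using False T by (simp add: grid_Suc mult_left_mono_neg)
    then have "(\<Sum>l<j. \<bar>c (Suc l) - c l\<bar>) = (\<Sum>l<j. c (Suc l) - c l)" by simp
    also have "\<dots> = c j - c 0" by (rule sum_lessThan_telescope)
    also have "\<dots> \<le> exp (\<bar>r\<bar> * T)" using cle[of 0] cle[of j] by linarith
    finally show ?thesis .
  qed
  have "discounted_sum r T n m' j - discounted_sum r T n m j = (\<Sum>l<j. c l * (d (Suc l) - d l))"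
    unfolding discounted_sum_def c_def d_def by (simp add: sum_subtractf[symmetric] algebra_simps)
  moreover have "\<bar>(\<Sum>l<j. c l * (d (Suc l) - d l)) - c j * d j\<bar> \<le> k * (\<bar>c 0\<bar> + (\<Sum>l<j. \<bar>c (Suc l) - c l\<bar>))"
    by (intro abel_sum_bound d)
  moreover have "k * (\<bar>c 0\<bar> + (\<Sum>l<j. \<bar>c (Suc l) - c l\<bar>)) \<le> k * (exp (\<bar>r\<bar> * T) + exp (\<bar>r\<bar> * T))"
    using k0 cle[of 0] var by (intro mult_left_mono add_mono) auto
  moreover have "\<bar>c j * d j\<bar> \<le> exp (\<bar>r\<bar> * T) * k"
    unfolding abs_mult using cle[of j] d[of j] by (intro mult_mono) auto
  ultimately show ?thesis by (simp add: algebra_simps)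
qed

text \<open>
  Variation of constants for \<open>X = x + m + r \<integral>X\<close>: the discounted solution is \<open>x + \<integral> exp (- r t) dm\<close>.
\<close>

lemma discounted_sum_approx:
  fixes X m :: "real \<Rightarrow> real"
  assumes T: "0 < T" and cX: "continuous_on {0..T} X" and X0: "X 0 = x"
    and eq: "\<And>t. t \<in> {0..T} \<Longrightarrow> X t = x + m t + r * integral {0..t} X"
    and e: "0 < e"
  shows "\<exists>n0>0. \<forall>n\<ge>n0. \<forall>j\<le>n. \<bar>x + discounted_sum r T n m j - exp (- r * grid T n j) * X (grid T n j)\<bar> \<le> e"
proof -
  \<comment> \<open>Each of the \<open>n\<close> grid steps costs at most
    \<open>T / n * \<bar>r\<bar> * e'\<close>; the added 1 keeps the denominator positive when
    \<open>r = 0\<close>.\<close>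
  define e' where "e' = e / (\<bar>r\<bar> * T + 1)"
  have den: "0 < \<bar>r\<bar> * T + 1" using T by (simp add: add_nonneg_pos)
  have e': "0 < e'" using e den by (simp add: e'_def)
  \<comment> \<open>The two time arguments are separated because the error density of one step is
    \<open>r * (G (s, b) - G (a, s))\<close>, which uniform continuity of \<open>G\<close> on the
    square makes small.\<close>
  define G where "G = (\<lambda>p. exp (- r * fst p) * X (snd p))"
  have "continuous_on ({0..T} \<times> {0..T}) G"
    unfolding G_def by (intro continuous_intros continuous_on_compose2[OF cX]) auto
  then have "uniformly_continuous_on ({0..T} \<times> {0..T}) G"
    by (intro compact_uniformly_continuous compact_Times) auto
  then obtain d where d: "0 < d" and dG: "\<And>p p'. p \<in> {0..T} \<times> {0..T} \<Longrightarrow> p' \<in> {0..T} \<times> {0..T} \<Longrightarrow>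
      dist p' p < d \<Longrightarrow> dist (G p') (G p) < e'"
    using e' unfolding uniformly_continuous_on_def by meson
  \<comment> \<open>The points \<open>(s, b)\<close> and \<open>(a, s)\<close> differ by at most one
    mesh width in each coordinate, hence the factor 2.\<close>
  obtain n0 :: nat where n0: "2 * T / d < real n0" using reals_Archimedean2 by blast
  have n0pos: "0 < n0"
  proof (rule ccontr)
    assume "\<not> 0 < n0"
    then show False using n0 T d by (simp add: field_simps)
  qed
  have "\<bar>x + discounted_sum r T n m j - exp (- r * grid T n j) * X (grid T n j)\<bar> \<le> real j * (T / real n * (\<bar>r\<bar> * e'))"
    if n: "n0 \<le> n" and j: "j \<le> n" for n j
    using j
  proof (induction j)
    case 0
    then show ?case using X0 by (simp add: discounted_sum_def grid_0)
  next
    case (Suc j)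
    have npos: "0 < n" using n n0pos by simp
    define a where "a = grid T n j"
    define b where "b = grid T n (Suc j)"
    have a: "a \<in> {0..T}" and b: "b \<in> {0..T}"
      unfolding a_def b_def using Suc.prems by (intro grid_in T npos; simp)+
    have ba: "b = a + T / real n" by (simp add: a_def b_def grid_Suc)
    have ab: "a \<le> b" using ba T by simp
    have "2 * T / d < real n" using n0 n by linarith
    then have "2 * (T / real n) < d" using d npos by (simp add: field_simps)
    then have small: "2 * (b - a) < d" using ba by simp
    have Xab: "continuous_on {a..b} X" using a b by (intro continuous_on_subset[OF cX]) auto
    have XT: "X integrable_on {0..b}" using a b
      by (intro integrable_continuous_interval continuous_on_subset[OF cX]) auto
    have int_split: "integral {0..b} X = integral {0..a} X + integral {a..b} X"
      using a ab by (intro Henstock_Kurzweil_Integration.integral_combine[symmetric] XT) auto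
    have m: "m b - m a = X b - X a - r * integral {a..b} X"
      using eq[OF a] eq[OF b] unfolding int_split by (simp add: algebra_simps)
    have "((\<lambda>s. r * exp (- r * s)) has_integral (- exp (- r * b) - (- exp (- r * a)))) {a..b}"
      using ab by (intro fundamental_theorem_of_calculus)
        (auto intro!: derivative_eq_intros simp flip: has_real_derivative_iff_has_vector_derivative)
    then have h1: "((\<lambda>s. r * exp (- r * s) * X b) has_integral (- exp (- r * b) - (- exp (- r * a))) * X b) {a..b}"
      by (rule has_integral_mult_left)
    have "(X has_integral integral {a..b} X) {a..b}"
      by (intro integrable_integral integrable_continuous_interval Xab)
    then have h2: "((\<lambda>s. r * exp (- r * a) * X s) has_integral r * exp (- r * a) * integral {a..b} X) {a..b}"
      by (rule has_integral_mult_right)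
    \<comment> \<open>Exactly the amount by which the discrepancy between the discounted sum and the
      discounted path changes over the step from \<open>a\<close> to \<open>b\<close>.\<close>
    define E where "E = (exp (- r * a) - exp (- r * b)) * X b - r * exp (- r * a) * integral {a..b} X"
    have hE: "((\<lambda>s. r * exp (- r * s) * X b - r * exp (- r * a) * X s) has_integral E) {a..b}"
      using has_integral_diff[OF h1 h2] by (simp add: E_def)
    have "norm E \<le> \<bar>r\<bar> * e' * measure lborel {a..b}"
    proof (rule has_integral_bound_real[OF _ _ hE, where S = "{}"])
      show "0 \<le> \<bar>r\<bar> * e'" using e' by simp
      fix s assume "s \<in> {a..b} - {}"
      then have s: "s \<in> {0..T}" "\<bar>s - a\<bar> \<le> b - a" "\<bar>b - s\<bar> \<le> b - a" using a b by auto
      have "dist (s, b) (a, s) \<le> \<bar>s - a\<bar> + \<bar>b - s\<bar>"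
        unfolding dist_Pair_Pair dist_real_def by (rule order_trans[OF sqrt_sum_squares_le_sum_abs]) simp
      also have "\<dots> \<le> (b - a) + (b - a)" by (intro add_mono s)
      also have "\<dots> < d" using small by simp
      finally have "dist (s, b) (a, s) < d" .
      then have "dist (G (s, b)) (G (a, s)) < e'" using a b s by (intro dG) auto
      then have "\<bar>r\<bar> * \<bar>exp (- r * s) * X b - exp (- r * a) * X s\<bar> \<le> \<bar>r\<bar> * e'"
        by (intro mult_left_mono) (auto simp: G_def dist_real_def)
      then show "norm (r * exp (- r * s) * X b - r * exp (- r * a) * X s) \<le> \<bar>r\<bar> * e'"
        by (simp add: abs_mult[symmetric] right_diff_distrib mult.assoc)
    qed simp
    then have E: "\<bar>E\<bar> \<le> T / real n * (\<bar>r\<bar> * e')" using ab ba by (simp add: mult_ac)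
    have "x + discounted_sum r T n m (Suc j) - exp (- r * b) * X b
       = (x + discounted_sum r T n m j - exp (- r * a) * X a) + E"
      unfolding discounted_sum_def sum.lessThan_Suc a_def[symmetric] b_def[symmetric] m E_def
      by (simp add: algebra_simps)
    moreover have "\<bar>x + discounted_sum r T n m j - exp (- r * a) * X a\<bar> \<le> real j * (T / real n * (\<bar>r\<bar> * e'))"
      using Suc unfolding a_def by simp
    moreover have "real (Suc j) * c = real j * c + c" for c :: real
      by (simp add: distrib_right)
    note this[of "T / real n * (\<bar>r\<bar> * e')"]
    ultimately show ?case using E unfolding b_def[symmetric] by linarith
  qed
  moreover have "real j * (T / real n * (\<bar>r\<bar> * e')) \<le> e" if "n0 \<le> n" "j \<le> n" for n j
  proof -
    have npos: "0 < n" using that n0pos by simp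
    have "real j * (T / real n * (\<bar>r\<bar> * e')) \<le> real n * (T / real n * (\<bar>r\<bar> * e'))"
      using that T e' by (intro mult_right_mono) auto
    also have "\<dots> = \<bar>r\<bar> * T * e'" using npos by simp
    also have "\<dots> \<le> (\<bar>r\<bar> * T + 1) * e'" using e' by (intro mult_right_mono) auto
    also have "\<dots> = e" using den by (simp add: e'_def)
    finally show ?thesis .
  qed
  ultimately show ?thesis using n0pos by (meson order_trans)
qed

section \<open>From convergence in probability to almost sure convergence\<close>

text \<open>Borel-Cantelli, applied to measurable covers because \<open>D\<close> and
  \<open>D'\<close> need not be measurable. One index sequence serves both: the union of two covers
  of measure below \<open>(1/2) ^ m\<close> gives the factor 2.\<close>

lemma vanish_in_prob_subsequence:
  assumes "prob_space M" and D: "vanish_in_prob M D" and D': "vanish_in_prob M D'"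
  shows "\<exists>f. AE \<omega> in M. \<forall>\<^sub>F m in sequentially. D (f m) \<omega> \<le> ennreal ((1/2) ^ m) \<and> D' (f m) \<omega> \<le> ennreal ((1/2) ^ m)"
proof -
  interpret prob_space M by fact
  define P where "P m k B \<longleftrightarrow> B \<in> sets M \<and> measure M B \<le> 2 * (1/2) ^ m \<and>
      {\<omega> \<in> space M. ennreal ((1/2) ^ m) < D k \<omega> \<or> ennreal ((1/2) ^ m) < D' k \<omega>} \<subseteq> B"
    for m k B
  have "\<exists>k B. P m k B" for m
  proof -
    have pos: "0 < ennreal ((1/2) ^ m)" "0 < (1/2 :: real) ^ m" by auto
    obtain E where E: "\<And>k. E k \<in> sets M" "\<And>k. {\<omega> \<in> space M. ennreal ((1/2) ^ m) < D k \<omega>} \<subseteq> E k"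
      and El: "(\<lambda>k. measure M (E k)) \<longlonglongrightarrow> 0"
      using D pos unfolding vanish_in_prob_def by meson
    obtain E' where E': "\<And>k. E' k \<in> sets M" "\<And>k. {\<omega> \<in> space M. ennreal ((1/2) ^ m) < D' k \<omega>} \<subseteq> E' k"
      and El': "(\<lambda>k. measure M (E' k)) \<longlonglongrightarrow> 0"
      using D' pos unfolding vanish_in_prob_def by meson
    have "\<forall>\<^sub>F k in sequentially. measure M (E k) < (1/2) ^ m \<and> measure M (E' k) < (1/2) ^ m"
      using order_tendstoD(2)[OF El pos(2)] order_tendstoD(2)[OF El' pos(2)] by (rule eventually_conj)
    then obtain k where k: "measure M (E k) < (1/2) ^ m" "measure M (E' k) < (1/2) ^ m"
      by (metis (mono_tags, lifting) eventually_sequentially order_refl)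
    have "measure M (E k \<union> E' k) \<le> measure M (E k) + measure M (E' k)"
      by (intro measure_Un_le E E')
    then have "measure M (E k \<union> E' k) \<le> 2 * (1/2) ^ m" using k by linarith
    then have "P m k (E k \<union> E' k)" using E[of k] E'[of k] unfolding P_def by auto
    then show ?thesis by blast
  qed
  then obtain f B where "\<And>m. P m (f m) (B m)" by metis
  then have B: "\<And>m. B m \<in> sets M" "\<And>m. measure M (B m) \<le> 2 * (1/2) ^ m"
    and sub: "\<And>m. {\<omega> \<in> space M. ennreal ((1/2) ^ m) < D (f m) \<omega> \<or> ennreal ((1/2) ^ m) < D' (f m) \<omega>} \<subseteq> B m"
    by (auto simp: P_def)
  have "summable (\<lambda>m. measure M (B m))"
    by (rule summable_comparison_test'[where g = "\<lambda>m. 2 * (1/2) ^ m" and N = 0])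
      (auto intro: summable_mult summable_geometric B)
  then have "AE \<omega> in M. eventually (\<lambda>m. \<omega> \<in> space M - B m) sequentially"
    by (intro borel_cantelli_AE1 B) (auto simp: less_top[symmetric])
  then have "AE \<omega> in M. \<forall>\<^sub>F m in sequentially. D (f m) \<omega> \<le> ennreal ((1/2) ^ m) \<and> D' (f m) \<omega> \<le> ennreal ((1/2) ^ m)"
  proof (rule AE_mp, intro AE_I2 impI)
    fix \<omega> assume \<omega>: "\<omega> \<in> space M" "\<forall>\<^sub>F m in sequentially. \<omega> \<in> space M - B m"
    from \<omega>(2) show "\<forall>\<^sub>F m in sequentially. D (f m) \<omega> \<le> ennreal ((1/2) ^ m) \<and> D' (f m) \<omega> \<le> ennreal ((1/2) ^ m)"
    proof (rule eventually_mono)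
      fix m assume "\<omega> \<in> space M - B m"
      then have "\<not> (ennreal ((1/2) ^ m) < D (f m) \<omega> \<or> ennreal ((1/2) ^ m) < D' (f m) \<omega>)" using sub[of m] by blast
      then show "D (f m) \<omega> \<le> ennreal ((1/2) ^ m) \<and> D' (f m) \<omega> \<le> ennreal ((1/2) ^ m)"
        by (simp add: not_less)
    qed
  qed
  then show ?thesis by blast
qed

section \<open>Gains of simple strategies under the martingale measure\<close>

text \<open>Clamping the nodes to the interval from \<open>t\<close> to \<open>t'\<close> makes the
  pieces outside it contribute zero.\<close>

lemma simple_integral_increment:
  assumes "t \<le> t'"
  shows "simple_integral (n, \<tau>, \<xi>) U t' \<omega> - simple_integral (n, \<tau>, \<xi>) U t \<omega>
    = (\<Sum>k<n. \<xi> k \<omega> * (U (max t (min t' (\<tau> (Suc k)))) \<omega> - U (max t (min t' (\<tau> k))) \<omega>))"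
proof -
  have eq: "U (min t' y) \<omega> - U (min t y) \<omega> = U (max t (min t' y)) \<omega> - U t \<omega>" for y
    using assms by (auto simp: max_def min_def)
  have "\<xi> k \<omega> * (U (min t' (\<tau> (Suc k))) \<omega> - U (min t' (\<tau> k)) \<omega>)
      - \<xi> k \<omega> * (U (min t (\<tau> (Suc k))) \<omega> - U (min t (\<tau> k)) \<omega>)
      = \<xi> k \<omega> * (U (max t (min t' (\<tau> (Suc k)))) \<omega> - U (max t (min t' (\<tau> k))) \<omega>)" for k
    using eq[of "\<tau> k"] eq[of "\<tau> (Suc k)"] by (simp add: right_diff_distrib[symmetric])
  then show ?thesis by (simp add: simple_integral_def sum_subtractf[symmetric])
qed

context black_scholes
begin

text \<open>The integrator is \<open>V\<close>, not \<open>W\<close>, since it is \<open>V\<close>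
  whose increments are centred under \<open>N\<close>.\<close>

definition gain1 :: "'a simple_proc \<Rightarrow> 'n \<Rightarrow> real \<Rightarrow> 'a \<Rightarrow> real" where
  "gain1 p i t \<omega> = simple_integral p (\<lambda>t \<omega>. V t \<omega> $ i) t \<omega>"

definition gain :: "('n \<Rightarrow> 'a simple_proc) \<Rightarrow> real \<Rightarrow> 'a \<Rightarrow> real" where
  "gain p t \<omega> = (\<Sum>i\<in>UNIV. gain1 (p i) i t \<omega>)"

text \<open>The number of pieces and the bound \<open>C\<close> are fixed before the interval, so
  moment estimates are uniform in \<open>t\<close> and \<open>t'\<close>. Each weight is known at
  the start of its piece, which lies after \<open>t\<close>; a further factor known at
  \<open>t\<close> can thus be absorbed into it.\<close>

lemma gain1_increment:
  assumes p: "simple_process mk p"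
  shows "\<exists>n C. 0 \<le> C \<and> (\<forall>t t'. 0 \<le> t \<and> t \<le> t' \<and> t' \<le> T \<longrightarrow> (\<exists>a b \<zeta>.
    (\<forall>k<n. t \<le> a k \<and> a k \<le> b k \<and> b k \<le> t' \<and> \<zeta> k \<in> borel_measurable (F (a k)) \<and>
      (\<forall>\<omega>\<in>space M. \<bar>\<zeta> k \<omega>\<bar> \<le> C)) \<and>
    (\<forall>\<omega>. gain1 p i t' \<omega> - gain1 p i t \<omega> = (\<Sum>k<n::nat. \<zeta> k \<omega> * dV (a k) (b k) i \<omega>))))"
proof -
  obtain n \<tau> \<xi> where peq: "p = (n, \<tau>, \<xi>)" by (metis prod_cases3)
  have \<tau>: "\<And>k. k \<le> n \<Longrightarrow> \<tau> k \<in> {0..T}" "\<And>k. k < n \<Longrightarrow> \<tau> k \<le> \<tau> (Suc k)"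
    and \<xi>: "\<And>k. k < n \<Longrightarrow> \<xi> k \<in> borel_measurable (F (\<tau> k))"
    and bd: "\<And>k. k < n \<Longrightarrow> \<exists>C. \<forall>\<omega>\<in>space M. \<bar>\<xi> k \<omega>\<bar> \<le> C"
    using p by (auto simp: simple_process_def peq)
  obtain c where c: "\<And>k \<omega>. k < n \<Longrightarrow> \<omega> \<in> space M \<Longrightarrow> \<bar>\<xi> k \<omega>\<bar> \<le> c k"
    using bd by metis
  define C where "C = (\<Sum>k<n. \<bar>c k\<bar>)"
  have C: "\<bar>c k\<bar> \<le> C" if "k < n" for k
    unfolding C_def using that by (intro member_le_sum) auto
  show ?thesis
  proof (intro exI[of _ n] exI[of _ C] conjI allI impI)
    show "0 \<le> C" by (simp add: C_def sum_nonneg)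
    fix t t' assume t: "0 \<le> t \<and> t \<le> t' \<and> t' \<le> T"
    define a where "a k = max t (min t' (\<tau> k))" for k
    \<comment> \<open>A coefficient attached to a node at or after \<open>t'\<close> need not be
      known at the clamped node, but its clamped increment is zero, so it may be replaced by
      zero.\<close>
    define \<zeta> where "\<zeta> k = (if \<tau> k < t' then \<xi> k else (\<lambda>_. 0))" for k
    show "\<exists>a b \<zeta>. (\<forall>k<n. t \<le> a k \<and> a k \<le> b k \<and> b k \<le> t' \<and> \<zeta> k \<in> borel_measurable (F (a k)) \<and>
      (\<forall>\<omega>\<in>space M. \<bar>\<zeta> k \<omega>\<bar> \<le> C)) \<and>
      (\<forall>\<omega>. gain1 p i t' \<omega> - gain1 p i t \<omega> = (\<Sum>k<n::nat. \<zeta> k \<omega> * dV (a k) (b k) i \<omega>))"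
    proof (rule exI[of _ a], rule exI[of _ "\<lambda>k. a (Suc k)"], rule exI[of _ \<zeta>], intro conjI allI impI ballI)
      fix k assume k: "k < n"
      show "t \<le> a k" "a (Suc k) \<le> t'" using t by (auto simp: a_def)
      show "a k \<le> a (Suc k)" using \<tau>(2)[OF k] by (auto simp: a_def max_def min_def)
      show "\<zeta> k \<in> borel_measurable (F (a k))"
      proof (cases "\<tau> k < t'")
        case True
        have "\<xi> k \<in> borel_measurable (F (a k))"
          by (rule measurable_F_mono[OF _ _ _ \<xi>[OF k]]) (use True \<tau>(1)[of k] k t in \<open>auto simp: a_def\<close>)
        then show ?thesis using True by (simp add: \<zeta>_def)
      qed (simp add: \<zeta>_def)
      fix \<omega> assume "\<omega> \<in> space M"
      then show "\<bar>\<zeta> k \<omega>\<bar> \<le> C" using c[OF k, of \<omega>] C[OF k] by (auto simp: \<zeta>_def)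
    next
      fix \<omega>
      have "\<xi> k \<omega> * (V (a (Suc k)) \<omega> $ i - V (a k) \<omega> $ i) = \<zeta> k \<omega> * dV (a k) (a (Suc k)) i \<omega>" if k: "k < n" for k
      proof (cases "\<tau> k < t'")
        case False
        then have "a k = t'" "a (Suc k) = t'" using t \<tau>(2)[OF k] by (auto simp: a_def)
        then show ?thesis using False t by (simp add: \<zeta>_def)
      next
        case True
        have "0 \<le> a k" "a k \<le> a (Suc k)" "a (Suc k) \<le> T"
          using t \<tau>(2)[OF k] by (auto simp: a_def max_def min_def)
        then show ?thesis using True by (simp add: \<zeta>_def dV_def)
      qed
      then show "gain1 p i t' \<omega> - gain1 p i t \<omega> = (\<Sum>k<n. \<zeta> k \<omega> * dV (a k) (a (Suc k)) i \<omega>)"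
        using t by (simp add: gain1_def peq simple_integral_increment a_def)
    qed
  qed
qed

text \<open>Conditional mean zero, expressed by bounded test variables: the product of \<eta> with
  each weight is bounded and known at the start of its piece, so every term has mean zero.\<close>

lemma gain1_martingale_increment:
  fixes i :: 'n
  assumes p: "simple_process mk p" and t: "0 \<le> t" "t \<le> t'" "t' \<le> T"
  defines "\<Delta> \<equiv> \<lambda>\<omega>. gain1 p i t' \<omega> - gain1 p i t \<omega>"
  shows "\<Delta> \<in> borel_measurable (F t')"
    and "\<And>\<eta> B. \<eta> \<in> borel_measurable (F t) \<Longrightarrow> (\<And>\<omega>. \<omega> \<in> space M \<Longrightarrow> \<bar>\<eta> \<omega>\<bar> \<le> B) \<Longrightarrow>
      integrable N (\<lambda>\<omega>. \<eta> \<omega> * \<Delta> \<omega>) \<and> (\<integral>\<omega>. \<eta> \<omega> * \<Delta> \<omega> \<partial>N) = 0"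
proof -
  obtain n C where C: "0 \<le> C" and rep: "\<And>t t'. 0 \<le> t \<and> t \<le> t' \<and> t' \<le> T \<Longrightarrow> (\<exists>a b \<zeta>.
    (\<forall>k<n. t \<le> a k \<and> a k \<le> b k \<and> b k \<le> t' \<and> \<zeta> k \<in> borel_measurable (F (a k)) \<and>
      (\<forall>\<omega>\<in>space M. \<bar>\<zeta> k \<omega>\<bar> \<le> C)) \<and>
    (\<forall>\<omega>. gain1 p i t' \<omega> - gain1 p i t \<omega> = (\<Sum>k<n::nat. \<zeta> k \<omega> * dV (a k) (b k) i \<omega>)))"
    using gain1_increment[OF p, of i] by blast
  from rep[of t t'] t obtain a b \<zeta> where
    ab: "\<And>k. k < n \<Longrightarrow> t \<le> a k \<and> a k \<le> b k \<and> b k \<le> t'"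
    and \<zeta>: "\<And>k. k < n \<Longrightarrow> \<zeta> k \<in> borel_measurable (F (a k))"
    and \<zeta>C: "\<And>k \<omega>. k < n \<Longrightarrow> \<omega> \<in> space M \<Longrightarrow> \<bar>\<zeta> k \<omega>\<bar> \<le> C"
    and eq: "\<And>\<omega>. \<Delta> \<omega> = (\<Sum>k<n::nat. \<zeta> k \<omega> * dV (a k) (b k) i \<omega>)"
    unfolding \<Delta>_def by blast
  have abT: "0 \<le> a k" "a k \<le> b k" "b k \<le> T" if "k < n" for k using ab[OF that] t by auto
  have "(\<lambda>\<omega>. \<Sum>k<n. \<zeta> k \<omega> * dV (a k) (b k) i \<omega>) \<in> borel_measurable (F t')"
  proof (intro borel_measurable_sum borel_measurable_times)
    fix k assume "k \<in> {..<n}"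
    then have k: "k < n" by simp
    show "\<zeta> k \<in> borel_measurable (F t')"
      by (rule measurable_F_mono[OF _ _ _ \<zeta>[OF k]]) (use ab[OF k] t in auto)
    show "dV (a k) (b k) i \<in> borel_measurable (F t')"
      by (rule measurable_F_mono[OF _ _ _ dV_measurable_F[OF abT[OF k]]]) (use ab[OF k] t in auto)
  qed
  then show "\<Delta> \<in> borel_measurable (F t')" by (simp add: eq[abs_def])
  fix \<eta> :: "'a \<Rightarrow> real" and B :: real
  assume \<eta>: "\<eta> \<in> borel_measurable (F t)" and B: "\<And>\<omega>. \<omega> \<in> space M \<Longrightarrow> \<bar>\<eta> \<omega>\<bar> \<le> B"
  have eq': "\<eta> \<omega> * \<Delta> \<omega> = (\<Sum>k<n. (\<eta> \<omega> * \<zeta> k \<omega>) * dV (a k) (b k) i \<omega>)" for \<omega>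
    by (simp add: eq sum_distrib_left mult.assoc)
  have m: "(\<lambda>\<omega>. \<eta> \<omega> * \<zeta> k \<omega>) \<in> borel_measurable (F (a k))" if k: "k < n" for k
    by (intro borel_measurable_times \<zeta> k measurable_F_mono[OF _ _ _ \<eta>]) (use ab[OF k] t in auto)
  have bd: "\<bar>\<eta> \<omega> * \<zeta> k \<omega>\<bar> \<le> \<bar>B\<bar> * C" if k: "k < n" and "\<omega> \<in> space M" for k \<omega>
    unfolding abs_mult using \<zeta>C[OF that] B[OF that(2)] by (intro mult_mono) auto
  have int: "integrable N (\<lambda>\<omega>. (\<eta> \<omega> * \<zeta> k \<omega>) * dV (a k) (b k) i \<omega>)" if k: "k < n" for k
    by (rule integrable_mult_dV[OF abT[OF k] m[OF k] bd[OF k]])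
  show "integrable N (\<lambda>\<omega>. \<eta> \<omega> * \<Delta> \<omega>) \<and> (\<integral>\<omega>. \<eta> \<omega> * \<Delta> \<omega> \<partial>N) = 0"
  proof
    show "integrable N (\<lambda>\<omega>. \<eta> \<omega> * \<Delta> \<omega>)" unfolding eq' using int by (intro Bochner_Integration.integrable_sum) auto
    have "(\<integral>\<omega>. \<eta> \<omega> * \<Delta> \<omega> \<partial>N) = (\<Sum>k<n. \<integral>\<omega>. (\<eta> \<omega> * \<zeta> k \<omega>) * dV (a k) (b k) i \<omega> \<partial>N)"
      unfolding eq' using int by (intro Bochner_Integration.integral_sum) auto
    also have "\<dots> = (\<Sum>k<n. 0)"
    proof (intro sum.cong refl)
      fix k assume "k \<in> {..<n}"
      then have k: "k < n" by simp
      show "(\<integral>\<omega>. (\<eta> \<omega> * \<zeta> k \<omega>) * dV (a k) (b k) i \<omega> \<partial>N) = 0"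
        by (rule integral_mult_dV[OF abT[OF k] m[OF k] bd[OF k]])
    qed
    finally show "(\<integral>\<omega>. \<eta> \<omega> * \<Delta> \<omega> \<partial>N) = 0" by simp
  qed
qed

text \<open>The power mean inequality over the pieces suffices. The constant grows with the number
  of pieces and the bound on the coefficients, but not with the interval.\<close>

lemma gain1_power4:
  assumes p: "simple_process mk p"
  shows "\<exists>C\<ge>0. \<forall>t t'. 0 \<le> t \<and> t \<le> t' \<and> t' \<le> T \<longrightarrow>
    (\<integral>\<^sup>+\<omega>. ennreal ((gain1 p i t' \<omega> - gain1 p i t \<omega>) ^ 4) \<partial>N) \<le> ennreal (C * (t' - t)\<^sup>2)"
proof -
  obtain n C where C: "0 \<le> C" and rep: "\<And>t t'. 0 \<le> t \<and> t \<le> t' \<and> t' \<le> T \<Longrightarrow> (\<exists>a b \<zeta>.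
    (\<forall>k<n. t \<le> a k \<and> a k \<le> b k \<and> b k \<le> t' \<and> \<zeta> k \<in> borel_measurable (F (a k)) \<and>
      (\<forall>\<omega>\<in>space M. \<bar>\<zeta> k \<omega>\<bar> \<le> C)) \<and>
    (\<forall>\<omega>. gain1 p i t' \<omega> - gain1 p i t \<omega> = (\<Sum>k<n::nat. \<zeta> k \<omega> * dV (a k) (b k) i \<omega>)))"
    using gain1_increment[OF p, of i] by blast
  define K where "K = real n ^ 3 * (real n * (C ^ 4 * 1024))"
  show ?thesis
  proof (intro exI[of _ K] conjI allI impI)
    show "0 \<le> K" using C by (simp add: K_def)
    fix t t' assume t: "0 \<le> t \<and> t \<le> t' \<and> t' \<le> T"
    from rep[OF t] obtain a b \<zeta> where
      ab: "\<And>k. k < n \<Longrightarrow> t \<le> a k \<and> a k \<le> b k \<and> b k \<le> t'"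
      and \<zeta>: "\<And>k. k < n \<Longrightarrow> \<zeta> k \<in> borel_measurable (F (a k))"
      and \<zeta>C: "\<And>k \<omega>. k < n \<Longrightarrow> \<omega> \<in> space M \<Longrightarrow> \<bar>\<zeta> k \<omega>\<bar> \<le> C"
      and eq: "\<And>\<omega>. gain1 p i t' \<omega> - gain1 p i t \<omega> = (\<Sum>k<n::nat. \<zeta> k \<omega> * dV (a k) (b k) i \<omega>)"
      by blast
    have abT: "0 \<le> a k" "a k \<le> b k" "b k \<le> T" if "k < n" for k using ab[OF that] t by auto
    define f where "f k \<omega> = ennreal (real n ^ 3 * C ^ 4) * ennreal ((dV (a k) (b k) i \<omega>) ^ 4)" for k \<omega>
    have f[measurable]: "f k \<in> borel_measurable N" if "k < n" for k
      using dV_measurable[OF abT[OF that]] unfolding f_def by measurable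
    have "(\<integral>\<^sup>+\<omega>. ennreal ((gain1 p i t' \<omega> - gain1 p i t \<omega>) ^ 4) \<partial>N) \<le> (\<integral>\<^sup>+\<omega>. (\<Sum>k<n. f k \<omega>) \<partial>N)"
    proof (intro nn_integral_mono)
      fix \<omega> assume \<omega>: "\<omega> \<in> space N"
      have "(gain1 p i t' \<omega> - gain1 p i t \<omega>) ^ 4 \<le> real n ^ 3 * (\<Sum>k<n. (\<zeta> k \<omega> * dV (a k) (b k) i \<omega>) ^ 4)"
        unfolding eq using sum_power4_le[of "\<lambda>k. \<zeta> k \<omega> * dV (a k) (b k) i \<omega>" "{..<n}"] by simp
      also have "\<dots> \<le> real n ^ 3 * (\<Sum>k<n. C ^ 4 * (dV (a k) (b k) i \<omega>) ^ 4)"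
      proof (intro mult_left_mono sum_mono)
        fix k assume "k \<in> {..<n}"
        then have "\<bar>\<zeta> k \<omega>\<bar> ^ 4 \<le> C ^ 4" using \<zeta>C[of k \<omega>] \<omega> by (intro power_mono) auto
        then have "\<zeta> k \<omega> ^ 4 \<le> C ^ 4" by simp
        then show "(\<zeta> k \<omega> * dV (a k) (b k) i \<omega>) ^ 4 \<le> C ^ 4 * (dV (a k) (b k) i \<omega>) ^ 4"
          unfolding power_mult_distrib by (intro mult_right_mono) auto
      qed simp
      finally have "(gain1 p i t' \<omega> - gain1 p i t \<omega>) ^ 4 \<le> (\<Sum>k<n. real n ^ 3 * C ^ 4 * (dV (a k) (b k) i \<omega>) ^ 4)"
        by (simp add: sum_distrib_left mult.assoc)
      then have "ennreal ((gain1 p i t' \<omega> - gain1 p i t \<omega>) ^ 4) \<le> ennreal (\<Sum>k<n. real n ^ 3 * C ^ 4 * (dV (a k) (b k) i \<omega>) ^ 4)"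
        by (rule ennreal_leI)
      also have "\<dots> = (\<Sum>k<n. ennreal (real n ^ 3 * C ^ 4 * (dV (a k) (b k) i \<omega>) ^ 4))"
        using C by (subst sum_ennreal) auto
      also have "\<dots> = (\<Sum>k<n. f k \<omega>)"
        unfolding f_def using C by (intro sum.cong refl ennreal_mult) auto
      finally show "ennreal ((gain1 p i t' \<omega> - gain1 p i t \<omega>) ^ 4) \<le> (\<Sum>k<n. f k \<omega>)" .
    qed
    also have "\<dots> = (\<Sum>k<n. \<integral>\<^sup>+\<omega>. f k \<omega> \<partial>N)"
      by (intro nn_integral_sum) auto
    also have "\<dots> \<le> (\<Sum>k<n. ennreal (real n ^ 3 * C ^ 4 * (1024 * (t' - t)\<^sup>2)))"
    proof (intro sum_mono)
      fix k assume "k \<in> {..<n}"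
      then have k: "k < n" by simp
      have "(\<integral>\<^sup>+\<omega>. f k \<omega> \<partial>N) = ennreal (real n ^ 3 * C ^ 4) * (\<integral>\<^sup>+\<omega>. ennreal ((dV (a k) (b k) i \<omega>) ^ 4) \<partial>N)"
        unfolding f_def by (intro nn_integral_cmult) (use dV_measurable[OF abT[OF k]] in measurable)
      also have "\<dots> \<le> ennreal (real n ^ 3 * C ^ 4) * ennreal (1024 * (b k - a k)\<^sup>2)"
        by (intro mult_left_mono nn_integral_dV_power4 abT k) auto
      also have "\<dots> = ennreal (real n ^ 3 * C ^ 4 * (1024 * (b k - a k)\<^sup>2))"
        using C by (subst ennreal_mult) auto
      also have "\<dots> \<le> ennreal (real n ^ 3 * C ^ 4 * (1024 * (t' - t)\<^sup>2))"
        using C ab[OF k] by (intro ennreal_leI mult_left_mono power_mono) auto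
      finally show "(\<integral>\<^sup>+\<omega>. f k \<omega> \<partial>N) \<le> ennreal (real n ^ 3 * C ^ 4 * (1024 * (t' - t)\<^sup>2))" .
    qed
    also have "\<dots> = ennreal (\<Sum>k<n. real n ^ 3 * C ^ 4 * (1024 * (t' - t)\<^sup>2))"
      using C by (intro sum_ennreal) auto
    also have "(\<Sum>k<n. real n ^ 3 * C ^ 4 * (1024 * (t' - t)\<^sup>2)) = K * (t' - t)\<^sup>2"
      by (simp add: K_def mult_ac)
    finally show "(\<integral>\<^sup>+\<omega>. ennreal ((gain1 p i t' \<omega> - gain1 p i t \<omega>) ^ 4) \<partial>N) \<le> ennreal (K * (t' - t)\<^sup>2)" .
  qed
qed

lemma gain_diff: "gain p t' \<omega> - gain p t \<omega> = (\<Sum>i\<in>UNIV. gain1 (p i) i t' \<omega> - gain1 (p i) i t \<omega>)"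
  by (simp add: gain_def sum_subtractf)

lemma gain_martingale_increment:
  assumes p: "\<And>i. simple_process mk (p i)" and t: "0 \<le> t" "t \<le> t'" "t' \<le> T"
  shows "(\<lambda>\<omega>. gain p t' \<omega> - gain p t \<omega>) \<in> borel_measurable (F t')"
    and "\<eta> \<in> borel_measurable (F t) \<Longrightarrow> (\<And>\<omega>. \<omega> \<in> space M \<Longrightarrow> \<bar>\<eta> \<omega>\<bar> \<le> B) \<Longrightarrow>
      integrable N (\<lambda>\<omega>. \<eta> \<omega> * (gain p t' \<omega> - gain p t \<omega>))"
    and "\<eta> \<in> borel_measurable (F t) \<Longrightarrow> (\<And>\<omega>. \<omega> \<in> space M \<Longrightarrow> \<bar>\<eta> \<omega>\<bar> \<le> B) \<Longrightarrow>
      (\<integral>\<omega>. \<eta> \<omega> * (gain p t' \<omega> - gain p t \<omega>) \<partial>N) = 0"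
proof -
  show "(\<lambda>\<omega>. gain p t' \<omega> - gain p t \<omega>) \<in> borel_measurable (F t')"
    unfolding gain_diff by (intro borel_measurable_sum gain1_martingale_increment(1) p t)
  assume "\<eta> \<in> borel_measurable (F t)" "\<And>\<omega>. \<omega> \<in> space M \<Longrightarrow> \<bar>\<eta> \<omega>\<bar> \<le> B"
  note * = gain1_martingale_increment(2)[OF p t this]
  show "integrable N (\<lambda>\<omega>. \<eta> \<omega> * (gain p t' \<omega> - gain p t \<omega>))"
    unfolding gain_diff sum_distrib_left using * by (intro Bochner_Integration.integrable_sum) auto
  have "(\<integral>\<omega>. \<eta> \<omega> * (gain p t' \<omega> - gain p t \<omega>) \<partial>N)
      = (\<Sum>i\<in>UNIV. \<integral>\<omega>. \<eta> \<omega> * (gain1 (p i) i t' \<omega> - gain1 (p i) i t \<omega>) \<partial>N)"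
    unfolding gain_diff sum_distrib_left using * by (intro Bochner_Integration.integral_sum) auto
  then show "(\<integral>\<omega>. \<eta> \<omega> * (gain p t' \<omega> - gain p t \<omega>) \<partial>N) = 0" using * by simp
qed

lemma gain_power4:
  assumes p: "\<And>i. simple_process mk (p i)"
  shows "\<exists>C\<ge>0. \<forall>t t'. 0 \<le> t \<and> t \<le> t' \<and> t' \<le> T \<longrightarrow>
    (\<integral>\<^sup>+\<omega>. ennreal ((gain p t' \<omega> - gain p t \<omega>) ^ 4) \<partial>N) \<le> ennreal (C * (t' - t)\<^sup>2)"
proof -
  from gain1_power4[OF p] have "\<forall>i. \<exists>C\<ge>0. \<forall>t t'. 0 \<le> t \<and> t \<le> t' \<and> t' \<le> T \<longrightarrow>
    (\<integral>\<^sup>+\<omega>. ennreal ((gain1 (p i) i t' \<omega> - gain1 (p i) i t \<omega>) ^ 4) \<partial>N) \<le> ennreal (C * (t' - t)\<^sup>2)"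
    by blast
  from choice[OF this] obtain C where C: "\<And>i. 0 \<le> C i" and Cb: "\<And>i t t'. 0 \<le> t \<Longrightarrow> t \<le> t' \<Longrightarrow> t' \<le> T \<Longrightarrow>
    (\<integral>\<^sup>+\<omega>. ennreal ((gain1 (p i) i t' \<omega> - gain1 (p i) i t \<omega>) ^ 4) \<partial>N) \<le> ennreal (C i * (t' - t)\<^sup>2)"
    by blast
  define d where "d = real CARD('n) ^ 3"
  have d: "0 \<le> d" by (simp add: d_def)
  show ?thesis
  proof (intro exI[of _ "d * (\<Sum>i\<in>UNIV. C i)"] conjI allI impI)
    show "0 \<le> d * (\<Sum>i\<in>UNIV. C i)" using C d by (intro mult_nonneg_nonneg sum_nonneg) auto
    fix t t' assume t: "0 \<le> t \<and> t \<le> t' \<and> t' \<le> T"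
    define g where "g i \<omega> = (gain1 (p i) i t' \<omega> - gain1 (p i) i t \<omega>) ^ 4" for i \<omega>
    have g[measurable]: "g i \<in> borel_measurable M" for i
      unfolding g_def
      by (intro borel_measurable_power measurable_F_M[OF _ gain1_martingale_increment(1)[OF p]]) (use t in auto)
    have g0: "0 \<le> g i \<omega>" for i \<omega> by (simp add: g_def)
    have "(\<integral>\<^sup>+\<omega>. ennreal ((gain p t' \<omega> - gain p t \<omega>) ^ 4) \<partial>N) \<le> (\<integral>\<^sup>+\<omega>. ennreal d * (\<Sum>i\<in>UNIV. ennreal (g i \<omega>)) \<partial>N)"
    proof (intro nn_integral_mono)
      fix \<omega>
      have "(gain p t' \<omega> - gain p t \<omega>) ^ 4 \<le> d * (\<Sum>i\<in>UNIV. g i \<omega>)"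
        unfolding gain_diff g_def d_def by (rule sum_power4_le)
      then have "ennreal ((gain p t' \<omega> - gain p t \<omega>) ^ 4) \<le> ennreal (d * (\<Sum>i\<in>UNIV. g i \<omega>))"
        by (rule ennreal_leI)
      then show "ennreal ((gain p t' \<omega> - gain p t \<omega>) ^ 4) \<le> ennreal d * (\<Sum>i\<in>UNIV. ennreal (g i \<omega>))"
        using d g0 by (simp add: ennreal_mult sum_nonneg sum_ennreal)
    qed
    also have "\<dots> = ennreal d * (\<Sum>i\<in>UNIV. \<integral>\<^sup>+\<omega>. ennreal (g i \<omega>) \<partial>N)"
      by (subst nn_integral_cmult, measurable, subst nn_integral_sum) auto
    also have "\<dots> \<le> ennreal d * (\<Sum>i\<in>UNIV. ennreal (C i * (t' - t)\<^sup>2))"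
      unfolding g_def using t by (intro mult_left_mono sum_mono Cb) auto
    also have "\<dots> = ennreal (d * (\<Sum>i\<in>UNIV. C i) * (t' - t)\<^sup>2)"
      using C d by (simp add: sum_ennreal ennreal_mult[symmetric] sum_nonneg sum_distrib_right mult.assoc)
    finally show "(\<integral>\<^sup>+\<omega>. ennreal ((gain p t' \<omega> - gain p t \<omega>) ^ 4) \<partial>N) \<le> ennreal (d * (\<Sum>i\<in>UNIV. C i) * (t' - t)\<^sup>2)" .
  qed
qed

definition discounted_gain :: "('n \<Rightarrow> 'a simple_proc) \<Rightarrow> real \<Rightarrow> nat \<Rightarrow> 'a \<Rightarrow> nat \<Rightarrow> real" where
  "discounted_gain p x n \<omega> j = x + discounted_sum (rate mk) T n (\<lambda>t. gain p t \<omega>) j"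

lemma discounted_gain_measurable:
  assumes p: "\<And>i. simple_process mk (p i)" and n: "0 < n" and j: "j \<le> k" "k \<le> n"
  shows "(\<lambda>\<omega>. discounted_gain p x n \<omega> j) \<in> borel_measurable (F (grid T n k))"
  unfolding discounted_gain_def discounted_sum_def
proof (intro borel_measurable_add borel_measurable_sum borel_measurable_times borel_measurable_const)
  fix l assume "l \<in> {..<j}"
  then have l: "Suc l \<le> k" "l \<le> n" "Suc l \<le> n" using j by auto
  have "grid T n (Suc l) \<le> grid T n k" using l(1) T_pos by (simp add: grid_def divide_right_mono mult_right_mono del: of_nat_Suc)
  then show "(\<lambda>\<omega>. gain p (grid T n (Suc l)) \<omega> - gain p (grid T n l) \<omega>) \<in> borel_measurable (F (grid T n k))"
    using grid_in[OF T_pos n l(2)] grid_in[OF T_pos n l(3)] grid_in[OF T_pos n j(2)] T_pos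
    by (intro measurable_F_mono[OF _ _ _ gain_martingale_increment(1)[OF p]]) (auto simp: grid_Suc)
qed

lemma stays_above_measurable:
  assumes "\<And>j. j \<le> n \<Longrightarrow> (\<lambda>\<omega>. D \<omega> j) \<in> borel_measurable R"
  shows "(\<lambda>\<omega>. stays_above a (D \<omega>) n) \<in> borel_measurable R"
proof -
  have [measurable]: "(\<lambda>\<omega>. D \<omega> j) \<in> borel_measurable R" if "j \<in> {..n}" for j using assms that by auto
  have "(\<lambda>\<omega>. stays_above a (D \<omega>) n) = (\<lambda>\<omega>. if \<forall>j\<in>{..n}. a \<le> D \<omega> j then 1 else 0)"
    by (auto simp: stays_above_def fun_eq_iff)
  also have "\<dots> \<in> borel_measurable R" by measurable
  finally show ?thesis .
qed

text \<open>The stopped sum has mean \<open>x\<close>, because its weights are known at the left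
  grid points, and the fourth powers of the increments add up to \<open>C / n\<close>. The shift by
  \<open>e\<close> makes the integrand nonnegative, so \<open>ennreal\<close> truncates
  nothing.\<close>

lemma nn_integral_stopped_gain_le:
  assumes p: "\<And>i. simple_process mk (p i)" and x: "0 \<le> x" and e: "0 < e"
  shows "\<exists>C\<ge>0. \<forall>n>0. (\<integral>\<^sup>+\<omega>. ennreal (stays_above (- e) (discounted_gain p x n \<omega>) n * (discounted_gain p x n \<omega> n + e)) \<partial>N)
    \<le> ennreal (x + 2 * e + C / real n)"
proof -
  obtain C where C: "0 \<le> C" and Cb: "\<And>t t'. 0 \<le> t \<Longrightarrow> t \<le> t' \<Longrightarrow> t' \<le> T \<Longrightarrow>
    (\<integral>\<^sup>+\<omega>. ennreal ((gain p t' \<omega> - gain p t \<omega>) ^ 4) \<partial>N) \<le> ennreal (C * (t' - t)\<^sup>2)"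
    using gain_power4[of p] p by metis
  define K where "K = exp (\<bar>rate mk\<bar> * T)"
  have K: "0 \<le> K" by (simp add: K_def)
  \<comment> \<open>Adding \<open>K ^ 4 / e ^ 3 * C * (T / n)\<^sup>2\<close> over \<open>n\<close>
    grid steps leaves \<open>C' / n\<close>; \<open>K\<close> bounds the discount factors.\<close>
  define C' where "C' = K ^ 4 * C * T\<^sup>2 / e ^ 3"
  show ?thesis
  proof (intro exI[of _ C'] conjI allI impI)
    show "0 \<le> C'" using C K e by (simp add: C'_def)
    fix n :: nat assume n: "0 < n"
    define D where "D = discounted_gain p x n"
    define c where "c l = exp (- rate mk * grid T n l)" for l
    define g where "g l \<omega> = gain p (grid T n (Suc l)) \<omega> - gain p (grid T n l) \<omega>" for l \<omega>
    define \<eta> where "\<eta> l \<omega> = stays_above (- e) (D \<omega>) l" for l \<omega>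
    have D0: "D \<omega> 0 = x" for \<omega> by (simp add: D_def discounted_gain_def discounted_sum_def)
    have Dd: "D \<omega> (Suc l) - D \<omega> l = c l * g l \<omega>" for l \<omega>
      by (simp add: D_def discounted_gain_def discounted_sum_def c_def g_def)
    have c: "0 \<le> c l" "c l \<le> K" if "l < n" for l
      using exp_grid_le[OF T_pos n, of l "rate mk"] that by (auto simp: c_def K_def)
    have gr: "0 \<le> grid T n l" "grid T n l \<le> grid T n (Suc l)" "grid T n (Suc l) \<le> T" if "l < n" for l
      using grid_in[OF T_pos n, of l] grid_in[OF T_pos n, of "Suc l"] that T_pos by (auto simp: grid_Suc)
    have gM[measurable]: "g l \<in> borel_measurable M" if "l < n" for l
      unfolding g_def
      by (rule measurable_F_M[OF _ gain_martingale_increment(1)[OF p gr[OF that]]]) (use gr[OF that] in auto)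
    have \<eta>: "(\<lambda>\<omega>. c l * \<eta> l \<omega>) \<in> borel_measurable (F (grid T n l))" if "l < n" for l
      unfolding \<eta>_def D_def using that
      by (intro borel_measurable_times borel_measurable_const stays_above_measurable discounted_gain_measurable p n) auto
    have \<eta>b: "\<bar>c l * \<eta> l \<omega>\<bar> \<le> K" if "l < n" for l \<omega>
      using c[OF that] K by (auto simp: \<eta>_def stays_above_def)
    have i1: "integrable N (\<lambda>\<omega>. c l * \<eta> l \<omega> * g l \<omega>)" and z1: "(\<integral>\<omega>. c l * \<eta> l \<omega> * g l \<omega> \<partial>N) = 0" if "l < n" for l
      unfolding g_def using gain_martingale_increment(2,3)[OF p gr[OF that] \<eta>[OF that] \<eta>b[OF that]] by auto
    have n4: "(\<integral>\<^sup>+\<omega>. ennreal (g l \<omega> ^ 4) \<partial>N) \<le> ennreal (C * (T / real n)\<^sup>2)" if "l < n" for l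
      unfolding g_def using Cb[OF gr[OF that]] by (simp add: grid_Suc)
    have i2: "integrable N (\<lambda>\<omega>. g l \<omega> ^ 4)" if "l < n" for l
      by (rule integrableI_nonneg) (use gM[OF that] n4[OF that] in \<open>auto intro: order_le_less_trans\<close>)
    have b2: "(\<integral>\<omega>. g l \<omega> ^ 4 \<partial>N) \<le> C * (T / real n)\<^sup>2" if "l < n" for l
    proof -
      have "ennreal (\<integral>\<omega>. g l \<omega> ^ 4 \<partial>N) \<le> ennreal (C * (T / real n)\<^sup>2)"
        using nn_integral_eq_integral[OF i2[OF that]] n4[OF that] by simp
      then show ?thesis using C by (simp add: ennreal_le_iff)
    qed
    define f where "f \<omega> = x + (\<Sum>l<n. c l * \<eta> l \<omega> * g l \<omega>) + 2 * e + (\<Sum>l<n. K ^ 4 / e ^ 3 * g l \<omega> ^ 4)" for \<omega>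
    have le: "\<eta> n \<omega> * (D \<omega> n + e) \<le> f \<omega>" for \<omega>
    proof -
      have "\<eta> n \<omega> * (D \<omega> n + e) \<le> x + (\<Sum>l<n. \<eta> l \<omega> * (D \<omega> (Suc l) - D \<omega> l)) + 2 * e + (\<Sum>l<n. (D \<omega> (Suc l) - D \<omega> l) ^ 4 / e ^ 3)"
        unfolding \<eta>_def using stopped_sum_lower_bound[OF e, of "D \<omega>" n] x by (simp add: D0)
      also have "\<dots> \<le> f \<omega>"
        unfolding f_def Dd
      proof (intro add_mono sum_mono order_refl)
        fix l assume "l \<in> {..<n}"
        then have l: "l < n" by simp
        show "\<eta> l \<omega> * (c l * g l \<omega>) \<le> c l * \<eta> l \<omega> * g l \<omega>" by (simp add: mult_ac)
        have "c l ^ 4 * g l \<omega> ^ 4 \<le> K ^ 4 * g l \<omega> ^ 4"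
          using c[OF l] by (intro mult_right_mono power_mono) auto
        then show "(c l * g l \<omega>) ^ 4 / e ^ 3 \<le> K ^ 4 / e ^ 3 * g l \<omega> ^ 4"
          using e by (simp add: power_mult_distrib divide_right_mono)
      qed
      finally show ?thesis .
    qed
    have \<eta>0: "0 \<le> \<eta> n \<omega> * (D \<omega> n + e)" for \<omega>
      by (auto simp: \<eta>_def stays_above_def)
    have if1: "integrable N (\<lambda>\<omega>. \<Sum>l<n. c l * \<eta> l \<omega> * g l \<omega>)"
      using i1 by (intro Bochner_Integration.integrable_sum) auto
    have if2: "integrable N (\<lambda>\<omega>. \<Sum>l<n. K ^ 4 / e ^ 3 * g l \<omega> ^ 4)"
      using i2 by (intro Bochner_Integration.integrable_sum integrable_mult_right) auto
    have fi: "integrable N f" unfolding f_def using if1 if2 by simp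
    have "(\<integral>\<omega>. f \<omega> \<partial>N) = x + 0 + 2 * e + (\<integral>\<omega>. (\<Sum>l<n. K ^ 4 / e ^ 3 * g l \<omega> ^ 4) \<partial>N)"
    proof -
      have "(\<integral>\<omega>. (\<Sum>l<n. c l * \<eta> l \<omega> * g l \<omega>) \<partial>N) = (\<Sum>l<n. \<integral>\<omega>. c l * \<eta> l \<omega> * g l \<omega> \<partial>N)"
        using i1 by (intro Bochner_Integration.integral_sum) auto
      also have "\<dots> = 0" using z1 by simp
      finally show ?thesis unfolding f_def using if1 if2 by (simp add: N.prob_space[simplified])
    qed
    also have "(\<integral>\<omega>. (\<Sum>l<n. K ^ 4 / e ^ 3 * g l \<omega> ^ 4) \<partial>N) = (\<Sum>l<n. K ^ 4 / e ^ 3 * (\<integral>\<omega>. g l \<omega> ^ 4 \<partial>N))"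
      using i2 by (subst Bochner_Integration.integral_sum) auto
    also have "(\<Sum>l<n. K ^ 4 / e ^ 3 * (\<integral>\<omega>. g l \<omega> ^ 4 \<partial>N)) \<le> (\<Sum>l<n. K ^ 4 / e ^ 3 * (C * (T / real n)\<^sup>2))"
      using b2 K e by (intro sum_mono mult_left_mono) auto
    also have "(\<Sum>l<n. K ^ 4 / e ^ 3 * (C * (T / real n)\<^sup>2)) = C' / real n"
      using n e by (simp add: C'_def power2_eq_square field_simps)
    finally have fb: "(\<integral>\<omega>. f \<omega> \<partial>N) \<le> x + 2 * e + C' / real n" by simp
    have "(\<integral>\<^sup>+\<omega>. ennreal (\<eta> n \<omega> * (D \<omega> n + e)) \<partial>N) \<le> (\<integral>\<^sup>+\<omega>. ennreal (f \<omega>) \<partial>N)"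
      by (intro nn_integral_mono ennreal_leI le)
    also have "\<dots> = ennreal (\<integral>\<omega>. f \<omega> \<partial>N)"
      by (intro nn_integral_eq_integral fi AE_I2 order_trans[OF \<eta>0 le])
    also have "\<dots> \<le> ennreal (x + 2 * e + C' / real n)" by (intro ennreal_leI fb)
    finally show "(\<integral>\<^sup>+\<omega>. ennreal (stays_above (- e) (discounted_gain p x n \<omega>) n * (discounted_gain p x n \<omega> n + e)) \<partial>N)
      \<le> ennreal (x + 2 * e + C' / real n)"
      unfolding \<eta>_def D_def .
  qed
qed

end

section \<open>Stochastic integrals along a subsequence\<close>

text \<open>The pointwise bound \<open>\<bar>g\<bar> \<le> c + g\<^sup>2 / c\<close> with
  \<open>c = sqrt u\<close> gives integrability and the estimate together: its integral is at most
  \<open>T * c + u / c = (T + 1) * c\<close>.\<close>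

lemma set_integral_L2_bound:
  fixes y :: "real \<Rightarrow> real"
  assumes T: "0 < T" and y: "set_borel_measurable lborel {0..T} y" and u: "0 < u"
    and b: "(\<integral>\<^sup>+s\<in>{0..T}. ennreal ((y s)\<^sup>2) \<partial>lborel) \<le> ennreal u"
  shows "set_integrable lborel {0..T} y"
    and "t \<in> {0..T} \<Longrightarrow> \<bar>LBINT s:{0..t}. y s\<bar> \<le> (T + 1) * sqrt u"
proof -
  define g where "g s = indicator {0..T} s *\<^sub>R y s" for s
  have g[measurable]: "g \<in> borel_measurable lborel" using y by (simp add: set_borel_measurable_def g_def[abs_def])
  define c where "c = sqrt u"
  have c: "0 < c" "c * c = u" using u by (auto simp: c_def)
  have "(\<integral>\<^sup>+s. ennreal (norm (g s)) \<partial>lborel)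
      \<le> (\<integral>\<^sup>+s. ennreal c * indicator {0..T} s + ennreal (1 / c) * ennreal ((g s)\<^sup>2) \<partial>lborel)"
  proof (intro nn_integral_mono)
    fix s
    have "\<bar>g s\<bar> \<le> c + 1 / c * (g s)\<^sup>2"
    proof -
      have "0 \<le> (\<bar>g s\<bar> - c)\<^sup>2 + c * \<bar>g s\<bar>" using c by simp
      then have "c * \<bar>g s\<bar> \<le> c * c + (g s)\<^sup>2"
        by (simp add: power2_eq_square algebra_simps)
      then show ?thesis using c by (simp add: field_simps)
    qed
    then show "ennreal (norm (g s)) \<le> ennreal c * indicator {0..T} s + ennreal (1 / c) * ennreal ((g s)\<^sup>2)"
      using c by (cases "s \<in> {0..T}") (auto simp: g_def ennreal_mult[symmetric] simp flip: ennreal_plus intro!: ennreal_leI)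
  qed
  also have "\<dots> = ennreal c * ennreal T + ennreal (1 / c) * (\<integral>\<^sup>+s. ennreal ((g s)\<^sup>2) \<partial>lborel)"
    using T by (subst nn_integral_add, measurable, subst nn_integral_cmult, measurable) (simp add: nn_integral_cmult_indicator)
  also have "(\<integral>\<^sup>+s. ennreal ((g s)\<^sup>2) \<partial>lborel) = (\<integral>\<^sup>+s\<in>{0..T}. ennreal ((y s)\<^sup>2) \<partial>lborel)"
    by (intro nn_integral_cong) (simp add: g_def indicator_def)
  also have "ennreal c * ennreal T + ennreal (1 / c) * (\<integral>\<^sup>+s\<in>{0..T}. ennreal ((y s)\<^sup>2) \<partial>lborel)
      \<le> ennreal c * ennreal T + ennreal (1 / c) * ennreal u"
    by (intro add_left_mono mult_left_mono b) auto
  also have "\<dots> = ennreal ((T + 1) * c)"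
    using c T u by (simp add: ennreal_mult[symmetric] c(2)[symmetric] algebra_simps flip: ennreal_plus)
  finally have le: "(\<integral>\<^sup>+s. ennreal (norm (g s)) \<partial>lborel) \<le> ennreal ((T + 1) * c)" .
  have gi: "integrable lborel g"
    by (rule integrableI_bounded) (use le in \<open>auto intro: order_le_less_trans\<close>)
  then show int: "set_integrable lborel {0..T} y" by (simp add: set_integrable_def g_def[abs_def])
  assume t: "t \<in> {0..T}"
  then have "set_integrable lborel {0..t} y" by (intro set_integrable_subset[OF int]) auto
  then have ti: "integrable lborel (\<lambda>s. indicator {0..t} s *\<^sub>R y s)" by (simp add: set_integrable_def)
  have "ennreal (norm (LBINT s:{0..t}. y s)) \<le> (\<integral>\<^sup>+s. ennreal (norm (indicator {0..t} s *\<^sub>R y s)) \<partial>lborel)"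
    unfolding set_lebesgue_integral_def by (rule integral_norm_bound_ennreal[OF ti])
  also have "\<dots> \<le> (\<integral>\<^sup>+s. ennreal (norm (g s)) \<partial>lborel)"
    using t by (intro nn_integral_mono ennreal_leI) (auto simp: g_def indicator_def)
  also note le
  finally show "\<bar>LBINT s:{0..t}. y s\<bar> \<le> (T + 1) * sqrt u"
    using c T by (simp add: c_def ennreal_le_iff)
qed

text \<open>With time itself as integrator the elementary integral is an ordinary one; this is the
  drift part of \<open>gain1\<close>.\<close>

lemma simple_integral_identity:
  assumes p: "simple_process mk p" and t: "t \<in> {0..horizon mk}"
  shows "simple_integral p (\<lambda>t \<omega>. t) t \<omega> = (LBINT s:{0..t}. simple_value p s \<omega>)"
proof -
  obtain n \<tau> \<xi> where peq: "p = (n, \<tau>, \<xi>)" by (metis prod_cases3)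
  have \<tau>: "\<And>k. k \<le> n \<Longrightarrow> \<tau> k \<in> {0..horizon mk}" "\<And>k. k < n \<Longrightarrow> \<tau> k \<le> \<tau> (Suc k)"
    using p by (auto simp: simple_process_def peq)
  have set: "indicator {0..t} s * indicator {\<tau> k<..\<tau> (Suc k)} s = (indicator {\<tau> k<..min t (\<tau> (Suc k))} s :: real)"
    if "k < n" for k s
    using \<tau>(1)[of k] that by (auto simp: indicator_def)
  have int: "integrable lborel (\<lambda>s. \<xi> k \<omega> * (indicator {\<tau> k<..min t (\<tau> (Suc k))} s :: real))" for k
  proof -
    have "bounded {\<tau> k<..min t (\<tau> (Suc k))}"
      by (rule bounded_subset[OF bounded_closed_interval[of "\<tau> k" "min t (\<tau> (Suc k))"]]) auto
    then show ?thesis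
      by (intro integrable_mult_right integrable_real_indicator emeasure_bounded_finite) auto
  qed
  have val: "(\<integral>s. (indicator {\<tau> k<..min t (\<tau> (Suc k))} s :: real) \<partial>lborel) = min t (\<tau> (Suc k)) - min t (\<tau> k)" if "k < n" for k
  proof -
    have "(\<integral>s. (indicator {\<tau> k<..min t (\<tau> (Suc k))} s :: real) \<partial>lborel) = measure lborel {\<tau> k<..min t (\<tau> (Suc k))}"
      by simp
    also have "\<dots> = min t (\<tau> (Suc k)) - min t (\<tau> k)"
      using \<tau>(2)[OF that] by (cases "\<tau> k \<le> min t (\<tau> (Suc k))") (auto simp: min_def split: if_splits)
    finally show ?thesis .
  qed
  have "(LBINT s:{0..t}. simple_value p s \<omega>) = (\<integral>s. (\<Sum>k<n. \<xi> k \<omega> * indicator {\<tau> k<..min t (\<tau> (Suc k))} s) \<partial>lborel)"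
    unfolding set_lebesgue_integral_def peq simple_value_def
  proof (intro Bochner_Integration.integral_cong refl)
    fix s
    have "indicator {0..t} s * (\<xi> k \<omega> * indicator {\<tau> k<..\<tau> (Suc k)} s) = \<xi> k \<omega> * indicator {\<tau> k<..min t (\<tau> (Suc k))} s"
      if "k < n" for k
      unfolding set[OF that, symmetric] by simp
    then show "indicator {0..t} s *\<^sub>R (case (n, \<tau>, \<xi>) of (n, \<tau>, \<xi>) \<Rightarrow> \<Sum>k<n. \<xi> k \<omega> * indicator {\<tau> k<..\<tau> (Suc k)} s)
        = (\<Sum>k<n. \<xi> k \<omega> * indicator {\<tau> k<..min t (\<tau> (Suc k))} s)"
      unfolding prod.case real_scaleR_def sum_distrib_left by (intro sum.cong refl) (simp only: lessThan_iff)
  qed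
  also have "\<dots> = (\<Sum>k<n. \<xi> k \<omega> * (\<integral>s. indicator {\<tau> k<..min t (\<tau> (Suc k))} s \<partial>lborel))"
    using int by (subst Bochner_Integration.integral_sum) auto
  also have "\<dots> = (\<Sum>k<n. \<xi> k \<omega> * (min t (\<tau> (Suc k)) - min t (\<tau> k)))"
    by (intro sum.cong refl) (simp only: lessThan_iff val)
  also have "\<dots> = simple_integral p (\<lambda>t \<omega>. t) t \<omega>" by (simp add: peq simple_integral_def)
  finally show ?thesis by simp
qed

lemma simple_value_measurable: "(\<lambda>s. simple_value p s \<omega>) \<in> borel_measurable borel"
proof -
  obtain n \<tau> \<xi> where peq: "p = (n, \<tau>, \<xi>)" by (metis prod_cases3)
  show ?thesis unfolding peq simple_value_def by measurable
qed

lemma progressive_adapted: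
  assumes "progressive mk \<phi>" "t \<in> {0..horizon mk}"
  shows "\<phi> t \<in> borel_measurable (filt mk t)"
proof -
  have m: "(\<lambda>(s, \<omega>). \<phi> s \<omega>) \<in> borel_measurable (restrict_space borel {0..t} \<Otimes>\<^sub>M filt mk t)"
    using assms by (auto simp: progressive_def)
  have "(\<lambda>\<omega>. (t, \<omega>)) \<in> measurable (filt mk t) (restrict_space borel {0..t} \<Otimes>\<^sub>M filt mk t)"
    using assms(2) by (intro measurable_Pair1') (auto simp: space_restrict_space)
  from measurable_compose[OF this m] show ?thesis by simp
qed

lemma progressive_path_measurable:
  assumes "progressive mk \<phi>" "0 < horizon mk" "\<omega> \<in> space (filt mk (horizon mk))"
  shows "set_borel_measurable lborel {0..horizon mk} (\<lambda>s. \<phi> s \<omega>)"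
proof -
  let ?T = "horizon mk"
  have m: "(\<lambda>(s, \<omega>). \<phi> s \<omega>) \<in> borel_measurable (restrict_space borel {0..?T} \<Otimes>\<^sub>M filt mk ?T)"
    using assms by (auto simp: progressive_def)
  have "(\<lambda>s. (s, \<omega>)) \<in> measurable (restrict_space borel {0..?T}) (restrict_space borel {0..?T} \<Otimes>\<^sub>M filt mk ?T)"
    using assms(3) by (rule measurable_Pair2')
  from measurable_compose[OF this m] have "(\<lambda>s. \<phi> s \<omega>) \<in> borel_measurable (restrict_space borel {0..?T})" by simp
  then show ?thesis
    by (simp add: set_borel_measurable_def borel_measurable_restrict_space_iff)
qed

context black_scholes
begin

lemma gain1_eq:
  "gain1 p i t \<omega> = simple_integral p (\<lambda>t \<omega>. W t \<omega> $ i) t \<omega> + \<theta> $ i * simple_integral p (\<lambda>t \<omega>. t) t \<omega>"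
proof -
  obtain n \<tau> \<xi> where peq: "p = (n, \<tau>, \<xi>)" by (metis prod_cases3)
  show ?thesis
    unfolding gain1_def peq simple_integral_def V_def
    by (simp add: sum_distrib_left sum.distrib[symmetric] algebra_simps)
qed

text \<open>The \<open>W\<close> part converges by the definition of the integral, the drift part
  because mean square convergence in time controls all time integrals uniformly. Along the extracted
  indices both errors have explicit bounds free of \<open>t\<close>.\<close>

lemma ito_integral_approximation:
  assumes I: "is_ito_integral mk i b I"
  shows "\<exists>p. (\<forall>m. simple_process mk (p m)) \<and> (AE \<omega> in M.
    set_integrable lborel {0..T} (\<lambda>s. b s \<omega>) \<and>
    uniform_limit {0..T} (\<lambda>m t. gain1 (p m) i t \<omega>) (\<lambda>t. I t \<omega> + \<theta> $ i * (LBINT s:{0..t}. b s \<omega>)) sequentially)"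
proof -
  have prog: "progressive mk b"
    and fin: "AE \<omega> in M. (\<integral>\<^sup>+s\<in>{0..T}. ennreal ((b s \<omega>)\<^sup>2) \<partial>lborel) < \<infinity>"
    using I by (auto simp: is_ito_integral_def)
  obtain p where p: "\<And>m. simple_process mk (p m)"
    and v1: "vanish_in_prob M (\<lambda>m \<omega>. \<integral>\<^sup>+s\<in>{0..T}. ennreal ((simple_value (p m) s \<omega> - b s \<omega>)\<^sup>2) \<partial>lborel)"
    and v2: "vanish_in_prob M (\<lambda>m \<omega>. SUP t\<in>{0..T}. ennreal \<bar>simple_integral (p m) (\<lambda>t \<omega>. W t \<omega> $ i) t \<omega> - I t \<omega>\<bar>)"
    using I unfolding is_ito_integral_def by blast
  obtain f where f: "AE \<omega> in M. \<forall>\<^sub>F m in sequentially.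
      (\<integral>\<^sup>+s\<in>{0..T}. ennreal ((simple_value (p (f m)) s \<omega> - b s \<omega>)\<^sup>2) \<partial>lborel) \<le> ennreal ((1/2) ^ m) \<and>
      (SUP t\<in>{0..T}. ennreal \<bar>simple_integral (p (f m)) (\<lambda>t \<omega>. W t \<omega> $ i) t \<omega> - I t \<omega>\<bar>) \<le> ennreal ((1/2) ^ m)"
    using vanish_in_prob_subsequence[OF prob_M v1 v2] by blast
  have "AE \<omega> in M. set_integrable lborel {0..T} (\<lambda>s. b s \<omega>) \<and>
    uniform_limit {0..T} (\<lambda>m t. gain1 (p (f m)) i t \<omega>) (\<lambda>t. I t \<omega> + \<theta> $ i * (LBINT s:{0..t}. b s \<omega>)) sequentially"
    using f fin AE_space
  proof eventually_elim
    case (elim \<omega>)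
    have bm: "set_borel_measurable lborel {0..T} (\<lambda>s. b s \<omega>)"
      using elim T_pos by (intro progressive_path_measurable prog) (auto simp: space_F)
    obtain u where "(\<integral>\<^sup>+s\<in>{0..T}. ennreal ((b s \<omega>)\<^sup>2) \<partial>lborel) = ennreal u" "0 \<le> u"
      using elim(2) by (cases "\<integral>\<^sup>+s\<in>{0..T}. ennreal ((b s \<omega>)\<^sup>2) \<partial>lborel" rule: ennreal_cases) auto
    \<comment> \<open>The norm may be zero, while the bound must be positive, hence
      \<open>u + 1\<close>.\<close>
    then have "(\<integral>\<^sup>+s\<in>{0..T}. ennreal ((b s \<omega>)\<^sup>2) \<partial>lborel) \<le> ennreal (u + 1)" "0 < u + 1"
      by (auto intro: ennreal_leI)
    then have bi: "set_integrable lborel {0..T} (\<lambda>s. b s \<omega>)"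
      using set_integral_L2_bound(1)[OF T_pos bm] by blast
    have bound: "\<bar>gain1 (p (f m)) i t \<omega> - (I t \<omega> + \<theta> $ i * (LBINT s:{0..t}. b s \<omega>))\<bar>
        \<le> (1/2) ^ m + \<bar>\<theta> $ i\<bar> * ((T + 1) * sqrt ((1/2) ^ m))"
      if l2: "(\<integral>\<^sup>+s\<in>{0..T}. ennreal ((simple_value (p (f m)) s \<omega> - b s \<omega>)\<^sup>2) \<partial>lborel) \<le> ennreal ((1/2) ^ m)"
        and sup: "(SUP t\<in>{0..T}. ennreal \<bar>simple_integral (p (f m)) (\<lambda>t \<omega>. W t \<omega> $ i) t \<omega> - I t \<omega>\<bar>) \<le> ennreal ((1/2) ^ m)"
        and t: "t \<in> {0..T}" for m t
    proof -
      define v where "v s = simple_value (p (f m)) s \<omega>" for s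
      have [measurable]: "v \<in> borel_measurable borel" unfolding v_def by (rule simple_value_measurable)
      have "(\<lambda>s. indicator {0..T} s *\<^sub>R v s - indicator {0..T} s *\<^sub>R b s \<omega>) \<in> borel_measurable lborel"
        by (intro borel_measurable_diff bm[unfolded set_borel_measurable_def]) measurable
      then have ym: "set_borel_measurable lborel {0..T} (\<lambda>s. v s - b s \<omega>)"
        by (simp add: set_borel_measurable_def right_diff_distrib)
      have pos: "0 < (1/2 :: real) ^ m" by simp
      note L = set_integral_L2_bound[OF T_pos ym pos l2[folded v_def]]
      have sub: "set_integrable lborel {0..t} (\<lambda>s. v s - b s \<omega>)" "set_integrable lborel {0..t} (\<lambda>s. b s \<omega>)"
        using t by (auto intro!: set_integrable_subset[OF L(1)] set_integrable_subset[OF bi])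
      have "(LBINT s:{0..t}. (v s - b s \<omega>) + b s \<omega>) = (LBINT s:{0..t}. v s - b s \<omega>) + (LBINT s:{0..t}. b s \<omega>)"
        by (rule set_integral_add(2)[OF sub])
      then have split: "simple_integral (p (f m)) (\<lambda>t \<omega>. t) t \<omega> - (LBINT s:{0..t}. b s \<omega>) = (LBINT s:{0..t}. v s - b s \<omega>)"
        unfolding simple_integral_identity[OF p t] v_def by simp
      have "ennreal \<bar>simple_integral (p (f m)) (\<lambda>t \<omega>. W t \<omega> $ i) t \<omega> - I t \<omega>\<bar> \<le> ennreal ((1/2) ^ m)"
        by (rule order_trans[OF SUP_upper[OF t] sup])
      then have w: "\<bar>simple_integral (p (f m)) (\<lambda>t \<omega>. W t \<omega> $ i) t \<omega> - I t \<omega>\<bar> \<le> (1/2) ^ m"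
        by (subst (asm) ennreal_le_iff) auto
      have "gain1 (p (f m)) i t \<omega> - (I t \<omega> + \<theta> $ i * (LBINT s:{0..t}. b s \<omega>))
          = (simple_integral (p (f m)) (\<lambda>t \<omega>. W t \<omega> $ i) t \<omega> - I t \<omega>) + \<theta> $ i * (LBINT s:{0..t}. v s - b s \<omega>)"
        unfolding gain1_eq split[symmetric] by (simp add: algebra_simps)
      moreover have "\<bar>\<theta> $ i * (LBINT s:{0..t}. v s - b s \<omega>)\<bar> \<le> \<bar>\<theta> $ i\<bar> * ((T + 1) * sqrt ((1/2) ^ m))"
        unfolding abs_mult by (intro mult_left_mono L(2) t) simp
      ultimately show ?thesis using w by linarith
    qed
    have "(\<lambda>m. (1/2) ^ m + \<bar>\<theta> $ i\<bar> * ((T + 1) * sqrt ((1/2) ^ m))) \<longlonglongrightarrow> 0 + \<bar>\<theta> $ i\<bar> * ((T + 1) * sqrt 0)"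
      by (intro tendsto_intros LIMSEQ_realpow_zero) auto
    then have lim: "(\<lambda>m. (1/2) ^ m + \<bar>\<theta> $ i\<bar> * ((T + 1) * sqrt ((1/2) ^ m))) \<longlonglongrightarrow> 0" by simp
    have "uniform_limit {0..T} (\<lambda>m t. gain1 (p (f m)) i t \<omega>) (\<lambda>t. I t \<omega> + \<theta> $ i * (LBINT s:{0..t}. b s \<omega>)) sequentially"
    proof (rule uniform_limitI)
      fix e :: real assume "0 < e"
      from order_tendstoD(2)[OF lim this] elim(1)
      show "\<forall>\<^sub>F m in sequentially. \<forall>t\<in>{0..T}. dist (gain1 (p (f m)) i t \<omega>) (I t \<omega> + \<theta> $ i * (LBINT s:{0..t}. b s \<omega>)) < e"
      proof eventually_elim
        case (elim m)
        then show ?case unfolding dist_real_def using bound by (meson order_le_less_trans)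
      qed
    qed
    then show ?case using bi by blast
  qed
  then show ?thesis by (intro exI[of _ "\<lambda>m. p (f m)"] conjI allI p)
qed

end

section \<open>Discounted wealth under the martingale measure\<close>

lemma uniform_limit_sum:
  fixes f :: "'i \<Rightarrow> nat \<Rightarrow> 'b \<Rightarrow> real"
  assumes "finite I" "\<And>i. i \<in> I \<Longrightarrow> uniform_limit S (f i) (l i) sequentially"
  shows "uniform_limit S (\<lambda>n x. \<Sum>i\<in>I. f i n x) (\<lambda>x. \<Sum>i\<in>I. l i x) sequentially"
  using assms
proof (induction I rule: finite_induct)
  case empty
  then show ?case by (simp add: uniform_limit_const)
next
  case (insert i I)
  then have "uniform_limit S (\<lambda>n x. f i n x + (\<Sum>i\<in>I. f i n x)) (\<lambda>x. l i x + (\<Sum>i\<in>I. l i x)) sequentially"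
    by (intro uniform_limit_add) auto
  then show ?case using insert by simp
qed

context black_scholes
begin

section \<open>Wealth as a limit of simple gains\<close>

lemma gain_continuous:
  assumes W: "continuous_on {0..T} (\<lambda>t. W t \<omega>)" and p: "\<And>i. simple_process mk (p i)"
  shows "continuous_on {0..T} (\<lambda>t. gain p t \<omega>)"
proof -
  have "continuous_on {0..T} (\<lambda>t. gain1 (p i) i t \<omega>)" for i
  proof -
    obtain n \<tau> \<xi> where peq: "p i = (n, \<tau>, \<xi>)" by (metis prod_cases3)
    have \<tau>: "\<And>k. k \<le> n \<Longrightarrow> \<tau> k \<in> {0..T}"
      using p[of i] by (auto simp: simple_process_def peq)
    have c: "continuous_on {0..T} (\<lambda>t. V t \<omega> $ i)"
      unfolding V_def by (intro continuous_intros W)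
    have "continuous_on {0..T} (\<lambda>t. V (min t (\<tau> k)) \<omega> $ i)" if "k \<le> n" for k
      using \<tau>[OF that] by (intro continuous_on_compose2[OF c] continuous_intros) auto
    then show ?thesis
      unfolding gain1_def peq simple_integral_def prod.case
      by (intro continuous_on_sum continuous_on_mult continuous_on_diff continuous_on_const) auto
  qed
  then show ?thesis unfolding gain_def by (intro continuous_intros)
qed

lemma wealth_measurable:
  assumes sf: "self_financing mk x \<pi>" and t: "t \<in> {0..T}"
  shows "wealth mk \<pi> t \<in> borel_measurable (F t)"
proof -
  \<comment> \<open>Adaptedness of a stock is implicit: the integrand of its equation is
    progressive, and division by the positive volatility recovers the stock.\<close>
  have "progressive mk (\<lambda>t \<omega>. vol mk $ i * stock mk t \<omega> $ i)" for i
    using bs by (auto simp: black_scholes_market_def is_ito_process_def is_ito_integral_def)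
  then have "(\<lambda>\<omega>. vol mk $ i * stock mk t \<omega> $ i) \<in> borel_measurable (F t)" for i
    using t by (rule progressive_adapted)
  note vS = this
  have [measurable]: "(\<lambda>\<omega>. stock mk t \<omega> $ i) \<in> borel_measurable (F t)" for i
    using borel_measurable_divide[OF vS[of i] borel_measurable_const[of "vol mk $ i"]] vol_pos[of i] by simp
  have "progressive mk (fst \<pi>)" "\<And>i. progressive mk (\<lambda>t \<omega>. snd \<pi> t \<omega> $ i)"
    using sf by (auto simp: self_financing_def)
  then have [measurable]: "fst \<pi> t \<in> borel_measurable (F t)" "\<And>i. (\<lambda>\<omega>. snd \<pi> t \<omega> $ i) \<in> borel_measurable (F t)"
    using t progressive_adapted[of mk "fst \<pi>"] progressive_adapted[of mk "\<lambda>t \<omega>. snd \<pi> t \<omega> $ _"] by blast+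
  show ?thesis unfolding wealth_def by measurable
qed

text \<open>All drift beyond the market price of risk is interest on the total wealth, which leaves
  a linear equation driven by the limit \<open>m\<close> of simple gains. Continuity of wealth is a
  consequence: \<open>m\<close> is a uniform limit of continuous paths, and an indefinite integral
  is continuous.\<close>

lemma wealth_decomposition:
  assumes sf: "self_financing mk x \<pi>"
  shows "\<exists>P m. (\<forall>k i. simple_process mk (P k i)) \<and> (AE \<omega> in M.
    continuous_on {0..T} (\<lambda>t. wealth mk \<pi> t \<omega>) \<and>
    uniform_limit {0..T} (\<lambda>k t. gain (P k) t \<omega>) (\<lambda>t. m t \<omega>) sequentially \<and>
    (\<forall>t\<in>{0..T}. wealth mk \<pi> t \<omega> = x + m t \<omega> + rate mk * integral {0..t} (\<lambda>s. wealth mk \<pi> s \<omega>)))"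
proof -
  define a where "a i t \<omega> = snd \<pi> t \<omega> $ i * (drift mk $ i * stock mk t \<omega> $ i)" for i t \<omega>
  define b where "b i t \<omega> = snd \<pi> t \<omega> $ i * (vol mk $ i * stock mk t \<omega> $ i)" for i t \<omega>
  define c where "c t \<omega> = fst \<pi> t \<omega> * (rate mk * bank mk t)" for t \<omega>
  obtain J where J: "\<And>i. is_ito_process mk i (a i) (b i) (J i)"
    and wealth_eq: "AE \<omega> in M. \<forall>t\<in>{0..T}. wealth mk \<pi> t \<omega> = x + (LBINT s:{0..t}. c s \<omega>) + (\<Sum>i\<in>UNIV. J i t \<omega>)"
    using sf unfolding self_financing_def a_def[abs_def] b_def[abs_def] c_def[abs_def] by blast
  have c: "AE \<omega> in M. set_integrable lborel {0..T} (\<lambda>s. c s \<omega>)"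
    using sf by (auto simp: self_financing_def time_integrable_def c_def)
  have a: "AE \<omega> in M. set_integrable lborel {0..T} (\<lambda>s. a i s \<omega>)" for i
    using J[of i] by (auto simp: is_ito_process_def time_integrable_def)
  have "\<forall>i. \<exists>I. is_ito_integral mk i (b i) I \<and>
      (AE \<omega> in M. \<forall>t\<in>{0..T}. J i t \<omega> = (LBINT s:{0..t}. a i s \<omega>) + I t \<omega>)"
    using J unfolding is_ito_process_def by blast
  from choice[OF this] obtain I where I: "\<And>i. is_ito_integral mk i (b i) (I i)"
    and J_eq: "\<And>i. AE \<omega> in M. \<forall>t\<in>{0..T}. J i t \<omega> = (LBINT s:{0..t}. a i s \<omega>) + I i t \<omega>"
    by blast
  have "\<forall>i. \<exists>p. (\<forall>k. simple_process mk (p k)) \<and> (AE \<omega> in M.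
    set_integrable lborel {0..T} (\<lambda>s. b i s \<omega>) \<and>
    uniform_limit {0..T} (\<lambda>k t. gain1 (p k) i t \<omega>) (\<lambda>t. I i t \<omega> + \<theta> $ i * (LBINT s:{0..t}. b i s \<omega>)) sequentially)"
    using ito_integral_approximation[OF I] by blast
  from choice[OF this] obtain p where p: "\<And>i k. simple_process mk (p i k)"
    and lim: "\<And>i. AE \<omega> in M. set_integrable lborel {0..T} (\<lambda>s. b i s \<omega>) \<and>
    uniform_limit {0..T} (\<lambda>k t. gain1 (p i k) i t \<omega>) (\<lambda>t. I i t \<omega> + \<theta> $ i * (LBINT s:{0..t}. b i s \<omega>)) sequentially"
    by blast
  define P where "P k i = p i k" for k i
  define m where "m t \<omega> = (\<Sum>i\<in>UNIV. I i t \<omega> + \<theta> $ i * (LBINT s:{0..t}. b i s \<omega>))" for t \<omega>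
  have P: "\<And>k i. simple_process mk (P k i)" using p by (simp add: P_def)
  have Wc: "AE \<omega> in M. continuous_on {0..T} (\<lambda>t. W t \<omega>)"
    using wiener by (simp add: Q_wiener_process_def)
  have aA: "AE \<omega> in M. \<forall>i\<in>UNIV. set_integrable lborel {0..T} (\<lambda>s. a i s \<omega>)"
    by (rule AE_finite_allI[OF finite]) (rule a)
  have JA: "AE \<omega> in M. \<forall>i\<in>UNIV. \<forall>t\<in>{0..T}. J i t \<omega> = (LBINT s:{0..t}. a i s \<omega>) + I i t \<omega>"
    by (rule AE_finite_allI[OF finite]) (rule J_eq)
  have limA: "AE \<omega> in M. \<forall>i\<in>UNIV. set_integrable lborel {0..T} (\<lambda>s. b i s \<omega>) \<and>
    uniform_limit {0..T} (\<lambda>k t. gain1 (p i k) i t \<omega>) (\<lambda>t. I i t \<omega> + \<theta> $ i * (LBINT s:{0..t}. b i s \<omega>)) sequentially"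
    by (rule AE_finite_allI[OF finite]) (rule lim)
  have "AE \<omega> in M. continuous_on {0..T} (\<lambda>t. wealth mk \<pi> t \<omega>) \<and>
    uniform_limit {0..T} (\<lambda>k t. gain (P k) t \<omega>) (\<lambda>t. m t \<omega>) sequentially \<and>
    (\<forall>t\<in>{0..T}. wealth mk \<pi> t \<omega> = x + m t \<omega> + rate mk * integral {0..t} (\<lambda>s. wealth mk \<pi> s \<omega>))"
    using wealth_eq c aA JA limA Wc
  proof eventually_elim
    case (elim \<omega>)
    define X where "X t = wealth mk \<pi> t \<omega>" for t
    have ul: "uniform_limit {0..T} (\<lambda>k t. gain (P k) t \<omega>) (\<lambda>t. m t \<omega>) sequentially"
      unfolding gain_def m_def P_def using elim(5) by (intro uniform_limit_sum) auto
    have mc: "continuous_on {0..T} (\<lambda>t. m t \<omega>)"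
      by (rule uniform_limit_theorem[OF _ ul]) (auto intro!: always_eventually gain_continuous elim P)
    \<comment> \<open>By definition
      \<open>\<theta> $ i * vol mk $ i = drift mk $ i - rate mk\<close>, so only the interest on the
      stock position remains.\<close>
    have drift: "a i s \<omega> - \<theta> $ i * b i s \<omega> = rate mk * (snd \<pi> s \<omega> $ i * stock mk s \<omega> $ i)" for i s
      using vol_pos[of i] by (simp add: a_def b_def theta_def field_simps)
    have rX: "rate mk * X s = c s \<omega> + (\<Sum>i\<in>UNIV. a i s \<omega> - \<theta> $ i * b i s \<omega>)" for s
      unfolding drift X_def wealth_def c_def by (simp add: distrib_left sum_distrib_left mult_ac)
    have bi: "set_integrable lborel {0..T} (\<lambda>s. \<theta> $ i * b i s \<omega>)" for i
      using elim(5) by (intro set_integrable_mult_right) auto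
    have abi: "set_integrable lborel {0..T} (\<lambda>s. a i s \<omega> - \<theta> $ i * b i s \<omega>)" for i
      using elim(3) bi by (intro set_integral_diff) auto
    have sumi: "set_integrable lborel {0..T} (\<lambda>s. \<Sum>i\<in>UNIV. a i s \<omega> - \<theta> $ i * b i s \<omega>)"
      using abi unfolding set_integrable_def scaleR_sum_right by (intro Bochner_Integration.integrable_sum)
    \<comment> \<open>The rate stays inside the integral: for a zero rate nothing is known yet about
      integrability of \<open>X\<close> itself. It is pulled out once the integral is a gauge
      integral, where this is unconditional.\<close>
    have rXi: "set_integrable lborel {0..T} (\<lambda>s. rate mk * X s)"
      unfolding rX by (intro set_integral_add elim sumi)
    have X_eq: "X t = x + m t \<omega> + (LBINT s:{0..t}. rate mk * X s)" if t: "t \<in> {0..T}" for t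
    proof -
      have sub: "set_integrable lborel {0..t} f" if "set_integrable lborel {0..T} f" for f :: "real \<Rightarrow> real"
        using that t by (rule_tac set_integrable_subset[OF that]) auto
      have "(LBINT s:{0..t}. rate mk * X s) = (LBINT s:{0..t}. c s \<omega>) + (LBINT s:{0..t}. \<Sum>i\<in>UNIV. a i s \<omega> - \<theta> $ i * b i s \<omega>)"
        unfolding rX by (intro set_integral_add(2) sub elim sumi)
      also have "(LBINT s:{0..t}. \<Sum>i\<in>UNIV. a i s \<omega> - \<theta> $ i * b i s \<omega>) = (\<Sum>i\<in>UNIV. LBINT s:{0..t}. a i s \<omega> - \<theta> $ i * b i s \<omega>)"
        using sub[OF abi] unfolding set_integrable_def set_lebesgue_integral_def scaleR_sum_right
        by (intro Bochner_Integration.integral_sum)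
      also have "\<dots> = (\<Sum>i\<in>UNIV. (LBINT s:{0..t}. a i s \<omega>) - \<theta> $ i * (LBINT s:{0..t}. b i s \<omega>))"
        using elim(3) by (intro sum.cong refl) (simp add: set_integral_diff(2) sub bi)
      finally show ?thesis
        using elim(1,4) t by (simp add: X_def m_def sum.distrib sum_subtractf)
    qed
    have "(\<lambda>s. rate mk * X s) integrable_on {0..T}"
      using rXi by (rule set_borel_integral_eq_integral)
    then have "continuous_on {0..T} (\<lambda>t. integral {0..t} (\<lambda>s. rate mk * X s))"
      by (rule indefinite_integral_continuous_1)
    then have "continuous_on {0..T} (\<lambda>t. x + m t \<omega> + integral {0..t} (\<lambda>s. rate mk * X s))"
      by (intro continuous_intros mc)
    moreover have X_eq': "X t = x + m t \<omega> + integral {0..t} (\<lambda>s. rate mk * X s)" if t: "t \<in> {0..T}" for t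
    proof -
      have "set_integrable lborel {0..t} (\<lambda>s. rate mk * X s)"
        using t by (intro set_integrable_subset[OF rXi]) auto
      then show ?thesis using X_eq[OF t] set_borel_integral_eq_integral(2) by metis
    qed
    moreover have "continuous_on {0..T} X = continuous_on {0..T} (\<lambda>t. x + m t \<omega> + integral {0..t} (\<lambda>s. rate mk * X s))"
      by (rule continuous_on_cong[OF refl X_eq'])
    ultimately have "continuous_on {0..T} X" by blast
    moreover have "integral {0..t} (\<lambda>s. rate mk * X s) = rate mk * integral {0..t} X" for t by simp
    ultimately show ?case
      using ul X_eq' unfolding X_def[abs_def] by simp
  qed
  then show ?thesis using P by blast
qed

text \<open>
  Along the grid the discounted wealth is the limit of discounted gains of simple strategies, which
  are martingales; stopping them when they fall below \<open>- e\<close> keeps them bounded below without changing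
  their limit, so Fatou applies.
\<close>

theorem admissible_supermartingale:
  assumes adm: "admissible mk x \<pi>"
  shows "0 \<le> x" and "(\<integral>\<^sup>+\<omega>. ennreal (exp (- rate mk * T) * wealth mk \<pi> T \<omega>) \<partial>N) \<le> ennreal x"
proof -
  have sf: "self_financing mk x \<pi>" and nonneg: "AE \<omega> in M. \<forall>t\<in>{0..T}. 0 \<le> wealth mk \<pi> t \<omega>"
    using adm by (auto simp: admissible_def)
  have start: "AE \<omega> in M. wealth mk \<pi> 0 \<omega> = x" using sf by (simp add: self_financing_def)
  have "AE \<omega> in M. 0 \<le> x" using nonneg start by eventually_elim (use T_pos in auto)
  then show x: "0 \<le> x" by simp
  obtain P m where P: "\<And>k i. simple_process mk (P k i)" and dec: "AE \<omega> in M.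
    continuous_on {0..T} (\<lambda>t. wealth mk \<pi> t \<omega>) \<and>
    uniform_limit {0..T} (\<lambda>k t. gain (P k) t \<omega>) (\<lambda>t. m t \<omega>) sequentially \<and>
    (\<forall>t\<in>{0..T}. wealth mk \<pi> t \<omega> = x + m t \<omega> + rate mk * integral {0..t} (\<lambda>s. wealth mk \<pi> s \<omega>))"
    using wealth_decomposition[OF sf] by blast
  define Y where "Y \<omega> = exp (- rate mk * T) * wealth mk \<pi> T \<omega>" for \<omega>
  have step: "(\<integral>\<^sup>+\<omega>. ennreal (Y \<omega> + e) \<partial>N) \<le> ennreal (x + 2 * e)" if e: "0 < e" for e
  proof -
    have "\<forall>k. \<exists>C\<ge>0. \<forall>n>0.
      (\<integral>\<^sup>+\<omega>. ennreal (stays_above (- e) (discounted_gain (P k) x n \<omega>) n * (discounted_gain (P k) x n \<omega> n + e)) \<partial>N)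
      \<le> ennreal (x + 2 * e + C / real n)"
      using nn_integral_stopped_gain_le[OF P x e] by (intro allI)
    from choice[OF this] obtain C where C: "\<And>k. 0 \<le> C k" and Cb: "\<And>k n. 0 < n \<Longrightarrow>
      (\<integral>\<^sup>+\<omega>. ennreal (stays_above (- e) (discounted_gain (P k) x n \<omega>) n * (discounted_gain (P k) x n \<omega> n + e)) \<partial>N)
      \<le> ennreal (x + 2 * e + C k / real n)"
      by blast
    \<comment> \<open>\<open>C k\<close> may grow with \<open>k\<close>, so the grid is chosen after
      the approximant: fine enough to make \<open>C k / n\<close> vanish in the limit, and with at
      least \<open>k\<close> steps so that the mesh tends to zero.\<close>
    have "\<exists>n. k \<le> n \<and> 0 < n \<and> C k / real n \<le> 1 / real (Suc k)" for k
    proof -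
      obtain n0 :: nat where n0: "real (Suc k) * C k \<le> real n0" using real_arch_simple by blast
      define n where "n = max n0 (Suc k)"
      have "real (Suc k) * C k \<le> real n" using n0 by (simp add: n_def)
      then have "C k / real n \<le> 1 / real (Suc k)" by (simp add: n_def field_simps)
      then show ?thesis by (intro exI[of _ n]) (auto simp: n_def)
    qed
    then obtain n where n: "\<And>k. k \<le> n k" "\<And>k. 0 < n k" "\<And>k. C k / real (n k) \<le> 1 / real (Suc k)" by metis
    define D where "D k \<omega> = discounted_gain (P k) x (n k) \<omega>" for k \<omega>
    define f where "f k \<omega> = ennreal (stays_above (- e) (D k \<omega>) (n k) * (D k \<omega> (n k) + e))" for k \<omega>
    have [measurable]: "f k \<in> borel_measurable N" for k
    proof -
      have "(\<lambda>\<omega>. D k \<omega> j) \<in> borel_measurable M" if "j \<le> n k" for j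
        unfolding D_def using that n grid_in[OF T_pos n(2)]
        by (intro measurable_F_M[OF _ discounted_gain_measurable[OF P n(2) that order_refl]]) auto
      then have "(\<lambda>\<omega>. stays_above (- e) (D k \<omega>) (n k) * (D k \<omega> (n k) + e)) \<in> borel_measurable M"
        by (intro borel_measurable_times borel_measurable_add stays_above_measurable) auto
      then show ?thesis unfolding f_def by measurable
    qed
    have "AE \<omega> in M. ennreal (Y \<omega> + e) \<le> liminf (\<lambda>k. f k \<omega>)"
      using dec nonneg start
    proof eventually_elim
      case (elim \<omega>)
      define X where "X t = wealth mk \<pi> t \<omega>" for t
      have X: "continuous_on {0..T} X" "X 0 = x" "\<And>t. t \<in> {0..T} \<Longrightarrow> 0 \<le> X t"
        "\<And>t. t \<in> {0..T} \<Longrightarrow> X t = x + m t \<omega> + rate mk * integral {0..t} X"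
        using elim unfolding X_def by auto
      have ul: "uniform_limit {0..T} (\<lambda>k t. gain (P k) t \<omega>) (\<lambda>t. m t \<omega>) sequentially" using elim by blast
      \<comment> \<open>Two errors of \<open>d / 2\<close>: replacing the gains by their uniform
        limit, which discounting magnifies by at most \<open>K\<close>, and discretising variation
        of constants on a grid of at least \<open>n0\<close> steps.\<close>
      have close: "\<forall>\<^sub>F k in sequentially. \<forall>j\<le>n k. \<bar>D k \<omega> j - exp (- rate mk * grid T (n k) j) * X (grid T (n k) j)\<bar> \<le> d"
        if d: "0 < d" for d
      proof -
        define K where "K = 3 * exp (\<bar>rate mk\<bar> * T)"
        have K: "0 < K" by (simp add: K_def)
        obtain n0 where n0: "\<And>n j. n0 \<le> n \<Longrightarrow> j \<le> n \<Longrightarrow>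
          \<bar>x + discounted_sum (rate mk) T n (\<lambda>t. m t \<omega>) j - exp (- rate mk * grid T n j) * X (grid T n j)\<bar> \<le> d / 2"
          using discounted_sum_approx[OF T_pos X(1,2,4), of "d / 2"] d by auto
        have "\<forall>\<^sub>F k in sequentially. \<forall>t\<in>{0..T}. dist (gain (P k) t \<omega>) (m t \<omega>) < d / (2 * K)"
          using ul K d by (intro uniform_limitD) auto
        then show ?thesis using eventually_ge_at_top[of n0]
        proof eventually_elim
          case (elim k)
          show ?case
          proof (intro allI impI)
            fix j assume j: "j \<le> n k"
            have "\<bar>discounted_sum (rate mk) T (n k) (\<lambda>t. gain (P k) t \<omega>) j - discounted_sum (rate mk) T (n k) (\<lambda>t. m t \<omega>) j\<bar>
                \<le> K * (d / (2 * K))"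
              unfolding K_def using elim(1) unfolding K_def dist_real_def
              by (intro discounted_sum_perturb T_pos n j) (auto intro: less_imp_le)
            then have "\<bar>discounted_sum (rate mk) T (n k) (\<lambda>t. gain (P k) t \<omega>) j - discounted_sum (rate mk) T (n k) (\<lambda>t. m t \<omega>) j\<bar> \<le> d / 2"
              using K by simp
            moreover have "\<bar>x + discounted_sum (rate mk) T (n k) (\<lambda>t. m t \<omega>) j - exp (- rate mk * grid T (n k) j) * X (grid T (n k) j)\<bar> \<le> d / 2"
              using n0[of "n k" j] elim(2) n(1)[of k] j by simp
            ultimately show "\<bar>D k \<omega> j - exp (- rate mk * grid T (n k) j) * X (grid T (n k) j)\<bar> \<le> d"
              unfolding D_def discounted_gain_def by linarith
          qed
        qed
      qed
      \<comment> \<open>Admissibility enters here: discounted wealth is nonnegative at every grid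
        point, so an error of at most \<open>e\<close> cannot trigger the stopping.\<close>
      have "\<forall>\<^sub>F k in sequentially. stays_above (- e) (D k \<omega>) (n k) = 1"
        using close[OF e]
      proof eventually_elim
        case (elim k)
        have "- e \<le> D k \<omega> j" if "j \<le> n k" for j
        proof -
          have "0 \<le> exp (- rate mk * grid T (n k) j) * X (grid T (n k) j)"
            by (intro mult_nonneg_nonneg X(3) grid_in T_pos n that) simp
          then show ?thesis using elim that by force
        qed
        then show ?case by (simp add: stays_above_def)
      qed
      then have ev: "\<forall>\<^sub>F k in sequentially. f k \<omega> = ennreal (D k \<omega> (n k) + e)"
        by eventually_elim (simp add: f_def)
      have "(\<lambda>k. D k \<omega> (n k)) \<longlonglongrightarrow> Y \<omega>"
      proof (rule tendstoI)
        fix d :: real assume "0 < d"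
        then have "0 < d / 2" by simp
        from close[OF this] show "\<forall>\<^sub>F k in sequentially. dist (D k \<omega> (n k)) (Y \<omega>) < d"
        proof eventually_elim
          case (elim k)
          have "\<bar>D k \<omega> (n k) - Y \<omega>\<bar> \<le> d / 2"
            using elim[rule_format, of "n k"] n(2)[of k] by (simp add: grid_n Y_def X_def)
          then show ?case using \<open>0 < d\<close> by (simp add: dist_real_def)
        qed
      qed
      then have "(\<lambda>k. ennreal (D k \<omega> (n k) + e)) \<longlonglongrightarrow> ennreal (Y \<omega> + e)"
        by (intro tendsto_ennrealI tendsto_intros)
      then have "(\<lambda>k. f k \<omega>) \<longlonglongrightarrow> ennreal (Y \<omega> + e)"
        using ev by (simp add: tendsto_cong)
      from lim_imp_Liminf[OF _ this] show ?case by simp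
    qed
    then have "AE \<omega> in N. ennreal (Y \<omega> + e) \<le> liminf (\<lambda>k. f k \<omega>)" by (simp add: AE_N_iff)
    then have "(\<integral>\<^sup>+\<omega>. ennreal (Y \<omega> + e) \<partial>N) \<le> (\<integral>\<^sup>+\<omega>. liminf (\<lambda>k. f k \<omega>) \<partial>N)"
      by (rule nn_integral_mono_AE)
    also have "\<dots> \<le> liminf (\<lambda>k. \<integral>\<^sup>+\<omega>. f k \<omega> \<partial>N)" by (intro nn_integral_liminf) measurable
    also have "\<dots> \<le> liminf (\<lambda>k. ennreal (x + 2 * e + 1 / real (Suc k)))"
    proof (intro Liminf_mono always_eventually allI)
      fix k
      have "(\<integral>\<^sup>+\<omega>. f k \<omega> \<partial>N) \<le> ennreal (x + 2 * e + C k / real (n k))"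
        unfolding f_def D_def by (intro Cb n)
      also have "\<dots> \<le> ennreal (x + 2 * e + 1 / real (Suc k))" using n(3)[of k] by (intro ennreal_leI) simp
      finally show "(\<integral>\<^sup>+\<omega>. f k \<omega> \<partial>N) \<le> ennreal (x + 2 * e + 1 / real (Suc k))" .
    qed
    also have "\<dots> = ennreal (x + 2 * e)"
    proof (rule lim_imp_Liminf)
      have "(\<lambda>k. x + 2 * e + 1 / real (Suc k)) \<longlonglongrightarrow> x + 2 * e + 0"
        by (intro tendsto_add tendsto_const LIMSEQ_Suc[OF lim_1_over_n])
      then show "(\<lambda>k. ennreal (x + 2 * e + 1 / real (Suc k))) \<longlonglongrightarrow> ennreal (x + 2 * e)"
        by (intro tendsto_ennrealI) simp
    qed simp
    finally show ?thesis .
  qed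
  have "(\<integral>\<^sup>+\<omega>. ennreal (Y \<omega>) \<partial>N) \<le> ennreal x"
  proof (rule ennreal_le_epsilon)
    fix e :: real assume "0 < e"
    then have e: "0 < e / 2" by simp
    have "(\<integral>\<^sup>+\<omega>. ennreal (Y \<omega>) \<partial>N) \<le> (\<integral>\<^sup>+\<omega>. ennreal (Y \<omega> + e / 2) \<partial>N)"
      using e by (intro nn_integral_mono ennreal_leI) auto
    also have "\<dots> \<le> ennreal (x + 2 * (e / 2))" by (rule step[OF e])
    also have "\<dots> = ennreal x + ennreal e" using x \<open>0 < e\<close> by (simp add: ennreal_plus)
    finally show "(\<integral>\<^sup>+\<omega>. ennreal (Y \<omega>) \<partial>N) \<le> ennreal x + ennreal e" .
  qed
  then show "(\<integral>\<^sup>+\<omega>. ennreal (exp (- rate mk * T) * wealth mk \<pi> T \<omega>) \<partial>N) \<le> ennreal x"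
    by (simp add: Y_def)
qed

end

section \<open>The Neyman-Pearson argument\<close>

text \<open>
  The test \<open>c z \<le> 1\<close> selects the states in which a unit of capital reduces the shortfall by at
  least \<open>c\<close>.
\<close>

lemma neyman_pearson_pointwise:
  fixes h X z c :: real
  assumes "0 \<le> h" "0 \<le> X" "0 < z" "0 \<le> c"
  shows "h - (if c \<le> inverse z then h else 0) + c * (z * ((if c \<le> inverse z then h else 0) - X)) \<le> max 0 (h - X)"
proof (cases "c \<le> inverse z")
  case True
  then have cz: "0 \<le> c * z" "c * z \<le> 1" using assms by (auto simp: field_simps)
  show ?thesis
  proof (cases "X \<le> h")
    case True
    then have "c * z * (h - X) \<le> 1 * (h - X)" using cz by (intro mult_right_mono) auto
    then show ?thesis using \<open>c \<le> inverse z\<close> by (simp add: mult.assoc)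
  next
    case False
    then have "c * z * (h - X) \<le> 0" using cz by (intro mult_nonneg_nonpos) auto
    then show ?thesis using \<open>c \<le> inverse z\<close> by (simp add: mult.assoc)
  qed
next
  case False
  then have "1 \<le> c * z" using assms by (simp add: field_simps)
  then have "1 * X \<le> c * z * X" using assms by (intro mult_right_mono) auto
  then show ?thesis using False by (simp add: mult.assoc)
qed

lemma Least_is_minimum: "is_minimum m A \<Longrightarrow> (LEAST a. a \<in> A) = m"
  unfolding is_minimum_def by (rule Least_equality) auto

context black_scholes
begin

lemma expected_wealth_le:
  assumes adm: "admissible mk x \<pi>"
  shows "wealth mk \<pi> T \<in> borel_measurable M" "AE \<omega> in M. 0 \<le> wealth mk \<pi> T \<omega>"
    "integrable N (wealth mk \<pi> T)" "(\<integral>\<omega>. wealth mk \<pi> T \<omega> \<partial>N) \<le> exp (rate mk * T) * x"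
proof -
  have TT: "T \<in> {0..T}" using T_pos by simp
  have sf: "self_financing mk x \<pi>" using adm by (simp add: admissible_def)
  show m[measurable]: "wealth mk \<pi> T \<in> borel_measurable M"
    by (rule measurable_F_M[OF TT wealth_measurable[OF sf TT]])
  show nn: "AE \<omega> in M. 0 \<le> wealth mk \<pi> T \<omega>"
    using adm TT by (auto simp: admissible_def)
  define Y where "Y \<omega> = exp (- rate mk * T) * wealth mk \<pi> T \<omega>" for \<omega>
  have Ym[measurable]: "Y \<in> borel_measurable N" unfolding Y_def by measurable
  have Y0: "AE \<omega> in N. 0 \<le> Y \<omega>" unfolding AE_N_iff using nn by eventually_elim (simp add: Y_def)
  have le: "(\<integral>\<^sup>+\<omega>. ennreal (Y \<omega>) \<partial>N) \<le> ennreal x"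
    using admissible_supermartingale(2)[OF adm] by (simp add: Y_def)
  then have Yi: "integrable N Y"
    by (intro integrableI_nonneg Ym Y0) (auto intro: order_le_less_trans)
  have X_eq: "wealth mk \<pi> T = (\<lambda>\<omega>. exp (rate mk * T) * Y \<omega>)"
    by (simp add: Y_def fun_eq_iff mult.assoc[symmetric] flip: exp_add)
  show "integrable N (wealth mk \<pi> T)" unfolding X_eq using Yi by simp
  have "ennreal (\<integral>\<omega>. Y \<omega> \<partial>N) \<le> ennreal x"
    using le nn_integral_eq_integral[OF Yi Y0] by simp
  then have "(\<integral>\<omega>. Y \<omega> \<partial>N) \<le> x"
    using admissible_supermartingale(1)[OF adm] by (simp add: ennreal_le_iff)
  then show "(\<integral>\<omega>. wealth mk \<pi> T \<omega> \<partial>N) \<le> exp (rate mk * T) * x" unfolding X_eq by simp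
qed

context
  fixes H :: "'a \<Rightarrow> real"
  assumes claim: "contingent_claim mk H" and complete: "complete_market mk"
begin

lemma H_measurable_F: "H \<in> borel_measurable (F T)"
  and H_nonneg: "\<omega> \<in> space M \<Longrightarrow> 0 \<le> H \<omega>"
  and H_integrable: "integrable M H"
  using claim by (auto simp: contingent_claim_def)

lemma H_measurable[measurable]: "H \<in> borel_measurable M"
  using H_integrable by auto

lemma H_integrable_N: "integrable N H"
proof -
  have "integrable M (\<lambda>\<omega>. exp (- rate mk * T) * Z_T mk \<omega> * H \<omega>)"
    using claim by (simp add: contingent_claim_def)
  then have "integrable M (\<lambda>\<omega>. exp (rate mk * T) * (exp (- rate mk * T) * Z_T mk \<omega> * H \<omega>))"
    by (rule integrable_mult_right)
  also have "(\<lambda>\<omega>. exp (rate mk * T) * (exp (- rate mk * T) * Z_T mk \<omega> * H \<omega>)) = (\<lambda>\<omega>. Z T \<omega> * H \<omega>)"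
    by (simp add: fun_eq_iff Z_T_eq mult.assoc[symmetric] flip: exp_add)
  finally show ?thesis by (simp add: integrable_N_iff)
qed

definition payoff :: "real \<Rightarrow> 'a \<Rightarrow> real" where
  "payoff c \<omega> = H \<omega> * indicator (A_set mk c) \<omega>"

lemma payoff_eq: "\<omega> \<in> space M \<Longrightarrow> payoff c \<omega> = (if c \<le> inverse (Z T \<omega>) then H \<omega> else 0)"
  by (simp add: payoff_def A_set_def Z_T_eq)

lemma payoff_measurable_F: "payoff c \<in> borel_measurable (F T)"
proof -
  have TT: "T \<in> {0..T}" using T_pos by simp
  have [measurable]: "Z T \<in> borel_measurable (F T)" "H \<in> borel_measurable (F T)"
    using Z_measurable[of T T] T_pos H_measurable_F by auto
  have "A_set mk c = {\<omega> \<in> space (F T). c \<le> inverse (Z T \<omega>)}"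
    by (simp add: A_set_def Z_T_eq space_F[OF TT])
  also have "\<dots> \<in> sets (F T)" by measurable
  finally have [measurable]: "A_set mk c \<in> sets (F T)" .
  show ?thesis unfolding payoff_def by measurable
qed

lemma payoff_measurable[measurable]: "payoff c \<in> borel_measurable M"
  by (rule measurable_F_M[OF _ payoff_measurable_F]) (use T_pos in auto)

lemma payoff_bounds: "\<omega> \<in> space M \<Longrightarrow> 0 \<le> payoff c \<omega> \<and> payoff c \<omega> \<le> H \<omega>"
  using H_nonneg by (simp add: payoff_eq)

lemma payoff_integrable: "integrable M (payoff c)"
  by (rule Bochner_Integration.integrable_bound[OF H_integrable])
    (use payoff_bounds[of _ c] H_nonneg in \<open>auto intro!: AE_I2\<close>)

lemma payoff_integrable_N: "integrable N (payoff c)"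
  by (rule Bochner_Integration.integrable_bound[OF H_integrable_N])
    (use payoff_bounds[of _ c] H_nonneg in \<open>auto intro!: AE_I2\<close>)

lemma Psi1_eq: "Psi1 mk H c = (\<integral>\<omega>. payoff c \<omega> \<partial>M)"
  and Psi2_eq: "Psi2 mk H c = (\<integral>\<omega>. payoff c \<omega> \<partial>N)"
  by (simp_all add: Psi1_def Psi2_def payoff_def)

lemma payoff_0: "\<omega> \<in> space M \<Longrightarrow> payoff 0 \<omega> = H \<omega>"
  by (simp add: payoff_eq Z_pos less_imp_le)

lemma Psi1_0: "Psi1 mk H 0 = (\<integral>\<omega>. H \<omega> \<partial>M)"
  unfolding Psi1_eq by (intro Bochner_Integration.integral_cong refl payoff_0)

lemma Psi2_0: "Psi2 mk H 0 = (\<integral>\<omega>. H \<omega> \<partial>N)"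
  unfolding Psi2_eq by (intro Bochner_Integration.integral_cong refl payoff_0) simp

lemma price_payoff: "price mk (payoff c) = exp (- rate mk * T) * Psi2 mk H c"
  unfolding price_def Psi2_eq by simp

lemma price_H: "price mk H = exp (- rate mk * T) * Psi2 mk H 0"
  unfolding price_def Psi2_0 by simp

lemma replicable:
  assumes "G \<in> borel_measurable (F T)" "\<And>\<omega>. \<omega> \<in> space M \<Longrightarrow> 0 \<le> G \<omega>" "integrable N G"
  shows "\<exists>\<pi>. replicates mk G \<pi>"
  using complete assms unfolding complete_market_def by simp

lemma payoff_replicable: "\<exists>\<pi>. replicates mk (payoff c) \<pi>"
  using payoff_bounds by (intro replicable payoff_measurable_F payoff_integrable_N) auto

lemma shortfall_integrable:
  assumes adm: "admissible mk x \<pi>"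
  shows "integrable M (\<lambda>\<omega>. max 0 (H \<omega> - wealth mk \<pi> T \<omega>))"
proof (rule Bochner_Integration.integrable_bound[OF H_integrable])
  have [measurable]: "wealth mk \<pi> T \<in> borel_measurable M" by (rule expected_wealth_le[OF adm])
  show "(\<lambda>\<omega>. max 0 (H \<omega> - wealth mk \<pi> T \<omega>)) \<in> borel_measurable M" by measurable
  show "AE \<omega> in M. norm (max 0 (H \<omega> - wealth mk \<pi> T \<omega>)) \<le> norm (H \<omega>)"
    using expected_wealth_le(2)[OF adm] AE_space by eventually_elim (use H_nonneg in \<open>force simp: max_def\<close>)
qed

lemma shortfall_nonneg: "0 \<le> shortfall_risk mk H \<pi>"
  unfolding shortfall_risk_def by (intro integral_nonneg_AE AE_I2) simp

text \<open>The Lagrangian form of the bound, with \<open>c\<close> as multiplier of the budget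
  constraint. Expected wealth remains as a term, so the same inequality bounds the risk for given
  capital and the capital for given risk.\<close>

lemma shortfall_lower_bound:
  assumes adm: "admissible mk x \<pi>" and c: "0 \<le> c"
  shows "Psi1 mk H 0 - Psi1 mk H c + c * (Psi2 mk H c - (\<integral>\<omega>. wealth mk \<pi> T \<omega> \<partial>N)) \<le> shortfall_risk mk H \<pi>"
proof -
  define X where "X = wealth mk \<pi> T"
  note X = expected_wealth_le[OF adm, folded X_def]
  have [measurable]: "X \<in> borel_measurable M" by (rule X)
  have d: "integrable N (\<lambda>\<omega>. payoff c \<omega> - X \<omega>)" using payoff_integrable_N X(3) by simp
  then have i: "integrable M (\<lambda>\<omega>. Z T \<omega> * (payoff c \<omega> - X \<omega>))" by (simp add: integrable_N_iff)
  have e: "(\<integral>\<omega>. Z T \<omega> * (payoff c \<omega> - X \<omega>) \<partial>M) = Psi2 mk H c - (\<integral>\<omega>. X \<omega> \<partial>N)"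
    unfolding Psi2_eq using payoff_integrable_N X(3)
    by (simp add: integral_N_eq[symmetric] Bochner_Integration.integral_diff)
  have "Psi1 mk H 0 - Psi1 mk H c + c * (Psi2 mk H c - (\<integral>\<omega>. X \<omega> \<partial>N))
      = (\<integral>\<omega>. H \<omega> - payoff c \<omega> + c * (Z T \<omega> * (payoff c \<omega> - X \<omega>)) \<partial>M)"
    using i H_integrable payoff_integrable[of c] unfolding Psi1_0 Psi1_eq[of c] e[symmetric] by simp
  also have "\<dots> \<le> (\<integral>\<omega>. max 0 (H \<omega> - X \<omega>) \<partial>M)"
  proof (rule integral_mono_AE)
    show "integrable M (\<lambda>\<omega>. H \<omega> - payoff c \<omega> + c * (Z T \<omega> * (payoff c \<omega> - X \<omega>)))"
      using i H_integrable payoff_integrable[of c] by simp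
    show "integrable M (\<lambda>\<omega>. max 0 (H \<omega> - X \<omega>))"
      unfolding X_def by (rule shortfall_integrable[OF adm])
    show "AE \<omega> in M. H \<omega> - payoff c \<omega> + c * (Z T \<omega> * (payoff c \<omega> - X \<omega>)) \<le> max 0 (H \<omega> - X \<omega>)"
      using X(2) AE_space
    proof eventually_elim
      case (elim \<omega>)
      then show ?case
        unfolding payoff_eq[OF elim(2)] by (intro neyman_pearson_pointwise H_nonneg Z_pos c)
    qed
  qed
  finally show ?thesis unfolding shortfall_risk_def X_def .
qed

text \<open>The payoff lies between zero and \<open>H\<close>, so the positive part changes
  nothing.\<close>

lemma shortfall_replicating:
  assumes "AE \<omega> in M. wealth mk \<pi> T \<omega> = payoff c \<omega>" "wealth mk \<pi> T \<in> borel_measurable M"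
  shows "shortfall_risk mk H \<pi> = Psi1 mk H 0 - Psi1 mk H c"
proof -
  note [measurable] = assms(2)
  have "shortfall_risk mk H \<pi> = (\<integral>\<omega>. H \<omega> - payoff c \<omega> \<partial>M)"
    unfolding shortfall_risk_def
  proof (rule integral_cong_AE)
    show "AE \<omega> in M. max 0 (H \<omega> - wealth mk \<pi> T \<omega>) = H \<omega> - payoff c \<omega>"
      using assms(1) AE_space by eventually_elim (use payoff_bounds in \<open>auto simp: max_def\<close>)
  qed measurable
  then show ?thesis unfolding Psi1_0 Psi1_eq[of c] using H_integrable payoff_integrable by simp
qed

lemma replicates_payoff:
  assumes "replicates mk (payoff c) \<pi>"
  shows "admissible mk (exp (- rate mk * T) * Psi2 mk H c) \<pi>"
    "shortfall_risk mk H \<pi> = Psi1 mk H 0 - Psi1 mk H c"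
  using assms shortfall_replicating[of \<pi> c] expected_wealth_le(1)[of "price mk (payoff c)" \<pi>]
  unfolding replicates_def price_payoff by auto

section \<open>Minimal risk for given capital\<close>

lemma risk_below_price:
  assumes c: "0 \<le> c" and x: "Psi2 mk H c = exp (rate mk * T) * x"
  shows "is_minimum (Psi1 mk H 0 - Psi1 mk H c) (risks mk H x)"
    "replicates mk (payoff c) \<pi> \<Longrightarrow> admissible mk x \<pi> \<and> shortfall_risk mk H \<pi> = Psi1 mk H 0 - Psi1 mk H c"
proof -
  have xeq: "exp (- rate mk * T) * Psi2 mk H c = x"
    unfolding x by (simp add: mult.assoc[symmetric] flip: exp_add)
  show rep: "admissible mk x \<pi> \<and> shortfall_risk mk H \<pi> = Psi1 mk H 0 - Psi1 mk H c" if "replicates mk (payoff c) \<pi>" for \<pi>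
    using replicates_payoff[OF that] xeq by simp
  show "is_minimum (Psi1 mk H 0 - Psi1 mk H c) (risks mk H x)"
    unfolding is_minimum_def
  proof (intro conjI ballI)
    obtain \<pi> where "replicates mk (payoff c) \<pi>" using payoff_replicable by blast
    from rep[OF this] show "Psi1 mk H 0 - Psi1 mk H c \<in> risks mk H x"
      unfolding risks_def by (intro CollectI exI[of _ \<pi>]) simp
    fix a assume "a \<in> risks mk H x"
    then obtain \<pi> where adm: "admissible mk x \<pi>" and a: "a = shortfall_risk mk H \<pi>" by (auto simp: risks_def)
    have "0 \<le> c * (Psi2 mk H c - (\<integral>\<omega>. wealth mk \<pi> T \<omega> \<partial>N))"
      using c x expected_wealth_le(4)[OF adm] by (intro mult_nonneg_nonneg) auto
    then show "Psi1 mk H 0 - Psi1 mk H c \<le> a" using shortfall_lower_bound[OF adm c] a by linarith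
  qed
qed

lemma risk_above_price:
  assumes x: "price mk H \<le> x"
  shows "is_minimum 0 (risks mk H x)"
proof -
  \<comment> \<open>A strategy has to start from exactly \<open>x\<close>, so the surplus over the
    price is carried to maturity: \<open>k\<close> is its value there, and \<open>H + k\<close>
    costs exactly \<open>x\<close>.\<close>
  define k where "k = exp (rate mk * T) * (x - price mk H)"
  have k: "0 \<le> k" using x by (simp add: k_def)
  define G where "G \<omega> = H \<omega> + k" for \<omega>
  have Gi: "integrable N G" unfolding G_def using H_integrable_N by simp
  have "\<exists>\<pi>. replicates mk G \<pi>"
    using H_measurable_F H_nonneg k Gi by (intro replicable) (auto simp: G_def[abs_def])
  then obtain \<pi> where rep: "replicates mk G \<pi>" by blast
  have "price mk G = exp (- rate mk * T) * (Psi2 mk H 0 + k)"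
    unfolding price_def G_def Psi2_0 using H_integrable_N N.prob_space by simp
  also have "\<dots> = x"
    unfolding distrib_left price_H[symmetric] k_def by (simp add: mult.assoc[symmetric] flip: exp_add)
  finally have adm: "admissible mk x \<pi>" and w: "AE \<omega> in M. wealth mk \<pi> T \<omega> = G \<omega>"
    using rep by (auto simp: replicates_def)
  have "shortfall_risk mk H \<pi> = (\<integral>\<omega>. 0 \<partial>M)"
    unfolding shortfall_risk_def
  proof (rule integral_cong_AE)
    have [measurable]: "wealth mk \<pi> T \<in> borel_measurable M" by (rule expected_wealth_le[OF adm])
    show "(\<lambda>\<omega>. max 0 (H \<omega> - wealth mk \<pi> T \<omega>)) \<in> borel_measurable M" by measurable
    show "AE \<omega> in M. max 0 (H \<omega> - wealth mk \<pi> T \<omega>) = 0"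
      using w by eventually_elim (use k in \<open>simp add: G_def\<close>)
  qed simp
  then have "0 \<in> risks mk H x" using adm unfolding risks_def by (intro CollectI exI[of _ \<pi>]) simp
  then show ?thesis using shortfall_nonneg unfolding is_minimum_def risks_def by auto
qed

section \<open>Minimal capital for given risk\<close>

text \<open>A nonnegative shortfall with mean zero vanishes almost surely, under \<open>N\<close> as
  well by equivalence; the terminal wealth then dominates \<open>H\<close>. This covers the case of
  multiplier zero below.\<close>

lemma superhedging_cost:
  assumes adm: "admissible mk x \<pi>" and 0: "shortfall_risk mk H \<pi> \<le> 0"
  shows "price mk H \<le> x"
proof -
  have "(\<integral>\<omega>. max 0 (H \<omega> - wealth mk \<pi> T \<omega>) \<partial>M) = 0"
    using 0 shortfall_nonneg[of \<pi>] unfolding shortfall_risk_def by linarith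
  then have "AE \<omega> in M. max 0 (H \<omega> - wealth mk \<pi> T \<omega>) = 0"
    by (subst (asm) integral_nonneg_eq_0_iff_AE[OF shortfall_integrable[OF adm]]) auto
  then have "AE \<omega> in N. H \<omega> \<le> wealth mk \<pi> T \<omega>"
    unfolding AE_N_iff by eventually_elim (simp add: max_def split: if_splits)
  then have "(\<integral>\<omega>. H \<omega> \<partial>N) \<le> (\<integral>\<omega>. wealth mk \<pi> T \<omega> \<partial>N)"
    by (intro integral_mono_AE H_integrable_N expected_wealth_le[OF adm])
  also have "\<dots> \<le> exp (rate mk * T) * x" by (rule expected_wealth_le[OF adm])
  finally have "exp (- rate mk * T) * Psi2 mk H 0 \<le> exp (- rate mk * T) * (exp (rate mk * T) * x)"
    unfolding Psi2_0 by (intro mult_left_mono) auto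
  then show ?thesis unfolding price_H by (simp add: mult.assoc[symmetric] flip: exp_add)
qed

text \<open>The lower bound read in the other direction: a risk of at most \<open>v\<close> makes
  the multiplier term nonpositive, and dividing by \<open>c\<close> forces expected wealth up to
  \<open>Psi2 mk H c\<close>.\<close>

lemma cost_below_expectation:
  assumes c: "0 \<le> c" and v: "Psi1 mk H c = Psi1 mk H 0 - v"
  shows "is_minimum (exp (- rate mk * T) * Psi2 mk H c) (costs mk H v)"
    "replicates mk (payoff c) \<pi> \<Longrightarrow> admissible mk (exp (- rate mk * T) * Psi2 mk H c) \<pi> \<and> shortfall_risk mk H \<pi> \<le> v"
proof -
  show rep: "admissible mk (exp (- rate mk * T) * Psi2 mk H c) \<pi> \<and> shortfall_risk mk H \<pi> \<le> v"
    if "replicates mk (payoff c) \<pi>" for \<pi>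
    using replicates_payoff[OF that] v by simp
  show "is_minimum (exp (- rate mk * T) * Psi2 mk H c) (costs mk H v)"
    unfolding is_minimum_def
  proof (intro conjI ballI)
    obtain \<pi> where "replicates mk (payoff c) \<pi>" using payoff_replicable by blast
    from rep[OF this] show "exp (- rate mk * T) * Psi2 mk H c \<in> costs mk H v" unfolding costs_def by blast
    fix x assume "x \<in> costs mk H v"
    then obtain \<pi> where adm: "admissible mk x \<pi>" and s: "shortfall_risk mk H \<pi> \<le> v" by (auto simp: costs_def)
    show "exp (- rate mk * T) * Psi2 mk H c \<le> x"
    proof (cases "c = 0")
      \<comment> \<open>Without a multiplier the lower bound says nothing about wealth, but the
        equation for \<open>c\<close> now forces \<open>v = 0\<close>.\<close>
      case True
      then have "shortfall_risk mk H \<pi> \<le> 0" using s v by simp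
      then show ?thesis using superhedging_cost[OF adm] True by (simp add: price_H)
    next
      case False
      have "c * (Psi2 mk H c - (\<integral>\<omega>. wealth mk \<pi> T \<omega> \<partial>N)) \<le> 0"
        using shortfall_lower_bound[OF adm c] s v by linarith
      then have "Psi2 mk H c \<le> (\<integral>\<omega>. wealth mk \<pi> T \<omega> \<partial>N)"
        using False c by (simp add: mult_le_0_iff)
      also have "\<dots> \<le> exp (rate mk * T) * x" by (rule expected_wealth_le[OF adm])
      finally have "exp (- rate mk * T) * Psi2 mk H c \<le> exp (- rate mk * T) * (exp (rate mk * T) * x)"
        by (intro mult_left_mono) auto
      then show ?thesis by (simp add: mult.assoc[symmetric] flip: exp_add)
    qed
  qed
qed

text \<open>Replicating the zero payoff leaves the whole claim as shortfall, which is allowed here,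
  and no admissible strategy starts from negative capital.\<close>

lemma cost_above_expectation:
  assumes v: "(\<integral>\<omega>. H \<omega> \<partial>M) \<le> v"
  shows "is_minimum 0 (costs mk H v)"
proof -
  have "\<exists>\<pi>. replicates mk (\<lambda>_. 0) \<pi>" by (intro replicable) auto
  then obtain \<pi> where adm: "admissible mk 0 \<pi>" and w: "AE \<omega> in M. wealth mk \<pi> T \<omega> = 0"
    by (auto simp: replicates_def price_def)
  have "shortfall_risk mk H \<pi> = (\<integral>\<omega>. H \<omega> \<partial>M)"
    unfolding shortfall_risk_def
  proof (rule integral_cong_AE)
    have [measurable]: "wealth mk \<pi> T \<in> borel_measurable M" by (rule expected_wealth_le[OF adm])
    show "(\<lambda>\<omega>. max 0 (H \<omega> - wealth mk \<pi> T \<omega>)) \<in> borel_measurable M" by measurable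
    show "AE \<omega> in M. max 0 (H \<omega> - wealth mk \<pi> T \<omega>) = H \<omega>"
      using w AE_space by eventually_elim (use H_nonneg in \<open>simp add: max_def\<close>)
  qed measurable
  then have "0 \<in> costs mk H v" using adm v unfolding costs_def by (intro CollectI exI[of _ \<pi>]) simp
  then show ?thesis using admissible_supermartingale(1) unfolding is_minimum_def costs_def by blast
qed

end

end

theorem theorem3p6:
  fixes mk :: "('a, 'n::finite) bs_market" and H :: "'a \<Rightarrow> real"
  assumes "black_scholes_market mk"
    and "complete_market mk"
    and "contingent_claim mk H"
  shows
    "(\<forall>x c. 0 \<le> x \<and> x < price mk H \<and> 0 \<le> c \<and> Psi2 mk H c = exp (rate mk * horizon mk) * x \<longrightarrow>
        is_minimum (Phi1 mk H x) (risks mk H x) \<and>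
        Phi1 mk H x = Psi1 mk H 0 - Psi1 mk H c \<and>
        (\<exists>\<pi>. replicates mk (\<lambda>\<omega>. H \<omega> * indicator (A_set mk c) \<omega>) \<pi>) \<and>
        (\<forall>\<pi>. replicates mk (\<lambda>\<omega>. H \<omega> * indicator (A_set mk c) \<omega>) \<pi> \<longrightarrow>
             risk_minimizing mk H x \<pi>)) \<and>
     (\<forall>x \<ge> price mk H.
        is_minimum (Phi1 mk H x) (risks mk H x) \<and> Phi1 mk H x = 0) \<and>
     (\<forall>v c. 0 \<le> v \<and> v < (\<integral>\<omega>. H \<omega> \<partial>pspace mk) \<and> 0 \<le> c \<and> Psi1 mk H c = Psi1 mk H 0 - v \<longrightarrow>
        is_minimum (Phi2 mk H v) (costs mk H v) \<and>
        Phi2 mk H v = exp (- rate mk * horizon mk) * Psi2 mk H c \<and>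
        (\<exists>\<pi>. replicates mk (\<lambda>\<omega>. H \<omega> * indicator (A_set mk c) \<omega>) \<pi>) \<and>
        (\<forall>\<pi>. replicates mk (\<lambda>\<omega>. H \<omega> * indicator (A_set mk c) \<omega>) \<pi> \<longrightarrow>
             cost_minimizing mk H v \<pi>)) \<and>
     (\<forall>v \<ge> (\<integral>\<omega>. H \<omega> \<partial>pspace mk).
        is_minimum (Phi2 mk H v) (costs mk H v) \<and> Phi2 mk H v = 0)"
proof -
  interpret black_scholes mk by unfold_locales fact
  note claim = assms(3) and complete = assms(2)
  have payoff: "(\<lambda>\<omega>. H \<omega> * indicator (A_set mk c) \<omega>) = payoff H c" for c
    by (simp add: fun_eq_iff payoff_def[OF claim complete])
  have a: "is_minimum (Phi1 mk H x) (risks mk H x) \<and> Phi1 mk H x = Psi1 mk H 0 - Psi1 mk H c \<and>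
      (\<exists>\<pi>. replicates mk (payoff H c) \<pi>) \<and> (\<forall>\<pi>. replicates mk (payoff H c) \<pi> \<longrightarrow> risk_minimizing mk H x \<pi>)"
    if "0 \<le> c" "Psi2 mk H c = exp (rate mk * horizon mk) * x" for x c
  proof -
    note m = risk_below_price[OF claim complete that]
    have "Phi1 mk H x = Psi1 mk H 0 - Psi1 mk H c" unfolding Phi1_def by (rule Least_is_minimum[OF m(1)])
    then show ?thesis using m payoff_replicable[OF claim complete, of c] by (simp add: risk_minimizing_def)
  qed
  have b: "is_minimum (Phi1 mk H x) (risks mk H x) \<and> Phi1 mk H x = 0" if "price mk H \<le> x" for x
    using risk_above_price[OF claim complete that] Least_is_minimum[of 0 "risks mk H x"] by (simp add: Phi1_def)
  have c: "is_minimum (Phi2 mk H v) (costs mk H v) \<and> Phi2 mk H v = exp (- rate mk * horizon mk) * Psi2 mk H c \<and>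
      (\<exists>\<pi>. replicates mk (payoff H c) \<pi>) \<and> (\<forall>\<pi>. replicates mk (payoff H c) \<pi> \<longrightarrow> cost_minimizing mk H v \<pi>)"
    if "0 \<le> c" "Psi1 mk H c = Psi1 mk H 0 - v" for v c
  proof -
    note m = cost_below_expectation[OF claim complete that]
    have "Phi2 mk H v = exp (- rate mk * horizon mk) * Psi2 mk H c"
      unfolding Phi2_def by (rule Least_is_minimum[OF m(1)])
    then show ?thesis using m payoff_replicable[OF claim complete, of c] by (simp add: cost_minimizing_def)
  qed
  have d: "is_minimum (Phi2 mk H v) (costs mk H v) \<and> Phi2 mk H v = 0" if "(\<integral>\<omega>. H \<omega> \<partial>pspace mk) \<le> v" for v
    using cost_above_expectation[OF claim complete that] Least_is_minimum[of 0 "costs mk H v"] by (simp add: Phi2_def)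
  show ?thesis unfolding payoff using a b c d by blast
qed

end
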